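(* Let $(W_t)_{t\ge 0}$ be a standard Wiener process, $M_t=\sup_{0\le s\le t}W_s$, $m_t=\inf_{0\le s\le t}W_s$, and let $C_{W,M,m}$ be the copula of $(W_t,M_t,m_t)$ (which does not depend on $t>0$). Then $C_{W,M,m}$ (as a probability measure on $[0,1]^3$) is absolutely continuous with respect to the Lebesgue measure, and its support is the polyhedron $$P=\{(u,v,w)\in[0,1]^3:\ w\le 2u\le 1+v\},$$ which has exactly the seven vertices $$(0,0,0),\ (0,1,0),\ (1,1,0),\ (1,1,1),\ (1/2,0,1),\ (1/2,0,0),\ (1/2,1,1),$$ six faces (two rectangles, two trapezoids, two triangles) and eleven edges.
   Context: The Wiener process starts at $W_0=0$. A copula is the restriction to $[0,1]^3$ of a distribution function whose univariate margins are uniform on $[0,1]$; it is identified with the corresponding probability measure on $[0,1]^3$, and the support is the smallest closed set of full measure. By Sklar's theorem, for a random vector with continuous marginal distribution functions $F_1,F_2,F_3$ and joint distribution function $F$ there is a unique copula $C$ with $F(x_1,x_2,x_3)=C(F_1(x_1),F_2(x_2),F_3(x_3))$; equivalently $C$ is the joint distribution function of $(F_1(X_1),F_2(X_2),F_3(X_3))$. Concretely, $C_{W,M,m}$ is the joint distribution function of $(\Phi(W_1),\,2\Phi(M_1)-1,\,2\Phi(m_1))$, where $\Phi$ is the standard normal distribution function. *)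

theory Defs
  imports "HOL-Probability.Probability"
begin

text \<open>
  A standard Wiener process, indexed by reals of which only the nonnegative ones matter.
  All paths are continuous (not merely almost all), so that the running extrema are genuine
  extrema of continuous functions, hence random variables.
\<close>

locale wiener_process = prob_space \<Omega> for \<Omega> :: "'a measure" +
  fixes W :: "real \<Rightarrow> 'a \<Rightarrow> real"
  assumes wiener_measurable: "0 \<le> t \<Longrightarrow> random_variable borel (W t)"
    and wiener_start: "\<omega> \<in> space \<Omega> \<Longrightarrow> W 0 \<omega> = 0"
    and wiener_continuous: "\<omega> \<in> space \<Omega> \<Longrightarrow> continuous_on {0..} (\<lambda>t. W t \<omega>)"
    and wiener_increment: "0 \<le> s \<Longrightarrow> s < t \<Longrightarrow>
      distributed \<Omega> lborel (\<lambda>\<omega>. W t \<omega> - W s \<omega>) (normal_density 0 (sqrt (t - s)))"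
    and wiener_indep_increments: "\<And>(\<tau> :: nat \<Rightarrow> real) n. 0 \<le> \<tau> 0 \<Longrightarrow> strict_mono_on {..n} \<tau> \<Longrightarrow>
      indep_vars (\<lambda>_. borel) (\<lambda>i \<omega>. W (\<tau> (Suc i)) \<omega> - W (\<tau> i) \<omega>) {..<n}"

definition running_max :: "(real \<Rightarrow> 'a \<Rightarrow> real) \<Rightarrow> real \<Rightarrow> 'a \<Rightarrow> real" where
  "running_max W t \<omega> = (SUP s\<in>{0..t}. W s \<omega>)"

definition running_min :: "(real \<Rightarrow> 'a \<Rightarrow> real) \<Rightarrow> real \<Rightarrow> 'a \<Rightarrow> real" where
  "running_min W t \<omega> = (INF s\<in>{0..t}. W s \<omega>)"

definition cdf3 :: "(real \<times> real \<times> real) measure \<Rightarrow> real \<Rightarrow> real \<Rightarrow> real \<Rightarrow> real" where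
  "cdf3 \<mu> x y z = measure \<mu> ({..x} \<times> {..y} \<times> {..z})"

text \<open>
  A trivariate copula is represented by its probability measure; as a function it is the
  restriction of \<open>cdf3 \<mu>\<close> to the unit cube. The uniform margins
  force the measure to be concentrated on the unit cube.
\<close>

definition is_copula :: "(real \<times> real \<times> real) measure \<Rightarrow> bool" where
  "is_copula \<mu> \<longleftrightarrow> prob_space \<mu> \<and> sets \<mu> = sets borel \<and>
     distr \<mu> borel (\<lambda>(u, v, w). u) = uniform_measure lborel {0..1} \<and>
     distr \<mu> borel (\<lambda>(u, v, w). v) = uniform_measure lborel {0..1} \<and>
     distr \<mu> borel (\<lambda>(u, v, w). w) = uniform_measure lborel {0..1}"

text \<open>The relation of Sklar's theorem; distribution functions only take values in the unit
  interval, so only the restriction of \<open>cdf3 \<mu>\<close> to the unit cube enters.\<close>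

definition is_copula_of ::
  "'a measure \<Rightarrow> ('a \<Rightarrow> real) \<Rightarrow> ('a \<Rightarrow> real) \<Rightarrow> ('a \<Rightarrow> real) \<Rightarrow> (real \<times> real \<times> real) measure \<Rightarrow> bool"
where
  "is_copula_of \<Omega> X Y Z \<mu> \<longleftrightarrow> is_copula \<mu> \<and>
     (\<forall>x y z. cdf3 (distr \<Omega> borel (\<lambda>\<omega>. (X \<omega>, Y \<omega>, Z \<omega>))) x y z =
        cdf3 \<mu> (cdf (distr \<Omega> borel X) x) (cdf (distr \<Omega> borel Y) y) (cdf (distr \<Omega> borel Z) z))"

definition is_support :: "'a::topological_space measure \<Rightarrow> 'a set \<Rightarrow> bool" where
  "is_support \<mu> S \<longleftrightarrow> closed S \<and> emeasure \<mu> S = emeasure \<mu> (space \<mu>) \<and>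
     (\<forall>T. closed T \<and> emeasure \<mu> T = emeasure \<mu> (space \<mu>) \<longrightarrow> S \<subseteq> T)"

definition wiener_polyhedron :: "(real \<times> real \<times> real) set" where
  "wiener_polyhedron = {(u, v, w). u \<in> {0..1} \<and> v \<in> {0..1} \<and> w \<in> {0..1} \<and>
     w \<le> 2 * u \<and> 2 * u \<le> 1 + v}"

definition is_triangle :: "'a::euclidean_space set \<Rightarrow> bool" where
  "is_triangle F \<longleftrightarrow> (\<exists>a b c. \<not> collinear {a, b, c} \<and> F = convex hull {a, b, c})"

definition is_rectangle :: "'a::euclidean_space set \<Rightarrow> bool" where
  "is_rectangle F \<longleftrightarrow> (\<exists>a b c d. a \<noteq> b \<and> a \<noteq> d \<and> (b - a) \<bullet> (d - a) = 0 \<and> c - d = b - a \<and>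
     F = convex hull {a, b, c, d})"

text \<open>
  Trapezoids in the exclusive sense: exactly one pair of opposite sides is parallel. With
  \<open>c - d = k (b - a)\<close>, the condition \<open>k > 0\<close> makes \<open>a b c d\<close> a convex quadrilateral with
  its vertices in cyclic order, and \<open>k \<noteq> 1\<close> says that \<open>a d\<close> and \<open>b c\<close> are not parallel.
\<close>

definition is_trapezoid :: "'a::euclidean_space set \<Rightarrow> bool" where
  "is_trapezoid F \<longleftrightarrow> (\<exists>a b c d k. \<not> collinear {a, b, d} \<and> 0 < k \<and> k \<noteq> 1 \<and>
     c - d = k *\<^sub>R (b - a) \<and> F = convex hull {a, b, c, d})"

end

theory Submission
  imports Defs
begin

text \<open>
  By the reflection principle \<open>M\<^sub>t\<close> and \<open>- m\<^sub>t\<close> have the law of \<open>\<bar>W\<^sub>t\<bar>\<close>, so by Brownian scaling the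
  copula is, for every \<open>t\<close>, the law of \<open>(\<Phi>(W\<^sub>1), 2 \<Phi>(M\<^sub>1) - 1, 2 \<Phi>(m\<^sub>1))\<close>; the inequalities
  \<open>m\<^sub>1 \<le> W\<^sub>1 \<le> M\<^sub>1\<close> and \<open>m\<^sub>1 \<le> 0 \<le> M\<^sub>1\<close> become those of the polyhedron.

  No formula for the joint density of \<open>(W\<^sub>1, M\<^sub>1, m\<^sub>1)\<close> is needed. If the maximum is attained before a
  rational time \<open>s\<close> and the minimum after it, the triple is \<open>(W\<^sub>s + Y, M\<^sub>s, W\<^sub>s + m')\<close>, where \<open>(Y, m')\<close> is
  the increment and the minimum of the path after \<open>s\<close>, independent of the path before \<open>s\<close>. Given the
  latter, \<open>(W\<^sub>s + Y, W\<^sub>s + m')\<close> is a translate of \<open>(Y, m')\<close>; the same device applied to \<open>(Y, m')\<close> reduces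
  absolute continuity to that of the one-dimensional margins.

  The support is full because \<open>W\<close> stays with positive probability close to the polygonal path
  \<open>0 \<rightarrow> y \<rightarrow> z \<rightarrow> x\<close>: on a step of length \<open>h\<close> the event of leaving a tube of width \<open>d\<close> has probability
  \<open>O(h)\<close>, whereas the increment hits a prescribed interval of length \<open>2dh\<close> with probability of order \<open>\<surd>h\<close>.
\<close>

section \<open>Laws and independence under pointwise limits\<close>

text \<open>The defining properties of \<open>W\<close> speak only of finitely many increments,
  whereas the extrema range over a continuum of times. Facts about the extrema are therefore proved
  for the triple (end value, maximum, minimum) on a finite grid, which is a function of independent
  increments, and carried over by pointwise limits: bounded continuous test functions preserve both
  equality of laws and independence. This takes the place of path space, filtrations and the strong
  Markov property. The reflection principle, too, is proved on deterministic grid times, with a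
  first-crossing index instead of a stopping time; the grid limit leaves a gap between strict and
  weak inequalities, which is closed by moving the level.

  Separation by a rational time requires two events to be null: an extremum attained at the final
  time, and the maximum and minimum attained at the same time. The first is the delicate one,
  because the law of the maximum alone does not exclude it; it needs a self-referential estimate
  from scaling and independence.\<close>

lemma closed_set_approximation:
  fixes F :: "'a::metric_space set"
  assumes "closed F"
  obtains g :: "nat \<Rightarrow> 'a \<Rightarrow> real" where "\<And>k. continuous_on UNIV (g k)" "\<And>k x. 0 \<le> g k x" "\<And>k x. g k x \<le> 1"
    "\<And>x. (\<lambda>k. g k x) \<longlonglongrightarrow> indicator F x"
proof (cases "F = {}")
  case True
  then show ?thesis by (intro that[of "\<lambda>_ _. 0"]) auto
next
  case False
  \<comment> \<open>A truncated linear function of the distance: it is \<open>1\<close> on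
    \<open>F\<close> and vanishes at \<open>x\<close> as soon as \<open>k\<close> exceeds the
    reciprocal of the positive distance. The empty set is treated apart because
    \<open>infdist x {}\<close> is \<open>0\<close> by convention.\<close>
  define g where "g k x = max 0 (1 - real k * infdist x F)" for k x
  have "(\<lambda>k. g k x) \<longlonglongrightarrow> indicator F x" for x
  proof (cases "x \<in> F")
    case True
    then show ?thesis by (simp add: g_def)
  next
    case notin: False
    have "infdist x F > 0"
      using notin False assms infdist_nonneg[of x F] in_closed_iff_infdist_zero[of F x] by force
    then have "eventually (\<lambda>k. 1 - real k * infdist x F \<le> 0) sequentially" by real_asymp
    then have "eventually (\<lambda>k. g k x = 0) sequentially"
      by eventually_elim (simp add: g_def max_def)
    then show ?thesis using notin by (simp add: tendsto_eventually)
  qed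
  moreover have "continuous_on UNIV (g k)" for k
    unfolding g_def by (intro continuous_intros)
  moreover have "0 \<le> g k x" "g k x \<le> 1" for k x
    by (auto simp: g_def infdist_nonneg)
  ultimately show ?thesis by (intro that[of g]) auto
qed

lemma (in prob_space) closed_set_prob_eq_lim:
  fixes X' :: "'a \<Rightarrow> 'b::metric_space"
  assumes g: "\<And>x. (\<lambda>k. g k x) \<longlonglongrightarrow> indicator F x" "\<And>k. continuous_on UNIV (g k)"
      "\<And>k x. 0 \<le> g k x" "\<And>k x. g k x \<le> (1::real)" and F: "closed F"
    and X: "X' \<in> borel_measurable M"
  shows "(\<lambda>k. expectation (\<lambda>\<omega>. g k (X' \<omega>))) \<longlonglongrightarrow> prob (X' -` F \<inter> space M)"
proof -
  have meas: "g k \<in> borel_measurable borel" for k using g(2) by (rule borel_measurable_continuous_onI)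
  have "(\<lambda>k. \<integral>\<omega>. g k (X' \<omega>) \<partial>M) \<longlonglongrightarrow> (\<integral>\<omega>. indicator F (X' \<omega>) \<partial>M)"
  proof (rule integral_dominated_convergence[where w="\<lambda>_. 1"])
    show "AE \<omega> in M. (\<lambda>k. g k (X' \<omega>)) \<longlonglongrightarrow> indicator F (X' \<omega>)" using g(1) by simp
    have "F \<in> sets borel" using F by (rule borel_closed)
    then show "(\<lambda>\<omega>. indicator F (X' \<omega>)) \<in> borel_measurable M" using X by measurable
    show "(\<lambda>\<omega>. g k (X' \<omega>)) \<in> borel_measurable M" for k using X meas by measurable
  qed (use g(3,4) in auto)
  also have "(\<integral>\<omega>. indicator F (X' \<omega>) \<partial>M) = (\<integral>\<omega>. indicator (X' -` F \<inter> space M) \<omega> \<partial>M)"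
    by (rule Bochner_Integration.integral_cong) (auto simp: indicator_def)
  finally show ?thesis by simp
qed


lemma sets_borel_eq_sigma_closed: "sets borel = sigma_sets UNIV (Collect closed)"
  by (simp add: borel_eq_closed)

lemma expectation_LIMSEQ_continuous_bounded:
  fixes X :: "nat \<Rightarrow> 'a \<Rightarrow> 'b::metric_space"
  assumes "prob_space M" and g: "continuous_on UNIV g" "\<And>x. 0 \<le> g x" "\<And>x. g x \<le> (1::real)"
    and X: "\<And>n. X n \<in> borel_measurable M" "X' \<in> borel_measurable M"
    and lim: "\<And>\<omega>. \<omega> \<in> space M \<Longrightarrow> (\<lambda>n. X n \<omega>) \<longlonglongrightarrow> X' \<omega>"
  shows "(\<lambda>n. \<integral>\<omega>. g (X n \<omega>) \<partial>M) \<longlonglongrightarrow> (\<integral>\<omega>. g (X' \<omega>) \<partial>M)"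
proof -
  interpret prob_space M by fact
  have meas: "g \<in> borel_measurable borel" using g(1) by (rule borel_measurable_continuous_onI)
  show ?thesis
  proof (rule integral_dominated_convergence[where w="\<lambda>_. 1"])
    show "AE \<omega> in M. (\<lambda>n. g (X n \<omega>)) \<longlonglongrightarrow> g (X' \<omega>)"
    proof (rule AE_I2)
      fix \<omega> assume "\<omega> \<in> space M"
      moreover have "isCont g (X' \<omega>)" using g(1) by (simp add: continuous_on_eq_continuous_at)
      ultimately show "(\<lambda>n. g (X n \<omega>)) \<longlonglongrightarrow> g (X' \<omega>)" using lim isCont_tendsto_compose by blast
    qed
    show "(\<lambda>\<omega>. g (X n \<omega>)) \<in> borel_measurable M" for n using X(1) meas by measurable
    show "(\<lambda>\<omega>. g (X' \<omega>)) \<in> borel_measurable M" using X(2) meas by measurable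
  qed (use g(2,3) in auto)
qed

text \<open>Expectations of bounded continuous functions pass to the limit by dominated convergence,
  and these expectations determine the measure of closed sets, an intersection-stable generator of
  the Borel sets. The two sequences may live on different probability spaces.\<close>

lemma distr_eq_LIMSEQ:
  fixes X :: "nat \<Rightarrow> 'a \<Rightarrow> 'c::metric_space" and Y :: "nat \<Rightarrow> 'b \<Rightarrow> 'c"
  assumes M: "prob_space M" and N: "prob_space N"
    and X: "\<And>n. X n \<in> borel_measurable M" and Y: "\<And>n. Y n \<in> borel_measurable N"
    and limX: "\<And>\<omega>. \<omega> \<in> space M \<Longrightarrow> (\<lambda>n. X n \<omega>) \<longlonglongrightarrow> X' \<omega>"
    and limY: "\<And>\<omega>. \<omega> \<in> space N \<Longrightarrow> (\<lambda>n. Y n \<omega>) \<longlonglongrightarrow> Y' \<omega>"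
    and eq: "\<And>n. distr M borel (X n) = distr N borel (Y n)"
  shows "distr M borel X' = distr N borel Y'"
proof -
  interpret M: prob_space M by fact
  interpret N: prob_space N by fact
  have X': "X' \<in> borel_measurable M" by (rule borel_measurable_LIMSEQ_metric[OF X limX])
  have Y': "Y' \<in> borel_measurable N" by (rule borel_measurable_LIMSEQ_metric[OF Y limY])
  have "M.prob (X' -` F \<inter> space M) = N.prob (Y' -` F \<inter> space N)" if F: "closed F" for F
  proof -
    from closed_set_approximation[OF F] obtain g :: "nat \<Rightarrow> 'c \<Rightarrow> real" where
      g: "\<And>k. continuous_on UNIV (g k)" "\<And>k x. 0 \<le> g k x" "\<And>k x. g k x \<le> 1"
        "\<And>x. (\<lambda>k. g k x) \<longlonglongrightarrow> indicator F x" by metis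
    have meas: "g k \<in> borel_measurable borel" for k using g(1) by (rule borel_measurable_continuous_onI)
    have "(\<integral>\<omega>. g k (X' \<omega>) \<partial>M) = (\<integral>\<omega>. g k (Y' \<omega>) \<partial>N)" for k
    proof (rule LIMSEQ_unique)
      show "(\<lambda>n. \<integral>\<omega>. g k (X n \<omega>) \<partial>M) \<longlonglongrightarrow> (\<integral>\<omega>. g k (X' \<omega>) \<partial>M)"
        by (rule expectation_LIMSEQ_continuous_bounded[OF M g(1-3) X X' limX])
      have "(\<integral>\<omega>. g k (X n \<omega>) \<partial>M) = (\<integral>\<omega>. g k (Y n \<omega>) \<partial>N)" for n
        using arg_cong[OF eq[of n], of "\<lambda>D. integral\<^sup>L D (g k)"] X Y meas by (simp add: integral_distr)
      then show "(\<lambda>n. \<integral>\<omega>. g k (X n \<omega>) \<partial>M) \<longlonglongrightarrow> (\<integral>\<omega>. g k (Y' \<omega>) \<partial>N)"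
        using expectation_LIMSEQ_continuous_bounded[OF N g(1-3) Y Y' limY] by simp
    qed
    then have "(\<lambda>k. \<integral>\<omega>. g k (X' \<omega>) \<partial>M) \<longlonglongrightarrow> N.prob (Y' -` F \<inter> space N)"
      using N.closed_set_prob_eq_lim[OF g(4,1-3) F Y'] by simp
    with M.closed_set_prob_eq_lim[OF g(4,1-3) F X'] show ?thesis by (rule LIMSEQ_unique)
  qed
  then have "emeasure (distr M borel X') F = emeasure (distr N borel Y') F" if "closed F" for F
    using that X' Y' by (simp add: emeasure_distr M.emeasure_eq_measure N.emeasure_eq_measure)
  then show ?thesis
    by (intro measure_eqI_generator_eq[where E="Collect closed" and \<Omega>=UNIV and A="\<lambda>_. UNIV"])
       (auto simp: Int_stable_def sets_borel_eq_sigma_closed emeasure_distr X' Y' M.emeasure_eq_measure)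
qed

text \<open>Independence is tested on products of bounded continuous functions, where the
  factorization of the expectation survives a pointwise limit. A second limit, from test functions
  to indicators of closed sets, gives the product rule on a generator.\<close>

lemma (in prob_space) indep_vars_LIMSEQ:
  fixes X :: "nat \<Rightarrow> 'i \<Rightarrow> 'a \<Rightarrow> 'c::metric_space"
  assumes I: "finite I" "I \<noteq> {}" and ind: "\<And>n. indep_vars (\<lambda>_. borel) (X n) I"
    and lim: "\<And>i \<omega>. i \<in> I \<Longrightarrow> \<omega> \<in> space M \<Longrightarrow> (\<lambda>n. X n i \<omega>) \<longlonglongrightarrow> X' i \<omega>"
  shows "indep_vars (\<lambda>_. borel) X' I"
proof -
  have X: "X n i \<in> borel_measurable M" if "i \<in> I" for n i
    using ind that by (auto simp: indep_vars_def)
  have X': "X' i \<in> borel_measurable M" if "i \<in> I" for i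
    by (rule borel_measurable_LIMSEQ_metric[OF X lim]) (use that in auto)
  have "prob (\<Inter>i\<in>I. X' i -` A i \<inter> space M) = (\<Prod>i\<in>I. prob (X' i -` A i \<inter> space M))"
    if A: "A \<in> (\<Pi> i\<in>I. Collect closed)" for A
  proof -
    have "\<forall>i\<in>I. \<exists>g :: nat \<Rightarrow> 'c \<Rightarrow> real. (\<forall>k. continuous_on UNIV (g k)) \<and> (\<forall>k x. 0 \<le> g k x) \<and> (\<forall>k x. g k x \<le> 1) \<and>
        (\<forall>x. (\<lambda>k. g k x) \<longlonglongrightarrow> indicator (A i) x)"
    proof
      fix i assume "i \<in> I"
      then have "closed (A i)" using A by auto
      from closed_set_approximation[OF this] show "\<exists>g :: nat \<Rightarrow> 'c \<Rightarrow> real. (\<forall>k. continuous_on UNIV (g k)) \<and>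
        (\<forall>k x. 0 \<le> g k x) \<and> (\<forall>k x. g k x \<le> 1) \<and> (\<forall>x. (\<lambda>k. g k x) \<longlonglongrightarrow> indicator (A i) x)" by metis
    qed
    then obtain g :: "'i \<Rightarrow> nat \<Rightarrow> 'c \<Rightarrow> real" where
      g: "\<And>i k. i \<in> I \<Longrightarrow> continuous_on UNIV (g i k)" "\<And>i k x. i \<in> I \<Longrightarrow> 0 \<le> g i k x"
         "\<And>i k x. i \<in> I \<Longrightarrow> g i k x \<le> 1" "\<And>i x. i \<in> I \<Longrightarrow> (\<lambda>k. g i k x) \<longlonglongrightarrow> indicator (A i) x"
      by metis
    have meas: "g i k \<in> borel_measurable borel" if "i \<in> I" for i k
      using g(1)[OF that] by (rule borel_measurable_continuous_onI)
    have gX: "(\<lambda>\<omega>. g i k (X n i \<omega>)) \<in> borel_measurable M" "(\<lambda>\<omega>. g i k (X' i \<omega>)) \<in> borel_measurable M"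
      if "i \<in> I" for i k n using X[OF that] X'[OF that] meas[OF that] by measurable
    have prod1: "\<bar>\<Prod>i\<in>I. g i k (Z i)\<bar> \<le> 1" for k Z
      using g(2,3) by (simp add: abs_prod prod_le_1)
    \<comment> \<open>For fixed \<open>k\<close> the test functions are continuous, so the limit in
      \<open>n\<close> can be taken; only afterwards does \<open>k\<close> tend to infinity, where
      the limit functions are indicators and no longer continuous.\<close>
    have step: "(\<integral>\<omega>. (\<Prod>i\<in>I. g i k (X' i \<omega>)) \<partial>M) = (\<Prod>i\<in>I. \<integral>\<omega>. g i k (X' i \<omega>) \<partial>M)" for k
    proof (rule LIMSEQ_unique)
      show "(\<lambda>n. \<integral>\<omega>. (\<Prod>i\<in>I. g i k (X n i \<omega>)) \<partial>M) \<longlonglongrightarrow> (\<integral>\<omega>. (\<Prod>i\<in>I. g i k (X' i \<omega>)) \<partial>M)"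
      proof (rule integral_dominated_convergence[where w="\<lambda>_. 1"])
        show "AE \<omega> in M. (\<lambda>n. \<Prod>i\<in>I. g i k (X n i \<omega>)) \<longlonglongrightarrow> (\<Prod>i\<in>I. g i k (X' i \<omega>))"
        proof (intro AE_I2 tendsto_prod)
          fix \<omega> i assume *: "\<omega> \<in> space M" "i \<in> I"
          moreover have "isCont (g i k) (X' i \<omega>)" using g(1) * by (simp add: continuous_on_eq_continuous_at)
          ultimately show "(\<lambda>n. g i k (X n i \<omega>)) \<longlonglongrightarrow> g i k (X' i \<omega>)" using lim isCont_tendsto_compose by blast
        qed
        show "(\<lambda>\<omega>. \<Prod>i\<in>I. g i k (X n i \<omega>)) \<in> borel_measurable M" for n
          using gX(1) by (rule borel_measurable_prod)
        show "(\<lambda>\<omega>. \<Prod>i\<in>I. g i k (X' i \<omega>)) \<in> borel_measurable M"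
          using gX(2) by (rule borel_measurable_prod)
        show "AE \<omega> in M. norm (\<Prod>i\<in>I. g i k (X n i \<omega>)) \<le> 1" for n using prod1 by simp
      qed simp
      have "(\<integral>\<omega>. (\<Prod>i\<in>I. g i k (X n i \<omega>)) \<partial>M) = (\<Prod>i\<in>I. \<integral>\<omega>. g i k (X n i \<omega>) \<partial>M)" for n
      proof (rule indep_vars_lebesgue_integral)
        show "indep_vars (\<lambda>_. borel) (\<lambda>i \<omega>. g i k (X n i \<omega>)) I"
          by (rule indep_vars_compose2[OF ind meas])
        show "integrable M (\<lambda>\<omega>. g i k (X n i \<omega>))" if "i \<in> I" for i
          by (rule integrable_const_bound[of _ 1]) (use that gX g(2,3) in auto)
      qed (rule I)
      moreover have "(\<lambda>n. \<Prod>i\<in>I. \<integral>\<omega>. g i k (X n i \<omega>) \<partial>M) \<longlonglongrightarrow> (\<Prod>i\<in>I. \<integral>\<omega>. g i k (X' i \<omega>) \<partial>M)"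
      proof (intro tendsto_prod)
        fix i assume i: "i \<in> I"
        show "(\<lambda>n. \<integral>\<omega>. g i k (X n i \<omega>) \<partial>M) \<longlonglongrightarrow> (\<integral>\<omega>. g i k (X' i \<omega>) \<partial>M)"
          by (rule expectation_LIMSEQ_continuous_bounded[OF prob_space_axioms g(1-3)[OF i] X[OF i] X'[OF i] lim[OF i]])
      qed
      ultimately show "(\<lambda>n. \<integral>\<omega>. (\<Prod>i\<in>I. g i k (X n i \<omega>)) \<partial>M) \<longlonglongrightarrow> (\<Prod>i\<in>I. \<integral>\<omega>. g i k (X' i \<omega>) \<partial>M)"
        by simp
    qed
    have ind_prod: "(\<Prod>i\<in>I. indicator (A i) (X' i \<omega>)) = (indicator (\<Inter>i\<in>I. X' i -` A i \<inter> space M) \<omega> :: real)"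
      if "\<omega> \<in> space M" for \<omega>
    proof (cases "\<forall>i\<in>I. X' i \<omega> \<in> A i")
      case True
      then show ?thesis using that by (simp add: indicator_def)
    next
      case False
      then have "(\<Prod>i\<in>I. indicator (A i) (X' i \<omega>)) = (0 :: real)" using I(1) by (intro prod_zero) (auto simp: indicator_def)
      then show ?thesis using False by (auto simp: indicator_def)
    qed
    show ?thesis
    proof (rule LIMSEQ_unique)
      have "(\<lambda>k. \<integral>\<omega>. (\<Prod>i\<in>I. g i k (X' i \<omega>)) \<partial>M) \<longlonglongrightarrow> (\<integral>\<omega>. indicator (\<Inter>i\<in>I. X' i -` A i \<inter> space M) \<omega> \<partial>M)"
      proof (rule integral_dominated_convergence[where w="\<lambda>_. 1"])
        show "AE \<omega> in M. (\<lambda>k. \<Prod>i\<in>I. g i k (X' i \<omega>)) \<longlonglongrightarrow> indicator (\<Inter>i\<in>I. X' i -` A i \<inter> space M) \<omega>"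
        proof (rule AE_I2)
          fix \<omega> assume \<omega>: "\<omega> \<in> space M"
          show "(\<lambda>k. \<Prod>i\<in>I. g i k (X' i \<omega>)) \<longlonglongrightarrow> indicator (\<Inter>i\<in>I. X' i -` A i \<inter> space M) \<omega>"
            unfolding ind_prod[OF \<omega>, symmetric] by (intro tendsto_prod g(4))
        qed
        show "(\<lambda>\<omega>. \<Prod>i\<in>I. g i k (X' i \<omega>)) \<in> borel_measurable M" for k
          using gX(2) by (rule borel_measurable_prod)
        show "AE \<omega> in M. norm (\<Prod>i\<in>I. g i k (X' i \<omega>)) \<le> 1" for k using prod1 by simp
        have "X' i -` A i \<inter> space M \<in> sets M" if "i \<in> I" for i
          using X'[OF that] A that by (intro measurable_sets[of _ _ borel] borel_closed) auto
        then show "indicator (\<Inter>i\<in>I. X' i -` A i \<inter> space M) \<in> borel_measurable M"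
          using I by (intro borel_measurable_indicator sets.finite_INT) auto
      qed simp
      then show "(\<lambda>k. \<integral>\<omega>. (\<Prod>i\<in>I. g i k (X' i \<omega>)) \<partial>M) \<longlonglongrightarrow> prob (\<Inter>i\<in>I. X' i -` A i \<inter> space M)"
      proof -
        have "(\<Inter>i\<in>I. X' i -` A i \<inter> space M) \<inter> space M = (\<Inter>i\<in>I. X' i -` A i \<inter> space M)"
          using I(2) by auto
        moreover assume "(\<lambda>k. \<integral>\<omega>. (\<Prod>i\<in>I. g i k (X' i \<omega>)) \<partial>M) \<longlonglongrightarrow> (\<integral>\<omega>. indicator (\<Inter>i\<in>I. X' i -` A i \<inter> space M) \<omega> \<partial>M)"
        ultimately show ?thesis by simp
      qed
      show "(\<lambda>k. \<integral>\<omega>. (\<Prod>i\<in>I. g i k (X' i \<omega>)) \<partial>M) \<longlonglongrightarrow> (\<Prod>i\<in>I. prob (X' i -` A i \<inter> space M))"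
        unfolding step
      proof (intro tendsto_prod)
        fix i assume i: "i \<in> I"
        show "(\<lambda>k. \<integral>\<omega>. g i k (X' i \<omega>) \<partial>M) \<longlonglongrightarrow> prob (X' i -` A i \<inter> space M)"
          by (rule closed_set_prob_eq_lim[OF g(4)[OF i] g(1-3)[OF i] _ X'[OF i]]) (use A i in auto)
      qed
    qed
  qed
  then show ?thesis
    by (subst indep_vars_finite[where E="\<lambda>_. Collect closed"])
       (use I X' in \<open>auto simp: Int_stable_def sets_borel_eq_sigma_closed\<close>)
qed

text \<open>Dominated convergence for indicators. The events need not be monotone in
  \<open>n\<close>; the crossing events on successive grids, to which this is applied, are not
  nested.\<close>

lemma (in prob_space) prob_LIMSEQ_eventually:
  assumes A: "\<And>n. A n \<in> events" "B \<in> events"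
    and ev: "\<And>\<omega>. \<omega> \<in> space M \<Longrightarrow> eventually (\<lambda>n. \<omega> \<in> A n \<longleftrightarrow> \<omega> \<in> B) sequentially"
  shows "(\<lambda>n. prob (A n)) \<longlonglongrightarrow> prob B"
proof -
  have "(\<lambda>n. \<integral>\<omega>. indicator (A n) \<omega> \<partial>M) \<longlonglongrightarrow> (\<integral>\<omega>. (indicator B \<omega> :: real) \<partial>M)"
  proof (rule integral_dominated_convergence[where w="\<lambda>_. 1"])
    show "AE \<omega> in M. (\<lambda>n. indicator (A n) \<omega>) \<longlonglongrightarrow> (indicator B \<omega> :: real)"
    proof (rule AE_I2)
      fix \<omega> assume "\<omega> \<in> space M"
      from ev[OF this] have "eventually (\<lambda>n. indicator (A n) \<omega> = (indicator B \<omega> :: real)) sequentially"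
        by eventually_elim (simp add: indicator_def)
      then show "(\<lambda>n. indicator (A n) \<omega>) \<longlonglongrightarrow> (indicator B \<omega> :: real)" by (rule tendsto_eventually)
    qed
  qed (use A in \<open>auto simp: indicator_def\<close>)
  then show ?thesis using A by simp
qed

section \<open>Block approximation of a Wiener process\<close>

text \<open>A function of the increments rather than of the path values, so that laws and
  independence of increments transfer directly. The empty sum \<open>k = 0\<close> accounts for the
  starting value \<open>0\<close> in both extrema.\<close>

definition grid_triple :: "nat \<Rightarrow> (nat \<Rightarrow> real) \<Rightarrow> real \<times> real \<times> real" where
  "grid_triple n x = (\<Sum>j<n. x j, Max ((\<lambda>k. \<Sum>j<k. x j) ` {..n}), Min ((\<lambda>k. \<Sum>j<k. x j) ` {..n}))"

definition path_triple :: "(real \<Rightarrow> 'a \<Rightarrow> real) \<Rightarrow> real \<Rightarrow> 'a \<Rightarrow> real \<times> real \<times> real" where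
  "path_triple W t \<omega> = (W t \<omega>, running_max W t \<omega>, running_min W t \<omega>)"

definition shifted :: "(real \<Rightarrow> 'a \<Rightarrow> real) \<Rightarrow> real \<Rightarrow> real \<Rightarrow> 'a \<Rightarrow> real" where
  "shifted W s u \<omega> = W (s + u) \<omega> - W s \<omega>"

definition rescaled :: "(real \<Rightarrow> 'a \<Rightarrow> real) \<Rightarrow> real \<Rightarrow> real \<Rightarrow> 'a \<Rightarrow> real" where
  "rescaled W c u \<omega> = W (c * u) \<omega> / sqrt c"

lemma grid_triple_cong: "(\<And>j. j < n \<Longrightarrow> x j = y j) \<Longrightarrow> grid_triple n x = grid_triple n y"
proof -
  assume *: "\<And>j. j < n \<Longrightarrow> x j = y j"
  have "(\<Sum>j<k. x j) = (\<Sum>j<k. y j)" if "k \<le> n" for k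
    using that * by (intro sum.cong) auto
  then have "(\<lambda>k. \<Sum>j<k. x j) ` {..n} = (\<lambda>k. \<Sum>j<k. y j) ` {..n}" "(\<Sum>j<n. x j) = (\<Sum>j<n. y j)"
    by (auto intro!: image_cong)
  then show ?thesis by (simp add: grid_triple_def)
qed

lemma grid_triple_measurable:
  assumes "\<And>j. j < n \<Longrightarrow> (\<lambda>x. f x j) \<in> borel_measurable M"
  shows "(\<lambda>x. grid_triple n (f x)) \<in> borel_measurable M"
proof -
  have S: "(\<lambda>x. \<Sum>j<k. f x j) \<in> borel_measurable M" if "k \<le> n" for k
    using assms that by (intro borel_measurable_sum) auto
  have "(\<lambda>x. Max ((\<lambda>k. \<Sum>j<k. f x j) ` {..n})) \<in> borel_measurable M"
    by (intro borel_measurable_Max) (use S in auto)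
  moreover have "(\<lambda>x. Min ((\<lambda>k. \<Sum>j<k. f x j) ` {..n})) \<in> borel_measurable M"
    by (intro borel_measurable_Min) (use S in auto)
  ultimately show ?thesis
    unfolding grid_triple_def using S[of n] by (intro borel_measurable_Pair) auto
qed

text \<open>Rounding \<open>x\<close> down to the grid costs at most one mesh width
  \<open>t / Suc n\<close>.\<close>

lemma grid_point_tendsto:
  fixes x t :: real
  assumes "0 \<le> x" "x \<le> t" "0 < t"
  shows "(\<lambda>n. t * real (nat \<lfloor>x * real (Suc n) / t\<rfloor>) / real (Suc n)) \<longlonglongrightarrow> x"
    and "nat \<lfloor>x * real (Suc n) / t\<rfloor> \<le> Suc n"
proof -
  have fl: "real (nat \<lfloor>x * real (Suc n) / t\<rfloor>) = of_int \<lfloor>x * real (Suc n) / t\<rfloor>" for n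
    using assms by simp
  show "(\<lambda>n. t * real (nat \<lfloor>x * real (Suc n) / t\<rfloor>) / real (Suc n)) \<longlonglongrightarrow> x"
  proof (rule tendsto_sandwich)
    show "(\<lambda>n. x - t / real (Suc n)) \<longlonglongrightarrow> x" by real_asymp
    show "(\<lambda>n. x) \<longlonglongrightarrow> x" by simp
    show "\<forall>\<^sub>F n in sequentially. x - t / real (Suc n) \<le> t * real (nat \<lfloor>x * real (Suc n) / t\<rfloor>) / real (Suc n)"
    proof (rule always_eventually, rule allI)
      fix n
      have "x * real (Suc n) / t - 1 \<le> of_int \<lfloor>x * real (Suc n) / t\<rfloor>" by linarith
      then have "t * (x * real (Suc n) / t - 1) / real (Suc n) \<le> t * of_int \<lfloor>x * real (Suc n) / t\<rfloor> / real (Suc n)"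
        using assms by (intro divide_right_mono mult_left_mono) auto
      moreover have "t * (x * N / t - 1) / N = x - t / N" if "N > 0" for N
        using assms(3) that by (simp add: field_simps)
      from this[of "real (Suc n)"] have "t * (x * real (Suc n) / t - 1) / real (Suc n) = x - t / real (Suc n)"
        by simp
      ultimately show "x - t / real (Suc n) \<le> t * real (nat \<lfloor>x * real (Suc n) / t\<rfloor>) / real (Suc n)"
        unfolding fl by simp
    qed
    show "\<forall>\<^sub>F n in sequentially. t * real (nat \<lfloor>x * real (Suc n) / t\<rfloor>) / real (Suc n) \<le> x"
    proof (rule always_eventually, rule allI)
      fix n
      have "t * of_int \<lfloor>x * real (Suc n) / t\<rfloor> / real (Suc n) \<le> t * (x * real (Suc n) / t) / real (Suc n)"
        using assms by (intro divide_right_mono mult_left_mono) auto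
      also have "\<dots> = x" using assms by simp
      finally show "t * real (nat \<lfloor>x * real (Suc n) / t\<rfloor>) / real (Suc n) \<le> x" unfolding fl .
    qed
  qed
  have "x * real (Suc n) \<le> t * real (Suc n)" using assms by (intro mult_right_mono) auto
  then have "x * real (Suc n) / t \<le> real (Suc n)" using assms(3) by (simp add: divide_le_eq mult.commute)
  then show "nat \<lfloor>x * real (Suc n) / t\<rfloor> \<le> Suc n" by linarith
qed

lemma running_extrema_attained:
  fixes f :: "real \<Rightarrow> real"
  assumes "continuous_on {0..t} f" "0 \<le> t"
  obtains u v where "u \<in> {0..t}" "v \<in> {0..t}" "(SUP s\<in>{0..t}. f s) = f u" "(INF s\<in>{0..t}. f s) = f v"
    "\<And>s. s \<in> {0..t} \<Longrightarrow> f v \<le> f s \<and> f s \<le> f u"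
proof -
  obtain u where u: "u \<in> {0..t}" "\<forall>s\<in>{0..t}. f s \<le> f u"
    using continuous_attains_sup[OF _ _ assms(1)] assms(2) by auto
  obtain v where v: "v \<in> {0..t}" "\<forall>s\<in>{0..t}. f v \<le> f s"
    using continuous_attains_inf[OF _ _ assms(1)] assms(2) by auto
  have "(SUP s\<in>{0..t}. f s) = f u" by (rule cSup_eq_maximum) (use u in auto)
  moreover have "(INF s\<in>{0..t}. f s) = f v" by (rule cInf_eq_minimum) (use v in auto)
  ultimately show ?thesis using that u v by blast
qed

text \<open>Every grid value is at most the maximum, and the value at the grid point just below a
  maximizer tends to the maximum by continuity.\<close>

lemma grid_max_tendsto:
  fixes f :: "real \<Rightarrow> real"
  assumes f: "continuous_on {0..t} f" and t: "0 < t"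
  shows "(\<lambda>n. Max ((\<lambda>k. f (t * real k / real (Suc n))) ` {..Suc n})) \<longlonglongrightarrow> (SUP s\<in>{0..t}. f s)"
proof -
  obtain u v where u: "u \<in> {0..t}" "(SUP s\<in>{0..t}. f s) = f u" "\<And>s. s \<in> {0..t} \<Longrightarrow> f v \<le> f s \<and> f s \<le> f u"
    using running_extrema_attained[OF f] t by (metis less_imp_le)
  let ?k = "\<lambda>n. nat \<lfloor>u * real (Suc n) / t\<rfloor>"
  have grid: "t * real k / real (Suc n) \<in> {0..t}" if "k \<le> Suc n" for k n
  proof -
    have "real k / real (Suc n) \<le> 1" using that by simp
    from mult_left_mono[OF this, of t] t show ?thesis by simp
  qed
  have u': "0 \<le> u" "u \<le> t" using u(1) by auto
  show ?thesis unfolding u(2)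
  proof (rule tendsto_sandwich)
    show "(\<lambda>n. f (t * real (?k n) / real (Suc n))) \<longlonglongrightarrow> f u"
    proof (rule continuous_on_tendsto_compose[OF f grid_point_tendsto(1)[OF u' t] u(1)])
      show "\<forall>\<^sub>F n in sequentially. t * real (?k n) / real (Suc n) \<in> {0..t}"
        by (intro always_eventually allI grid grid_point_tendsto(2)[OF u' t])
    qed
    show "\<forall>\<^sub>F n in sequentially. f (t * real (?k n) / real (Suc n)) \<le> Max ((\<lambda>k. f (t * real k / real (Suc n))) ` {..Suc n})"
      by (intro always_eventually allI Max_ge) (use grid_point_tendsto(2)[OF u' t] in auto)
    show "\<forall>\<^sub>F n in sequentially. Max ((\<lambda>k. f (t * real k / real (Suc n))) ` {..Suc n}) \<le> f u"
      by (intro always_eventually allI Max.boundedI) (use u(3) grid in auto)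
  qed simp
qed

lemma grid_min_tendsto:
  fixes f :: "real \<Rightarrow> real"
  assumes f: "continuous_on {0..t} f" and t: "0 < t"
  shows "(\<lambda>n. Min ((\<lambda>k. f (t * real k / real (Suc n))) ` {..Suc n})) \<longlonglongrightarrow> (INF s\<in>{0..t}. f s)"
proof -
  have "continuous_on {0..t} (\<lambda>s. - f s)" using f by (intro continuous_intros)
  from tendsto_minus[OF grid_max_tendsto[OF this t]]
  have "(\<lambda>n. - Max ((\<lambda>k. - f (t * real k / real (Suc n))) ` {..Suc n})) \<longlonglongrightarrow> - (SUP s\<in>{0..t}. - f s)" .
  moreover have "- Max ((\<lambda>k. - f (t * real k / real (Suc n))) ` {..Suc n}) = Min ((\<lambda>k. f (t * real k / real (Suc n))) ` {..Suc n})" for n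
    using minus_Max_eq_Min[of "(\<lambda>k. - f (t * real k / real (Suc n))) ` {..Suc n}"]
    by (simp add: image_image)
  moreover have "- (SUP s\<in>{0..t}. - f s) = (INF s\<in>{0..t}. f s)"
    by (simp add: Inf_real_def image_image)
  ultimately show ?thesis by simp
qed

lemma grid_triple_tendsto:
  fixes f :: "real \<Rightarrow> real"
  assumes f: "continuous_on {0..t} f" and t: "0 < t" and 0: "f 0 = 0"
  shows "(\<lambda>n. grid_triple (Suc n) (\<lambda>j. f (t * real (Suc j) / real (Suc n)) - f (t * real j / real (Suc n))))
    \<longlonglongrightarrow> (f t, SUP s\<in>{0..t}. f s, INF s\<in>{0..t}. f s)"
proof -
  have S: "(\<Sum>j<k. f (t * real (Suc j) / real (Suc n)) - f (t * real j / real (Suc n))) = f (t * real k / real (Suc n))" for k n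
    using sum_lessThan_telescope[of "\<lambda>j. f (t * real j / real (Suc n))" k] 0 by simp
  have "f (t * real (Suc n) / real (Suc n)) = f t" for n by simp
  then show ?thesis
    unfolding grid_triple_def S
    by (intro tendsto_Pair grid_max_tendsto[OF f t] grid_min_tendsto[OF f t]) simp
qed

section \<open>Measurability of the extrema, invariances of a Wiener process, uniqueness of the
  law\<close>

context wiener_process
begin

lemma continuous_path: "\<omega> \<in> space \<Omega> \<Longrightarrow> continuous_on {0..t} (\<lambda>s. W s \<omega>)"
  using wiener_continuous continuous_on_subset by fastforce

lemma increment_distr:
  assumes "0 \<le> s" "s < t"
  shows "distr \<Omega> borel (\<lambda>\<omega>. W t \<omega> - W s \<omega>) = density lborel (\<lambda>x. ennreal (normal_density 0 (sqrt (t - s)) x))"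
proof -
  have "distr \<Omega> borel (\<lambda>\<omega>. W t \<omega> - W s \<omega>) = distr \<Omega> lborel (\<lambda>\<omega>. W t \<omega> - W s \<omega>)"
    by (rule distr_cong) auto
  then show ?thesis
    using distributed_distr_eq_density[OF wiener_increment[OF assms]] by simp
qed

lemma increment_measurable:
  assumes "0 \<le> s" "0 \<le> t" shows "(\<lambda>\<omega>. W t \<omega> - W s \<omega>) \<in> borel_measurable \<Omega>"
  using wiener_measurable[OF assms(1)] wiener_measurable[OF assms(2)] by measurable

lemma grid_triple_path_tendsto:
  assumes "0 < t" "\<omega> \<in> space \<Omega>"
  shows "(\<lambda>n. grid_triple (Suc n) (\<lambda>j. W (t * real (Suc j) / real (Suc n)) \<omega> - W (t * real j / real (Suc n)) \<omega>))
    \<longlonglongrightarrow> path_triple W t \<omega>"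
  unfolding path_triple_def running_max_def running_min_def
  using assms by (intro grid_triple_tendsto continuous_path wiener_start)

lemma grid_triple_path_measurable:
  assumes "0 < t"
  shows "(\<lambda>\<omega>. grid_triple (Suc n) (\<lambda>j. W (t * real (Suc j) / real (Suc n)) \<omega> - W (t * real j / real (Suc n)) \<omega>))
    \<in> borel_measurable \<Omega>"
  using assms by (intro grid_triple_measurable increment_measurable) auto

text \<open>The extrema involve uncountably many times; measurability comes from the representation
  as a limit of finite grid triples along continuous paths.\<close>

lemma path_triple_measurable: "0 < t \<Longrightarrow> path_triple W t \<in> borel_measurable \<Omega>"
  by (rule borel_measurable_LIMSEQ_metric[OF grid_triple_path_measurable grid_triple_path_tendsto])

lemma running_max_measurable: "0 < t \<Longrightarrow> running_max W t \<in> borel_measurable \<Omega>"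
  and running_min_measurable: "0 < t \<Longrightarrow> running_min W t \<in> borel_measurable \<Omega>"
proof -
  assume t: "0 < t"
  have c: "(\<lambda>x. fst (snd x)) \<in> borel_measurable (borel :: (real \<times> real \<times> real) measure)"
    "(\<lambda>x. snd (snd x)) \<in> borel_measurable (borel :: (real \<times> real \<times> real) measure)"
    by (auto intro!: borel_measurable_continuous_onI continuous_intros)
  show "running_max W t \<in> borel_measurable \<Omega>"
    using measurable_compose[OF path_triple_measurable[OF t] c(1)] by (simp add: path_triple_def)
  show "running_min W t \<in> borel_measurable \<Omega>"
    using measurable_compose[OF path_triple_measurable[OF t] c(2)] by (simp add: path_triple_def)
qed

text \<open>Shift, scaling and negation each yield another Wiener process on the same probability
  space. Interpreting the locale for them transfers results about \<open>W\<close> to the path after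
  \<open>s\<close>, from one time to another, and from the maximum to the minimum.\<close>

lemma wiener_process_shifted:
  assumes s: "0 \<le> s"
  shows "wiener_process \<Omega> (shifted W s)"
proof
  show "shifted W s t \<in> borel_measurable \<Omega>" if "0 \<le> t" for t
    unfolding shifted_def[abs_def] using s that by (intro increment_measurable) auto
  show "shifted W s 0 \<omega> = 0" for \<omega> by (simp add: shifted_def)
  show "continuous_on {0..} (\<lambda>t. shifted W s t \<omega>)" if "\<omega> \<in> space \<Omega>" for \<omega>
    unfolding shifted_def
    by (intro continuous_on_diff continuous_on_const continuous_on_compose2[OF wiener_continuous[OF that]] continuous_intros)
      (use s in auto)
  show "distributed \<Omega> lborel (\<lambda>\<omega>. shifted W s v \<omega> - shifted W s u \<omega>) (normal_density 0 (sqrt (v - u)))"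
    if "0 \<le> u" "u < v" for u v
    using wiener_increment[of "s + u" "s + v"] s that by (simp add: shifted_def)
  show "indep_vars (\<lambda>_. borel) (\<lambda>i \<omega>. shifted W s (\<tau> (Suc i)) \<omega> - shifted W s (\<tau> i) \<omega>) {..<n}"
    if "0 \<le> \<tau> 0" "strict_mono_on {..n} \<tau>" for \<tau> and n :: nat
    using wiener_indep_increments[of "\<lambda>i. s + \<tau> i" n] s that
    by (simp add: shifted_def strict_mono_on_def)
qed

lemma wiener_process_rescaled:
  assumes c: "0 < c"
  shows "wiener_process \<Omega> (rescaled W c)"
proof
  show "rescaled W c t \<in> borel_measurable \<Omega>" if "0 \<le> t" for t
    unfolding rescaled_def[abs_def] using c that
    by (intro borel_measurable_divide wiener_measurable borel_measurable_const) simp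
  show "rescaled W c 0 \<omega> = 0" if "\<omega> \<in> space \<Omega>" for \<omega> using wiener_start[OF that] by (simp add: rescaled_def)
  show "continuous_on {0..} (\<lambda>t. rescaled W c t \<omega>)" if "\<omega> \<in> space \<Omega>" for \<omega>
    unfolding rescaled_def
    by (intro continuous_on_divide continuous_on_const continuous_on_compose2[OF wiener_continuous[OF that]] continuous_intros)
      (use c in auto)
  show "distributed \<Omega> lborel (\<lambda>\<omega>. rescaled W c v \<omega> - rescaled W c u \<omega>) (normal_density 0 (sqrt (v - u)))"
    if uv: "0 \<le> u" "u < v" for u v
  proof -
    have "distributed \<Omega> lborel (\<lambda>\<omega>. W (c * v) \<omega> - W (c * u) \<omega>) (normal_density 0 (sqrt (c * v - c * u)))"
      using c uv by (intro wiener_increment) auto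
    from normal_density_affine[OF this, of "1 / sqrt c" 0]
    show ?thesis using c uv
      by (simp add: rescaled_def diff_divide_distrib real_sqrt_mult flip: right_diff_distrib)
  qed
  show "indep_vars (\<lambda>_. borel) (\<lambda>i \<omega>. rescaled W c (\<tau> (Suc i)) \<omega> - rescaled W c (\<tau> i) \<omega>) {..<n}"
    if "0 \<le> \<tau> 0" "strict_mono_on {..n} \<tau>" for \<tau> and n :: nat
  proof -
    have "indep_vars (\<lambda>_. borel) (\<lambda>i \<omega>. W (c * \<tau> (Suc i)) \<omega> - W (c * \<tau> i) \<omega>) {..<n}"
      using wiener_indep_increments[of "\<lambda>i. c * \<tau> i" n] c that by (simp add: strict_mono_on_def)
    from indep_vars_compose2[OF this, of "\<lambda>_ x. x / sqrt c" "\<lambda>_. borel"]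
    show ?thesis by (simp add: rescaled_def diff_divide_distrib)
  qed
qed

lemma wiener_process_uminus: "wiener_process \<Omega> (\<lambda>t \<omega>. - W t \<omega>)"
proof
  show "(\<lambda>\<omega>. - W t \<omega>) \<in> borel_measurable \<Omega>" if "0 \<le> t" for t
    using wiener_measurable[OF that] by measurable
  show "- W 0 \<omega> = 0" if "\<omega> \<in> space \<Omega>" for \<omega> using wiener_start[OF that] by simp
  show "continuous_on {0..} (\<lambda>t. - W t \<omega>)" if "\<omega> \<in> space \<Omega>" for \<omega>
    using wiener_continuous[OF that] by (intro continuous_intros)
  show "distributed \<Omega> lborel (\<lambda>\<omega>. - W v \<omega> - - W u \<omega>) (normal_density 0 (sqrt (v - u)))"
    if uv: "0 \<le> u" "u < v" for u v
    using normal_density_affine[OF wiener_increment[OF uv], of "-1" 0] uv by simp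
  show "indep_vars (\<lambda>_. borel) (\<lambda>i \<omega>. - W (\<tau> (Suc i)) \<omega> - - W (\<tau> i) \<omega>) {..<n}"
    if \<tau>: "0 \<le> \<tau> 0" "strict_mono_on {..n} \<tau>" for \<tau> and n :: nat
    using indep_vars_compose2[OF wiener_indep_increments[OF \<tau>], of "\<lambda>_ x. - x" "\<lambda>_. borel"] by simp
qed

end

text \<open>On each grid the triple is a fixed measurable function of independent normal increments,
  so its law depends only on \<open>t\<close> and the mesh; the limit inherits this.\<close>

lemma path_triple_distr_unique:
  assumes "wiener_process \<Omega> W" "wiener_process \<Omega>' W'" and t: "0 < t"
  shows "distr \<Omega> borel (path_triple W t) = distr \<Omega>' borel (path_triple W' t)"
proof -
  interpret A: wiener_process \<Omega> W by fact
  interpret B: wiener_process \<Omega>' W' by fact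
  \<comment> \<open>Stated with a type variable of its own, since the two processes may live on
    probability spaces over different types.\<close>
  have law: "distr M borel (\<lambda>\<omega>. grid_triple (Suc n) (\<lambda>j. V (t * real (Suc j) / real (Suc n)) \<omega> - V (t * real j / real (Suc n)) \<omega>))
     = distr (PiM {..<Suc n} (\<lambda>_. density lborel (normal_density 0 (sqrt (t / real (Suc n)))))) borel (grid_triple (Suc n))"
    if "wiener_process M V" for M :: "'c measure" and V n
  proof -
    interpret C: wiener_process M V by fact
    define N where "N = density lborel (normal_density 0 (sqrt (t / real (Suc n))))"
    define \<tau> where "\<tau> j = t * real j / real (Suc n)" for j
    have mono: "strict_mono \<tau>" using t by (auto simp: strict_mono_def \<tau>_def intro!: divide_strict_right_mono)
    have nn: "0 \<le> \<tau> j" for j using t by (simp add: \<tau>_def)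
    define X where "X j \<omega> = V (\<tau> (Suc j)) \<omega> - V (\<tau> j) \<omega>" for j \<omega>
    have rv: "X j \<in> borel_measurable M" for j
      unfolding X_def[abs_def] using nn by (intro C.increment_measurable)
    have ind: "C.indep_vars (\<lambda>_. borel) X {..<Suc n}"
      unfolding X_def[abs_def] using mono nn
      by (intro C.wiener_indep_increments) (auto simp: strict_mono_on_def strict_mono_def)
    have "\<tau> (Suc j) - \<tau> j = t * (real (Suc j) - real j) / real (Suc n)" for j
      by (simp only: \<tau>_def right_diff_distrib diff_divide_distrib)
    then have "\<tau> (Suc j) - \<tau> j = t / real (Suc n)" for j by simp
    then have d: "distr M borel (X j) = N" for j
      using C.increment_distr[OF nn, of j "\<tau> (Suc j)"] strict_monoD[OF mono, of j "Suc j"]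
      by (simp add: X_def[abs_def] N_def)
    have "distr M (PiM {..<Suc n} (\<lambda>_. borel)) (\<lambda>\<omega>. \<lambda>j\<in>{..<Suc n}. X j \<omega>) = PiM {..<Suc n} (\<lambda>_. N)"
      using C.indep_vars_iff_distr_eq_PiM'[where I="{..<Suc n}" and M'="\<lambda>_. borel" and X=X] ind rv d by auto
    then have "distr (PiM {..<Suc n} (\<lambda>_. N)) borel (grid_triple (Suc n))
       = distr (distr M (PiM {..<Suc n} (\<lambda>_. borel)) (\<lambda>\<omega>. \<lambda>j\<in>{..<Suc n}. X j \<omega>)) borel (grid_triple (Suc n))"
      by simp
    also have "\<dots> = distr M borel (\<lambda>\<omega>. grid_triple (Suc n) (\<lambda>j\<in>{..<Suc n}. X j \<omega>))"
    proof (subst distr_distr)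
      show "grid_triple (Suc n) \<in> borel_measurable (PiM {..<Suc n} (\<lambda>_. borel))"
        by (rule grid_triple_measurable[where f="\<lambda>x. x"]) simp
      show "(\<lambda>\<omega>. \<lambda>j\<in>{..<Suc n}. X j \<omega>) \<in> M \<rightarrow>\<^sub>M PiM {..<Suc n} (\<lambda>_. borel)"
        by (intro measurable_restrict rv)
    qed (simp add: comp_def)
    also have "(\<lambda>\<omega>. grid_triple (Suc n) (\<lambda>j\<in>{..<Suc n}. X j \<omega>)) = (\<lambda>\<omega>. grid_triple (Suc n) (\<lambda>j. X j \<omega>))"
      by (intro ext grid_triple_cong) simp
    finally show ?thesis by (simp add: X_def \<tau>_def N_def)
  qed
  show ?thesis
    by (rule distr_eq_LIMSEQ[OF A.prob_space_axioms B.prob_space_axioms A.grid_triple_path_measurable[OF t]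
          B.grid_triple_path_measurable[OF t] A.grid_triple_path_tendsto[OF t] B.grid_triple_path_tendsto[OF t]])
       (simp_all only: law[OF assms(1)] law[OF assms(2)])
qed

text \<open>Each block between consecutive times is cut into \<open>n\<close> equal pieces. All the
  small increments together are independent, and the grid triples of distinct blocks use disjoint
  groups of them; refining the pieces then gives the statement in the limit.\<close>

lemma (in wiener_process) block_triples_indep:
  assumes s: "strict_mono s" "0 \<le> s 0" and k: "0 < k"
  shows "indep_vars (\<lambda>_. borel) (\<lambda>i. path_triple (shifted W (s i)) (s (Suc i) - s i)) {..<k}"
proof (rule indep_vars_LIMSEQ)
  have nn: "0 \<le> s i" for i using s strict_mono_mono[OF s(1)] by (meson monoD order_trans zero_le)
  have pos: "0 < s (Suc i) - s i" for i using strict_monoD[OF s(1), of i "Suc i"] by simp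
  let ?X = "\<lambda>m i \<omega>. grid_triple (Suc m) (\<lambda>j. shifted W (s i) ((s (Suc i) - s i) * real (Suc j) / real (Suc m)) \<omega>
       - shifted W (s i) ((s (Suc i) - s i) * real j / real (Suc m)) \<omega>)"
  show "(\<lambda>m. ?X m i \<omega>) \<longlonglongrightarrow> path_triple (shifted W (s i)) (s (Suc i) - s i) \<omega>" if "\<omega> \<in> space \<Omega>" for i \<omega>
    by (rule wiener_process.grid_triple_path_tendsto[OF wiener_process_shifted[OF nn] pos that])
  fix m
  define n where "n = Suc m"
  \<comment> \<open>The refined grid, enumerated block by block: \<open>l = i * n + j\<close> is the
    point number \<open>j\<close> of block \<open>i\<close>.\<close>
  define \<tau> where "\<tau> l = s (l div n) + (s (Suc (l div n)) - s (l div n)) * real (l mod n) / real n" for l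
  \<comment> \<open>The value \<open>j = n\<close> is included: the end of block \<open>i\<close> is
    the start of block \<open>Suc i\<close>, and the last increment of each block needs it.\<close>
  have \<tau>: "\<tau> (i * n + j) = s i + (s (Suc i) - s i) * real j / real n" if "j \<le> n" for i j
  proof (cases "j = n")
    case True
    then have "i * n + j = Suc i * n" by simp
    moreover have "(Suc i * n) div n = Suc i" "(Suc i * n) mod n = 0"
      by (simp_all only: nonzero_mult_div_cancel_right mod_mult_self2_is_0 n_def nat.simps not_False_eq_True)
    then have "\<tau> (Suc i * n) = s (Suc i)" by (simp add: \<tau>_def del: mult_Suc)
    ultimately have "\<tau> (i * n + j) = s (Suc i)" by (simp only:)
    moreover have "s i + (s (Suc i) - s i) * real j / real n = s (Suc i)" using True by (simp add: n_def)
    ultimately show ?thesis by (simp only:)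
  next
    case False
    then have "(i * n + j) div n = i" "(i * n + j) mod n = j" using that by auto
    then show ?thesis by (simp add: \<tau>_def)
  qed
  have "\<tau> l < \<tau> (Suc l)" for l
  proof -
    define i j where "i = l div n" "j = l mod n"
    have l: "l = i * n + j" unfolding i_j_def by simp
    have "j < n" by (simp add: i_j_def n_def)
    from l have "Suc l = i * n + Suc j" by simp
    then show ?thesis unfolding l using \<tau>[of j i] \<tau>[of "Suc j" i] \<open>j < n\<close> pos[of i]
      by (simp add: divide_strict_right_mono)
  qed
  then have mono: "strict_mono \<tau>" by (simp add: strict_mono_Suc_iff)
  have "\<tau> 0 = s 0" using \<tau>[of 0 0] by simp
  then have ind: "indep_vars (\<lambda>_. borel) (\<lambda>l \<omega>. W (\<tau> (Suc l)) \<omega> - W (\<tau> l) \<omega>) {..<k * n}"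
    using s mono by (intro wiener_indep_increments) (auto simp: strict_mono_on_def strict_mono_def)
  define K where "K i = {i * n..<i * n + n}" for i
  have K: "K i \<subseteq> {..<k * n}" if "i \<in> {..<k}" for i
  proof -
    have "Suc i * n \<le> k * n" using that by (intro mult_right_mono) auto
    then show ?thesis by (auto simp: K_def)
  qed
  have disj: "disjoint_family_on K {..<k}"
  proof (unfold disjoint_family_on_def, intro ballI impI equals0I)
    fix a b l assume "a \<noteq> b" "l \<in> K a \<inter> K b"
    then have "l div n = a" "l div n = b" by (auto simp: K_def algebra_simps intro!: div_nat_eqI)
    with \<open>a \<noteq> b\<close> show False by simp
  qed
  have "indep_vars (\<lambda>_. borel) (\<lambda>i \<omega>. grid_triple n (\<lambda>j. restrict (\<lambda>l. W (\<tau> (Suc l)) \<omega> - W (\<tau> l) \<omega>) (K i) (i * n + j))) {..<k}"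
  proof (rule indep_vars_compose2[OF indep_vars_restrict[OF ind K disj], where Y="\<lambda>i x. grid_triple n (\<lambda>j. x (i * n + j))"])
    show "(\<lambda>x. grid_triple n (\<lambda>j. x (i * n + j))) \<in> borel_measurable (PiM (K i) (\<lambda>_. borel))" for i
      by (rule grid_triple_measurable) (simp add: K_def)
  qed
  also have "?this = indep_vars (\<lambda>_. borel) (?X m) {..<k}"
  proof (rule indep_vars_cong)
    fix i assume "i \<in> {..<k}"
    show "(\<lambda>\<omega>. grid_triple n (\<lambda>j. restrict (\<lambda>l. W (\<tau> (Suc l)) \<omega> - W (\<tau> l) \<omega>) (K i) (i * n + j))) = ?X m i"
    proof
      fix \<omega>
      show "grid_triple n (\<lambda>j. restrict (\<lambda>l. W (\<tau> (Suc l)) \<omega> - W (\<tau> l) \<omega>) (K i) (i * n + j)) = ?X m i \<omega>"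
        unfolding n_def[symmetric]
      proof (rule grid_triple_cong)
        fix j assume j: "j < n"
        then show "restrict (\<lambda>l. W (\<tau> (Suc l)) \<omega> - W (\<tau> l) \<omega>) (K i) (i * n + j) =
            shifted W (s i) ((s (Suc i) - s i) * real (Suc j) / real n) \<omega> - shifted W (s i) ((s (Suc i) - s i) * real j / real n) \<omega>"
          using \<tau>[of j i] \<tau>[of "Suc j" i] by (simp add: K_def shifted_def)
      qed
    qed
  qed auto
  finally show "indep_vars (\<lambda>_. borel) (?X m) {..<k}" .
qed (use k in auto)

section \<open>The reflection principle\<close>

lemma (in prob_space) indep_var_of_indep_vars:
  assumes "indep_vars M' X I" "i \<in> I" "j \<in> I" "i \<noteq> j"
  shows "indep_var (M' i) (X i) (M' j) (X j)"
proof -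
  have "indep_var (PiM {i} M') (\<lambda>\<omega>. restrict (\<lambda>l. X l \<omega>) {i}) (PiM {j} M') (\<lambda>\<omega>. restrict (\<lambda>l. X l \<omega>) {j})"
    using assms by (intro indep_var_restrict[OF assms(1)]) auto
  from indep_var_compose[OF this, of "\<lambda>x. x i" "M' i" "\<lambda>x. x j" "M' j"]
  show ?thesis by (simp add: comp_def)
qed

text \<open>Needed because the path starts at \<open>0\<close> only for points of
  \<open>space \<Omega>\<close>, so shifting by \<open>0\<close> changes nothing there but possibly
  outside.\<close>

lemma (in prob_space) indep_var_cong_space:
  assumes "indep_var S X T Y"
    and X: "\<And>\<omega>. \<omega> \<in> space M \<Longrightarrow> X \<omega> = X' \<omega>" and Y: "\<And>\<omega>. \<omega> \<in> space M \<Longrightarrow> Y \<omega> = Y' \<omega>"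
  shows "indep_var S X' T Y'"
proof -
  have "distr M S X = distr M S X'" "distr M T Y = distr M T Y'"
    "distr M (S \<Otimes>\<^sub>M T) (\<lambda>\<omega>. (X \<omega>, Y \<omega>)) = distr M (S \<Otimes>\<^sub>M T) (\<lambda>\<omega>. (X' \<omega>, Y' \<omega>))"
    using X Y by (auto intro!: distr_cong)
  moreover have "random_variable S X = random_variable S X'" "random_variable T Y = random_variable T Y'"
    using X Y by (auto intro!: measurable_cong)
  ultimately show ?thesis using assms(1) unfolding indep_var_distribution_eq by simp
qed

lemma path_triple_shifted_0:
  "W 0 \<omega> = 0 \<Longrightarrow> path_triple (shifted W 0) t \<omega> = path_triple W t \<omega>"
  by (simp add: path_triple_def shifted_def running_max_def running_min_def)

context wiener_process
begin

lemma extrema_attained: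
  assumes "0 \<le> t" "\<omega> \<in> space \<Omega>"
  obtains u v where "u \<in> {0..t}" "v \<in> {0..t}" "running_max W t \<omega> = W u \<omega>" "running_min W t \<omega> = W v \<omega>"
    "\<And>s. s \<in> {0..t} \<Longrightarrow> W v \<omega> \<le> W s \<omega> \<and> W s \<omega> \<le> W u \<omega>"
  using running_extrema_attained[OF continuous_path[OF assms(2)] assms(1)]
  unfolding running_max_def running_min_def by metis

lemma running_bounds:
  assumes "0 \<le> t" "\<omega> \<in> space \<Omega>" "s \<in> {0..t}"
  shows "running_min W t \<omega> \<le> W s \<omega>" "W s \<omega> \<le> running_max W t \<omega>"
proof -
  obtain u v where "running_max W t \<omega> = W u \<omega>" "running_min W t \<omega> = W v \<omega>"
    "\<And>s. s \<in> {0..t} \<Longrightarrow> W v \<omega> \<le> W s \<omega> \<and> W s \<omega> \<le> W u \<omega>"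
    using extrema_attained[OF assms(1,2)] by blast
  then show "running_min W t \<omega> \<le> W s \<omega>" "W s \<omega> \<le> running_max W t \<omega>" using assms(3) by auto
qed

lemma running_max_nonneg: "0 \<le> t \<Longrightarrow> \<omega> \<in> space \<Omega> \<Longrightarrow> 0 \<le> running_max W t \<omega>"
  and running_min_nonpos: "0 \<le> t \<Longrightarrow> \<omega> \<in> space \<Omega> \<Longrightarrow> running_min W t \<omega> \<le> 0"
  using running_bounds[of t \<omega> 0] wiener_start[of \<omega>] by auto

lemma running_max_eqI:
  assumes "u \<in> {0..t}" "\<And>s. s \<in> {0..t} \<Longrightarrow> W s \<omega> \<le> W u \<omega>"
  shows "running_max W t \<omega> = W u \<omega>"
  unfolding running_max_def by (rule cSup_eq_maximum) (use assms in auto)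

lemma running_min_eqI:
  assumes "u \<in> {0..t}" "\<And>s. s \<in> {0..t} \<Longrightarrow> W u \<omega> \<le> W s \<omega>"
  shows "running_min W t \<omega> = W u \<omega>"
  unfolding running_min_def by (rule cInf_eq_minimum) (use assms in auto)

text \<open>Dividing the time by \<open>c\<close> carries the times at which the extrema of
  \<open>W\<close> are attained to those of the rescaled path.\<close>

lemma path_triple_rescaled:
  assumes c: "0 < c" and u: "0 \<le> u" and \<omega>: "\<omega> \<in> space \<Omega>"
  shows "path_triple (rescaled W c) u \<omega> =
    (W (c * u) \<omega> / sqrt c, running_max W (c * u) \<omega> / sqrt c, running_min W (c * u) \<omega> / sqrt c)"
proof -
  interpret R: wiener_process \<Omega> "rescaled W c" by (rule wiener_process_rescaled[OF c])
  have "0 \<le> c * u" using c u by simp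
  then obtain x y where xy: "x \<in> {0..c * u}" "y \<in> {0..c * u}" "running_max W (c * u) \<omega> = W x \<omega>" "running_min W (c * u) \<omega> = W y \<omega>"
    "\<And>s. s \<in> {0..c * u} \<Longrightarrow> W y \<omega> \<le> W s \<omega> \<and> W s \<omega> \<le> W x \<omega>"
    using extrema_attained[OF _ \<omega>] by blast
  have sub: "c * s \<in> {0..c * u}" if "s \<in> {0..u}" for s using that c by auto
  have "running_max (rescaled W c) u \<omega> = rescaled W c (x / c) \<omega>"
    by (rule R.running_max_eqI)
       (use xy c sub in \<open>auto simp: rescaled_def field_simps intro!: divide_right_mono\<close>)
  moreover have "running_min (rescaled W c) u \<omega> = rescaled W c (y / c) \<omega>"
    by (rule R.running_min_eqI)
       (use xy c sub in \<open>auto simp: rescaled_def field_simps intro!: divide_right_mono\<close>)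
  ultimately show ?thesis using c by (simp add: path_triple_def rescaled_def xy(3,4))
qed

section \<open>The law of a single value and its symmetry\<close>

lemma value_distr:
  assumes "0 < t"
  shows "distr \<Omega> borel (W t) = density lborel (\<lambda>x. ennreal (normal_density 0 (sqrt t) x))"
proof -
  have "distr \<Omega> borel (\<lambda>\<omega>. W t \<omega> - W 0 \<omega>) = distr \<Omega> borel (W t)"
    by (rule distr_cong) (auto simp: wiener_start)
  then show ?thesis using increment_distr[of 0 t] assms by simp
qed

lemma prob_value:
  assumes "0 < t" "A \<in> sets borel"
  shows "prob {\<omega> \<in> space \<Omega>. W t \<omega> \<in> A} = measure (density lborel (\<lambda>x. ennreal (normal_density 0 (sqrt t) x))) A"
  using arg_cong[OF value_distr[OF assms(1)], of "\<lambda>D. measure D A"] assms wiener_measurable[of t]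
  by (simp add: measure_distr vimage_def Int_def conj_commute)

lemma prob_value_null:
  assumes "0 < t" "A \<in> null_sets lborel"
  shows "prob {\<omega> \<in> space \<Omega>. W t \<omega> \<in> A} = 0"
proof -
  have "absolutely_continuous lborel (density lborel (\<lambda>x. ennreal (normal_density 0 (sqrt t) x)))"
    by (rule absolutely_continuousI_density) simp
  then have "A \<in> null_sets (density lborel (\<lambda>x. ennreal (normal_density 0 (sqrt t) x)))"
    using assms(2) by (auto simp: absolutely_continuous_def)
  then show ?thesis using assms by (subst prob_value) (auto simp: measure_def null_sets_def)
qed

lemma prob_value_eq: "0 < t \<Longrightarrow> prob {\<omega> \<in> space \<Omega>. W t \<omega> = a} = 0"
  using prob_value_null[of t "{a}"] by (simp add: null_sets_def)

lemma value_event [measurable]: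
  assumes "0 \<le> t" "A \<in> sets borel"
  shows "{\<omega> \<in> space \<Omega>. W t \<omega> \<in> A} \<in> events"
  using measurable_sets[OF wiener_measurable[OF assms(1)] assms(2)] by (simp add: vimage_def Int_def conj_commute)

lemma prob_value_uminus:
  assumes "0 < t" "A \<in> sets borel"
  shows "prob {\<omega> \<in> space \<Omega>. - W t \<omega> \<in> A} = prob {\<omega> \<in> space \<Omega>. W t \<omega> \<in> A}"
proof -
  interpret N: wiener_process \<Omega> "\<lambda>t \<omega>. - W t \<omega>" by (rule wiener_process_uminus)
  show ?thesis using N.prob_value[OF assms] prob_value[OF assms] by simp
qed

text \<open>The two half-lines have equal probability by symmetry, and the point \<open>0\<close>
  carries none.\<close>

lemma prob_value_pos:
  assumes "0 < t"
  shows "prob {\<omega> \<in> space \<Omega>. 0 < W t \<omega>} = 1/2" and "prob {\<omega> \<in> space \<Omega>. 0 \<le> W t \<omega>} = 1/2"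
proof -
  have ev: "{\<omega> \<in> space \<Omega>. 0 < W t \<omega>} \<in> events" "{\<omega> \<in> space \<Omega>. W t \<omega> < 0} \<in> events"
    "{\<omega> \<in> space \<Omega>. W t \<omega> = 0} \<in> events"
    using value_event[of t "{0<..}"] value_event[of t "{..<0}"] value_event[of t "{0}"] assms by simp_all
  have "prob {\<omega> \<in> space \<Omega>. - W t \<omega> \<in> {0<..}} = prob {\<omega> \<in> space \<Omega>. W t \<omega> \<in> {0<..}}"
    by (rule prob_value_uminus[OF assms]) simp
  then have eq: "prob {\<omega> \<in> space \<Omega>. W t \<omega> < 0} = prob {\<omega> \<in> space \<Omega>. 0 < W t \<omega>}" by simp
  have "space \<Omega> = ({\<omega> \<in> space \<Omega>. 0 < W t \<omega>} \<union> {\<omega> \<in> space \<Omega>. W t \<omega> < 0}) \<union> {\<omega> \<in> space \<Omega>. W t \<omega> = 0}" by auto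
  also have "prob \<dots> = prob {\<omega> \<in> space \<Omega>. 0 < W t \<omega>} + prob {\<omega> \<in> space \<Omega>. W t \<omega> < 0} + prob {\<omega> \<in> space \<Omega>. W t \<omega> = 0}"
    using ev by (subst finite_measure_Union, auto)+
  finally show 1: "prob {\<omega> \<in> space \<Omega>. 0 < W t \<omega>} = 1/2"
    using prob_value_eq[OF assms] eq by (simp add: prob_space)
  have "{\<omega> \<in> space \<Omega>. 0 \<le> W t \<omega>} = {\<omega> \<in> space \<Omega>. 0 < W t \<omega>} \<union> {\<omega> \<in> space \<Omega>. W t \<omega> = 0}" by auto
  also have "prob \<dots> = prob {\<omega> \<in> space \<Omega>. 0 < W t \<omega>} + prob {\<omega> \<in> space \<Omega>. W t \<omega> = 0}"
    using ev by (intro finite_measure_Union) auto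
  finally show "prob {\<omega> \<in> space \<Omega>. 0 \<le> W t \<omega>} = 1/2" using 1 prob_value_eq[OF assms] by simp
qed

lemma prob_increment_pos:
  assumes "0 \<le> s" "s < t"
  shows "prob {\<omega> \<in> space \<Omega>. 0 < W t \<omega> - W s \<omega>} = 1/2"
proof -
  interpret S: wiener_process \<Omega> "shifted W s" by (rule wiener_process_shifted[OF assms(1)])
  show ?thesis using S.prob_value_pos(1)[of "t - s"] assms by (simp add: shifted_def)
qed

text \<open>Grid version of the event that the level \<open>a\<close> is first reached at the time
  number \<open>k\<close>. For different \<open>k\<close> these events are disjoint, and each
  depends only on the increments before the index \<open>k\<close>.\<close>

definition first_crossing :: "real \<Rightarrow> nat \<Rightarrow> real \<Rightarrow> nat \<Rightarrow> 'a set" where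
  "first_crossing t n a k = {\<omega> \<in> space \<Omega>. a \<le> W (t * real k / real n) \<omega> \<and> (\<forall>j<k. W (t * real j / real n) \<omega> < a)}"

lemma first_crossing_event: "0 < t \<Longrightarrow> first_crossing t n a k \<in> events"
proof -
  assume t: "0 < t"
  have "(\<lambda>\<omega>. W (t * real j / real n) \<omega>) \<in> borel_measurable \<Omega>" for j
    using t by (intro wiener_measurable) simp
  then show ?thesis unfolding first_crossing_def
    by (intro sets.sets_Collect_conj sets.sets_Collect_finite_All' borel_measurable_le borel_measurable_less) auto
qed

text \<open>The increment after the first crossing is symmetric and independent of it; the overshoot
  at the crossing disappears as the grid is refined.\<close>

lemma prob_first_crossing_exceed:
  assumes t: "0 < t" and a: "0 < a" and k: "k < n"
  shows "prob (first_crossing t n a k \<inter> {\<omega> \<in> space \<Omega>. 0 < W t \<omega> - W (t * real k / real n) \<omega>}) = prob (first_crossing t n a k) / 2"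
proof -
  \<comment> \<open>The grid up to index \<open>k\<close>, then a single jump to \<open>t\<close>;
    the unit steps afterwards only continue the sequence so that it is strictly increasing.\<close>
  define \<tau> where "\<tau> i = (if i \<le> k then t * real i / real n else t + real (i - Suc k))" for i
  have tk: "t * real k / real n < t" using t k by (simp add: field_simps)
  have "\<tau> i < \<tau> (Suc i)" for i
  proof -
    consider "i < k" | "i = k" | "i > k" by linarith
    then show ?thesis
    proof cases
      case 1
      then show ?thesis using t k by (simp add: \<tau>_def divide_strict_right_mono)
    next
      case 2
      then show ?thesis using tk by (simp add: \<tau>_def)
    next
      case 3
      then show ?thesis by (simp add: \<tau>_def)
    qed
  qed
  then have mono: "strict_mono \<tau>" by (simp add: strict_mono_Suc_iff)
  define X where "X i \<omega> = W (\<tau> (Suc i)) \<omega> - W (\<tau> i) \<omega>" for i \<omega>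
  have "indep_vars (\<lambda>_. borel) X {..<Suc k}"
    unfolding X_def[abs_def]
  proof (rule wiener_indep_increments)
    show "strict_mono_on {..Suc k} \<tau>" using mono by (simp add: strict_mono_on_def strict_mono_def)
  qed (simp add: \<tau>_def)
  then have ind: "indep_var (PiM {..<k} (\<lambda>_. borel)) (\<lambda>\<omega>. restrict (\<lambda>i. X i \<omega>) {..<k})
      (PiM {k} (\<lambda>_. borel)) (\<lambda>\<omega>. restrict (\<lambda>i. X i \<omega>) {k})"
    by (rule indep_var_restrict) auto
  \<comment> \<open>\<open>Q\<close> expresses the crossing through the increments with index below
    \<open>k\<close>, and \<open>R\<close>, defined below, the sign of increment \<open>k\<close>,
    which leads from the crossing time to \<open>t\<close>. The two sets of indices are
    disjoint.\<close>
  define Q where "Q = {x \<in> space (PiM {..<k} (\<lambda>_. borel :: real measure)). a \<le> (\<Sum>i<k. x i) \<and> (\<forall>j<k. (\<Sum>i<j. x i) < a)}"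
  have Q: "Q \<in> sets (PiM {..<k} (\<lambda>_. borel))"
  proof -
    have "(\<lambda>x. \<Sum>i<j. x i) \<in> borel_measurable (PiM {..<k} (\<lambda>_. borel :: real measure))" if "j \<le> k" for j
      using that by (intro borel_measurable_sum measurable_component_singleton) auto
    then show ?thesis unfolding Q_def
      by (intro sets.sets_Collect_conj sets.sets_Collect_finite_All' borel_measurable_le borel_measurable_less) auto
  qed
  define R where "R = {x \<in> space (PiM {k} (\<lambda>_. borel :: real measure)). 0 < x k}"
  have R: "R \<in> sets (PiM {k} (\<lambda>_. borel))"
    unfolding R_def by (intro borel_measurable_less measurable_component_singleton) auto
  have sum: "(\<Sum>i<j. restrict (\<lambda>i. X i \<omega>) {..<k} i) = W (t * real j / real n) \<omega>" if "j \<le> k" "\<omega> \<in> space \<Omega>" for j \<omega>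
  proof -
    have "(\<Sum>i<j. restrict (\<lambda>i. X i \<omega>) {..<k} i) = (\<Sum>i<j. W (\<tau> (Suc i)) \<omega> - W (\<tau> i) \<omega>)"
      using that by (intro sum.cong) (auto simp: X_def)
    also have "\<dots> = W (\<tau> j) \<omega> - W (\<tau> 0) \<omega>" by (rule sum_lessThan_telescope)
    also have "\<dots> = W (t * real j / real n) \<omega>" using that wiener_start by (simp add: \<tau>_def)
    finally show ?thesis .
  qed
  have 1: "(\<lambda>\<omega>. restrict (\<lambda>i. X i \<omega>) {..<k}) -` Q \<inter> space \<Omega> = first_crossing t n a k"
    using sum by (auto simp: Q_def first_crossing_def space_PiM)
  have 2: "(\<lambda>\<omega>. restrict (\<lambda>i. X i \<omega>) {k}) -` R \<inter> space \<Omega> = {\<omega> \<in> space \<Omega>. 0 < W t \<omega> - W (t * real k / real n) \<omega>}"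
    by (auto simp: R_def X_def \<tau>_def space_PiM)
  have "prob ((\<lambda>\<omega>. (restrict (\<lambda>i. X i \<omega>) {..<k}, restrict (\<lambda>i. X i \<omega>) {k})) -` (Q \<times> R) \<inter> space \<Omega>) =
     prob (first_crossing t n a k) * prob {\<omega> \<in> space \<Omega>. 0 < W t \<omega> - W (t * real k / real n) \<omega>}"
    using indep_varD[OF ind Q R] by (simp add: 1 2)
  also have "(\<lambda>\<omega>. (restrict (\<lambda>i. X i \<omega>) {..<k}, restrict (\<lambda>i. X i \<omega>) {k})) -` (Q \<times> R) \<inter> space \<Omega>
     = first_crossing t n a k \<inter> {\<omega> \<in> space \<Omega>. 0 < W t \<omega> - W (t * real k / real n) \<omega>}"
    unfolding 1[symmetric] 2[symmetric] by auto
  also have "prob {\<omega> \<in> space \<Omega>. 0 < W t \<omega> - W (t * real k / real n) \<omega>} = 1/2"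
    using tk t by (intro prob_increment_pos) auto
  finally show ?thesis by simp
qed

text \<open>The disjoint crossing events are summed over \<open>k\<close>. The last grid point
  \<open>k = n\<close> is left out, because no increment follows it.\<close>

lemma prob_grid_crossing:
  assumes t: "0 < t" and a: "0 < a"
  shows "prob (\<Union>k<n. first_crossing t n a k) =
     2 * prob (\<Union>k<n. first_crossing t n a k \<inter> {\<omega> \<in> space \<Omega>. 0 < W t \<omega> - W (t * real k / real n) \<omega>})"
proof -
  let ?A = "first_crossing t n a" and ?B = "\<lambda>k. {\<omega> \<in> space \<Omega>. 0 < W t \<omega> - W (t * real k / real n) \<omega>}"
  have "(\<lambda>\<omega>. W t \<omega> - W (t * real k / real n) \<omega>) \<in> borel_measurable \<Omega>" for k
    using t by (intro increment_measurable) auto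
  then have B: "?B k \<in> events" for k by (intro borel_measurable_less) auto
  have disj: "disjoint_family_on ?A {..<n}"
    unfolding disjoint_family_on_def first_crossing_def
    by (auto simp: neq_iff dest!: spec)
  have "prob (\<Union>k<n. ?A k) = (\<Sum>k<n. prob (?A k))"
    using disj first_crossing_event[OF t] by (intro finite_measure_finite_Union) auto
  also have "\<dots> = (\<Sum>k<n. 2 * prob (?A k \<inter> ?B k))"
  proof (rule sum.cong)
    fix k assume "k \<in> {..<n}"
    then show "prob (?A k) = 2 * prob (?A k \<inter> ?B k)"
      using prob_first_crossing_exceed[OF t a, of k n] by simp
  qed simp
  also have "\<dots> = 2 * (\<Sum>k<n. prob (?A k \<inter> ?B k))" by (rule sum_distrib_left[symmetric])
  also have "(\<Sum>k<n. prob (?A k \<inter> ?B k)) = prob (\<Union>k<n. ?A k \<inter> ?B k)"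
    using disj first_crossing_event[OF t] B
    by (intro finite_measure_finite_Union[symmetric]) (auto simp: disjoint_family_on_def)
  finally show ?thesis .
qed


text \<open>By uniform continuity with tolerance \<open>W t \<omega> - a\<close>, on a fine grid the
  path cannot jump from below \<open>a\<close> to \<open>W t \<omega>\<close> in one step. The first
  crossing therefore happens at a value still below \<open>W t \<omega>\<close>, hence before
  \<open>t\<close> and with a positive remaining increment.\<close>

lemma eventually_exceed_after_crossing:
  assumes t: "0 < t" and a: "0 < a" and \<omega>: "\<omega> \<in> space \<Omega>" and ex: "a < W t \<omega>"
  shows "\<forall>\<^sub>F n in sequentially. \<omega> \<in> (\<Union>k<Suc n. first_crossing t (Suc n) a k \<inter>
     {\<omega> \<in> space \<Omega>. 0 < W t \<omega> - W (t * real k / real (Suc n)) \<omega>})"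
proof -
  have "uniformly_continuous_on {0..t} (\<lambda>s. W s \<omega>)"
    by (rule compact_uniformly_continuous[OF continuous_path[OF \<omega>]]) simp
  then obtain d where d: "d > 0" "\<And>x y. x \<in> {0..t} \<Longrightarrow> y \<in> {0..t} \<Longrightarrow> dist y x < d \<Longrightarrow> dist (W y \<omega>) (W x \<omega>) < W t \<omega> - a"
    using ex unfolding uniformly_continuous_on_def by (metis diff_gt_0_iff_gt)
  have "\<forall>\<^sub>F n in sequentially. t / real (Suc n) < d" using t d(1) by real_asymp
  then show ?thesis
  proof eventually_elim
    case (elim n)
    define g where "g k = t * real k / real (Suc n)" for k
    have "a \<le> W (g (Suc n)) \<omega>" using ex by (simp add: g_def)
    define k where "k = (LEAST k. a \<le> W (g k) \<omega>)"
    have k: "a \<le> W (g k) \<omega>" unfolding k_def using \<open>a \<le> W (g (Suc n)) \<omega>\<close> by (rule LeastI)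
    have kmin: "W (g j) \<omega> < a" if "j < k" for j using not_less_Least[OF that[unfolded k_def]] by simp
    have kle: "k \<le> Suc n" unfolding k_def using \<open>a \<le> W (g (Suc n)) \<omega>\<close> by (rule Least_le)
    have "k \<noteq> 0"
    proof
      assume "k = 0"
      then show False using k a wiener_start[OF \<omega>] by (simp add: g_def)
    qed
    then obtain i where i: "k = Suc i" by (cases k) auto
    have gin: "g j \<in> {0..t}" if "j \<le> Suc n" for j
    proof -
      have "real j / real (Suc n) \<le> 1" using that by simp
      from mult_left_mono[OF this, of t] t show ?thesis by (simp add: g_def)
    qed
    have "g k - g i = t / real (Suc n)"
    proof -
      have "g k - g i = t * (real (Suc i) - real i) / real (Suc n)"
        unfolding g_def i by (simp only: right_diff_distrib diff_divide_distrib)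
      then show ?thesis by simp
    qed
    then have "dist (g k) (g i) < d" using elim t by (simp add: dist_real_def)
    then have "dist (W (g k) \<omega>) (W (g i) \<omega>) < W t \<omega> - a"
      using d(2)[OF gin gin] kle i by simp
    moreover have "W (g i) \<omega> < a" using kmin[of i] i by simp
    ultimately have lt: "W (g k) \<omega> < W t \<omega>" by (simp add: dist_real_def)
    then have "k \<noteq> Suc n" by (auto simp: g_def)
    then have "k < Suc n" using kle by simp
    then show ?case using k kmin lt \<omega> unfolding first_crossing_def g_def by auto
  qed
qed

text \<open>Some time has a value strictly above \<open>a\<close>; by continuity so does a grid
  point slightly before it, once the mesh is small.\<close>

lemma eventually_crossing:
  assumes t: "0 < t" and a: "0 < a" and \<omega>: "\<omega> \<in> space \<Omega>" and ex: "a < running_max W t \<omega>"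
  shows "\<forall>\<^sub>F n in sequentially. \<omega> \<in> (\<Union>k<Suc n. first_crossing t (Suc n) a k)"
proof -
  have "0 \<le> t" using t by simp
  then obtain u where u: "u \<in> {0..t}" "a < W u \<omega>"
    using extrema_attained[OF _ \<omega>] ex by metis
  then have "u \<noteq> 0" using wiener_start[OF \<omega>] a by auto
  then have upos: "0 < u" "u \<le> t" using u by auto
  have "continuous_on {0..t} (\<lambda>s. W s \<omega>)" by (rule continuous_path[OF \<omega>])
  then obtain d where d: "d > 0" "\<And>y. y \<in> {0..t} \<Longrightarrow> dist y u < d \<Longrightarrow> dist (W y \<omega>) (W u \<omega>) < W u \<omega> - a"
    using u unfolding continuous_on_iff by (metis diff_gt_0_iff_gt)
  have "\<forall>\<^sub>F n in sequentially. t / real (Suc n) < d" using t d(1) by real_asymp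
  then show ?thesis
  proof eventually_elim
    case (elim n)
    define g where "g k = t * real k / real (Suc n)" for k
    define j where "j = nat (\<lceil>u * real (Suc n) / t\<rceil> - 1)"
    have pos: "0 < u * real (Suc n) / t" using upos t by simp
    have "u * real (Suc n) \<le> t * real (Suc n)" using upos by (intro mult_right_mono) auto
    then have le: "u * real (Suc n) / t \<le> real (Suc n)" using t by (simp add: divide_le_eq mult.commute)
    have "j < Suc n" using pos le unfolding j_def by linarith
    have r: "real j < u * real (Suc n) / t" "u * real (Suc n) / t \<le> real j + 1"
      using pos unfolding j_def by linarith+
    have s: "t * (u * real (Suc n) / t) / real (Suc n) = u" using t by simp
    have "t * real j / real (Suc n) < t * (u * real (Suc n) / t) / real (Suc n)"
      using t r(1) by (intro divide_strict_right_mono mult_strict_left_mono) auto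
    then have g1: "g j < u" unfolding s g_def .
    have "t * (u * real (Suc n) / t) / real (Suc n) \<le> t * (real j + 1) / real (Suc n)"
      using t r(2) by (intro divide_right_mono mult_left_mono) auto
    then have "u \<le> g j + t / real (Suc n)" unfolding s g_def by (simp only: distrib_left add_divide_distrib mult_1_right)
    then have "dist (g j) u < d" using g1 elim by (simp add: dist_real_def)
    moreover have "g j \<in> {0..t}" using g1 upos t by (simp add: g_def)
    ultimately have "dist (W (g j) \<omega>) (W u \<omega>) < W u \<omega> - a" using d(2) by blast
    then have hit: "a \<le> W (g j) \<omega>" by (simp add: dist_real_def)
    define k where "k = (LEAST k. a \<le> W (g k) \<omega>)"
    have k: "a \<le> W (g k) \<omega>" unfolding k_def using hit by (rule LeastI)
    have kmin: "W (g i) \<omega> < a" if "i < k" for i using not_less_Least[OF that[unfolded k_def]] by simp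
    have "k \<le> j" unfolding k_def using hit by (rule Least_le)
    then have "k < Suc n" using \<open>j < Suc n\<close> by simp
    then show ?case using k kmin \<omega> unfolding first_crossing_def g_def by auto
  qed
qed

text \<open>\<open>E n\<close> is a crossing on the grid and \<open>D n\<close> a crossing followed
  by a rise, so \<open>prob (E n) = 2 * prob (D n)\<close>. The events \<open>D n\<close> converge
  to \<open>a < W t \<omega>\<close>, whereas \<open>E n\<close> is only known to lie within
  \<open>a \<le> running_max W t \<omega>\<close> and to contain eventually each path with
  \<open>a < running_max W t \<omega>\<close>. Hence two bounds instead of one equation.\<close>

lemma reflection_bounds:
  assumes t: "0 < t" and a: "0 < a"
  shows "prob {\<omega> \<in> space \<Omega>. a < running_max W t \<omega>} \<le> 2 * prob {\<omega> \<in> space \<Omega>. a < W t \<omega>}"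
    and "2 * prob {\<omega> \<in> space \<Omega>. a < W t \<omega>} \<le> prob {\<omega> \<in> space \<Omega>. a \<le> running_max W t \<omega>}"
proof -
  define E where "E n = (\<Union>k<Suc n. first_crossing t (Suc n) a k)" for n
  define D where "D n = (\<Union>k<Suc n. first_crossing t (Suc n) a k \<inter>
     {\<omega> \<in> space \<Omega>. 0 < W t \<omega> - W (t * real k / real (Suc n)) \<omega>})" for n
  have "(\<lambda>\<omega>. W t \<omega> - W (t * real k / real n) \<omega>) \<in> borel_measurable \<Omega>" for k n
    using t by (intro increment_measurable) auto
  then have "{\<omega> \<in> space \<Omega>. 0 < W t \<omega> - W (t * real k / real n) \<omega>} \<in> events" for k n
    by (intro borel_measurable_less) auto
  then have D: "D n \<in> events" for n
    unfolding D_def using first_crossing_event[OF t] by (intro sets.finite_UN sets.Int) (auto simp only: finite_lessThan)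
  have E: "E n \<in> events" for n unfolding E_def using first_crossing_event[OF t] by auto
  have Wm: "W t \<in> borel_measurable \<Omega>" using t by (intro wiener_measurable) simp
  have ev: "{\<omega> \<in> space \<Omega>. a < W t \<omega>} \<in> events"
    by (intro borel_measurable_less borel_measurable_const Wm)
  have evM: "{\<omega> \<in> space \<Omega>. a < running_max W t \<omega>} \<in> events" "{\<omega> \<in> space \<Omega>. a \<le> running_max W t \<omega>} \<in> events"
    by (intro borel_measurable_less borel_measurable_le borel_measurable_const running_max_measurable[OF t])+
  have "(\<lambda>n. prob (D n)) \<longlonglongrightarrow> prob {\<omega> \<in> space \<Omega>. a < W t \<omega>}"
  proof (rule prob_LIMSEQ_eventually[OF D ev])
    fix \<omega> assume \<omega>: "\<omega> \<in> space \<Omega>"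
    show "\<forall>\<^sub>F n in sequentially. \<omega> \<in> D n \<longleftrightarrow> \<omega> \<in> {\<omega> \<in> space \<Omega>. a < W t \<omega>}"
    proof (cases "a < W t \<omega>")
      case True
      from eventually_exceed_after_crossing[OF t a \<omega> True] show ?thesis
        by eventually_elim (use True \<omega> in \<open>simp add: D_def\<close>)
    next
      case False
      then have "\<omega> \<notin> D n" for n by (auto simp: D_def first_crossing_def)
      then show ?thesis using False by simp
    qed
  qed
  then have lim: "(\<lambda>n. prob (E n)) \<longlonglongrightarrow> 2 * prob {\<omega> \<in> space \<Omega>. a < W t \<omega>}"
    unfolding E_def prob_grid_crossing[OF t a] D_def by (rule tendsto_mult_left)
  have "(\<lambda>n. prob (E n \<inter> {\<omega> \<in> space \<Omega>. a < running_max W t \<omega>})) \<longlonglongrightarrow> prob {\<omega> \<in> space \<Omega>. a < running_max W t \<omega>}"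
  proof (rule prob_LIMSEQ_eventually)
    fix \<omega> assume \<omega>: "\<omega> \<in> space \<Omega>"
    show "\<forall>\<^sub>F n in sequentially. \<omega> \<in> E n \<inter> {\<omega> \<in> space \<Omega>. a < running_max W t \<omega>} \<longleftrightarrow> \<omega> \<in> {\<omega> \<in> space \<Omega>. a < running_max W t \<omega>}"
    proof (cases "a < running_max W t \<omega>")
      case True
      from eventually_crossing[OF t a \<omega> True] show ?thesis
        by eventually_elim (use True \<omega> in \<open>simp add: E_def\<close>)
    qed simp
  qed (use E evM in auto)
  then show "prob {\<omega> \<in> space \<Omega>. a < running_max W t \<omega>} \<le> 2 * prob {\<omega> \<in> space \<Omega>. a < W t \<omega>}"
    by (rule LIMSEQ_le[OF _ lim]) (use E in \<open>auto intro!: finite_measure_mono\<close>)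
  have "E n \<subseteq> {\<omega> \<in> space \<Omega>. a \<le> running_max W t \<omega>}" for n
  proof
    fix \<omega> assume "\<omega> \<in> E n"
    then obtain k where k: "k < Suc n" "\<omega> \<in> space \<Omega>" "a \<le> W (t * real k / real (Suc n)) \<omega>"
      by (auto simp: E_def first_crossing_def)
    have "real k / real (Suc n) \<le> 1" using k(1) by simp
    from mult_left_mono[OF this, of t] t have "t * real k / real (Suc n) \<in> {0..t}" by simp
    then show "\<omega> \<in> {\<omega> \<in> space \<Omega>. a \<le> running_max W t \<omega>}"
      using running_bounds(2)[OF less_imp_le[OF t] k(2)] k by force
  qed
  then have "prob (E n) \<le> prob {\<omega> \<in> space \<Omega>. a \<le> running_max W t \<omega>}" for n
    using evM by (intro finite_measure_mono)
  then show "2 * prob {\<omega> \<in> space \<Omega>. a < W t \<omega>} \<le> prob {\<omega> \<in> space \<Omega>. a \<le> running_max W t \<omega>}"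
    by (intro LIMSEQ_le_const2[OF lim]) auto
qed

lemma prob_greater_LIMSEQ:
  fixes X :: "'a \<Rightarrow> real"
  assumes X: "X \<in> borel_measurable \<Omega>"
  shows "(\<lambda>m. prob {\<omega> \<in> space \<Omega>. a + 1 / real (Suc m) < X \<omega>}) \<longlonglongrightarrow> prob {\<omega> \<in> space \<Omega>. a < X \<omega>}"
proof (rule prob_LIMSEQ_eventually)
  fix \<omega>
  show "\<forall>\<^sub>F m in sequentially. \<omega> \<in> {\<omega> \<in> space \<Omega>. a + 1 / real (Suc m) < X \<omega>} \<longleftrightarrow> \<omega> \<in> {\<omega> \<in> space \<Omega>. a < X \<omega>}"
  proof (cases "a < X \<omega>")
    case True
    have "\<forall>\<^sub>F m in sequentially. a + 1 / real (Suc m) < X \<omega>" using True by real_asymp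
    then show ?thesis by eventually_elim (use True in auto)
  next
    case False
    have "\<not> a + 1 / real (Suc m) < X \<omega>" for m
      using False divide_nonneg_nonneg[of 1 "real (Suc m)"] by linarith
    then show ?thesis using False by simp
  qed
qed (use X in \<open>auto intro!: borel_measurable_less\<close>)

text \<open>The lower bound is applied at the slightly higher level \<open>a + 1 / Suc m\<close>,
  where the weak inequality for the maximum implies the strict one at \<open>a\<close>; then
  \<open>m\<close> tends to infinity.\<close>

lemma reflection_principle:
  assumes t: "0 < t" and a: "0 < a"
  shows "prob {\<omega> \<in> space \<Omega>. a < running_max W t \<omega>} = 2 * prob {\<omega> \<in> space \<Omega>. a < W t \<omega>}"
proof (rule antisym[OF reflection_bounds(1)[OF t a]])
  have Wm: "W t \<in> borel_measurable \<Omega>" using t by (intro wiener_measurable) simp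
  have "2 * prob {\<omega> \<in> space \<Omega>. a + 1 / real (Suc m) < W t \<omega>} \<le> prob {\<omega> \<in> space \<Omega>. a < running_max W t \<omega>}" for m
  proof -
    have am: "0 < a + 1 / real (Suc m)" "a < a + 1 / real (Suc m)" using a by (auto intro: add_pos_pos)
    have "2 * prob {\<omega> \<in> space \<Omega>. a + 1 / real (Suc m) < W t \<omega>} \<le> prob {\<omega> \<in> space \<Omega>. a + 1 / real (Suc m) \<le> running_max W t \<omega>}"
      by (rule reflection_bounds(2)[OF t am(1)])
    also have "\<dots> \<le> prob {\<omega> \<in> space \<Omega>. a < running_max W t \<omega>}"
      by (intro finite_measure_mono borel_measurable_less borel_measurable_const running_max_measurable[OF t])
         (use less_le_trans[OF am(2)] in blast)
    finally show ?thesis .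
  qed
  then show "2 * prob {\<omega> \<in> space \<Omega>. a < W t \<omega>} \<le> prob {\<omega> \<in> space \<Omega>. a < running_max W t \<omega>}"
    by (intro LIMSEQ_le_const2[OF tendsto_mult_left[OF prob_greater_LIMSEQ[OF Wm]]]) auto
qed

lemma prob_abs_value_greater:
  assumes t: "0 < t" and a: "0 \<le> a"
  shows "prob {\<omega> \<in> space \<Omega>. a < \<bar>W t \<omega>\<bar>} = 2 * prob {\<omega> \<in> space \<Omega>. a < W t \<omega>}"
proof -
  have "{\<omega> \<in> space \<Omega>. a < \<bar>W t \<omega>\<bar>} = {\<omega> \<in> space \<Omega>. W t \<omega> \<in> {a<..}} \<union> {\<omega> \<in> space \<Omega>. W t \<omega> \<in> {..<-a}}"
    by auto
  also have "prob \<dots> = prob {\<omega> \<in> space \<Omega>. W t \<omega> \<in> {a<..}} + prob {\<omega> \<in> space \<Omega>. W t \<omega> \<in> {..<-a}}"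
    using t a by (intro finite_measure_Union value_event) auto
  also have "prob {\<omega> \<in> space \<Omega>. W t \<omega> \<in> {..<-a}} = prob {\<omega> \<in> space \<Omega>. - W t \<omega> \<in> {a<..}}"
    by (rule arg_cong[where f=prob]) auto
  also have "\<dots> = prob {\<omega> \<in> space \<Omega>. W t \<omega> \<in> {a<..}}" using t by (intro prob_value_uminus) auto
  finally show ?thesis by simp
qed

text \<open>Both laws have the tail
  \<open>2 * prob {\<omega> \<in> space \<Omega>. a < W t \<omega>}\<close> at positive levels, and
  both variables are nonnegative; equality of tails is equality of distribution functions.\<close>

lemma running_max_distr:
  assumes t: "0 < t"
  shows "distr \<Omega> borel (running_max W t) = distr \<Omega> borel (\<lambda>\<omega>. \<bar>W t \<omega>\<bar>)"
proof -
  have Wm: "(\<lambda>\<omega>. \<bar>W t \<omega>\<bar>) \<in> borel_measurable \<Omega>"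
    using t by (intro borel_measurable_abs wiener_measurable) simp
  note Mm = running_max_measurable[OF t]
  have nn: "0 \<le> running_max W t \<omega>" if "\<omega> \<in> space \<Omega>" for \<omega> using running_max_nonneg[OF _ that] t by simp
  have pos: "prob {\<omega> \<in> space \<Omega>. a < running_max W t \<omega>} = prob {\<omega> \<in> space \<Omega>. a < \<bar>W t \<omega>\<bar>}" if "0 < a" for a
    using reflection_principle[OF t that] prob_abs_value_greater[OF t, of a] that by simp
  have *: "prob {\<omega> \<in> space \<Omega>. a < running_max W t \<omega>} = prob {\<omega> \<in> space \<Omega>. a < \<bar>W t \<omega>\<bar>}" for a
  proof -
    consider "a > 0" | "a = 0" | "a < 0" by linarith
    then show ?thesis
    proof cases
      case 1 then show ?thesis by (rule pos)
    next
      \<comment> \<open>The reflection principle needs a positive level, so level \<open>0\<close>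
        is reached by a limit from the right.\<close>
      case 2
      have "prob {\<omega> \<in> space \<Omega>. 0 + 1 / real (Suc m) < running_max W t \<omega>} = prob {\<omega> \<in> space \<Omega>. 0 + 1 / real (Suc m) < \<bar>W t \<omega>\<bar>}" for m
        by (rule pos) simp
      then show ?thesis unfolding 2 using prob_greater_LIMSEQ[OF Mm, of 0] prob_greater_LIMSEQ[OF Wm, of 0] LIMSEQ_unique by simp
    next
      case 3
      then have "{\<omega> \<in> space \<Omega>. a < running_max W t \<omega>} = {\<omega> \<in> space \<Omega>. a < \<bar>W t \<omega>\<bar>}" using nn by force
      then show ?thesis by simp
    qed
  qed
  have c: "prob {\<omega> \<in> space \<Omega>. X \<omega> \<le> a} = 1 - prob {\<omega> \<in> space \<Omega>. a < X \<omega>}"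
    if "X \<in> borel_measurable \<Omega>" for X :: "'a \<Rightarrow> real" and a
  proof -
    have "{\<omega> \<in> space \<Omega>. X \<omega> \<le> a} = space \<Omega> - {\<omega> \<in> space \<Omega>. a < X \<omega>}" by auto
    moreover have "{\<omega> \<in> space \<Omega>. a < X \<omega>} \<in> events" using that by (intro borel_measurable_less) auto
    ultimately show ?thesis by (simp add: prob_compl)
  qed
  have "cdf (distr \<Omega> borel X) a = prob {\<omega> \<in> space \<Omega>. X \<omega> \<le> a}" if "X \<in> borel_measurable \<Omega>" for X a
    using that by (simp add: cdf_def measure_distr vimage_def Int_def conj_commute)
  then show ?thesis
    using Mm Wm * c by (intro cdf_unique real_distribution_distr ext) auto
qed

end

section \<open>Absolute continuity\<close>

lemma absolutely_continuous_distr_iff: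
  fixes X :: "'a \<Rightarrow> 'b::euclidean_space"
  assumes "X \<in> borel_measurable M"
  shows "absolutely_continuous lborel (distr M borel X) \<longleftrightarrow> (\<forall>N\<in>null_sets lborel. AE \<omega> in M. X \<omega> \<notin> N)"
proof -
  have "N \<in> null_sets (distr M borel X) \<longleftrightarrow> (AE \<omega> in M. X \<omega> \<notin> N)" if "N \<in> null_sets lborel" for N
  proof -
    have N: "N \<in> sets borel" using that by (auto simp: null_sets_def)
    then have "N \<in> null_sets (distr M borel X) \<longleftrightarrow> (AE x in distr M borel X. x \<notin> N)"
      by (intro AE_iff_null_sets) simp
    also have "\<dots> \<longleftrightarrow> (AE \<omega> in M. X \<omega> \<notin> N)" using assms N by (intro AE_distr_iff) auto
    finally show ?thesis .
  qed
  then show ?thesis by (auto simp: absolutely_continuous_def)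
qed

text \<open>If \<open>g (X \<omega>)\<close> lies in the null set \<open>N\<close>, then
  \<open>X \<omega>\<close> lies in the image of \<open>N \<inter> T\<close> under the left inverse
  \<open>h\<close>. A differentiable map into a space of at least the same dimension sends null sets
  to null sets.\<close>

lemma absolutely_continuous_distr_map:
  fixes X :: "'a \<Rightarrow> 'b::euclidean_space" and g :: "'b \<Rightarrow> 'c::euclidean_space"
  assumes X: "X \<in> borel_measurable M" and gX: "(\<lambda>\<omega>. g (X \<omega>)) \<in> borel_measurable M"
    and ac: "absolutely_continuous lborel (distr M borel X)"
    and h: "h differentiable_on T" "\<And>\<omega>. \<omega> \<in> space M \<Longrightarrow> g (X \<omega>) \<in> T \<and> h (g (X \<omega>)) = X \<omega>"
    and dim: "DIM('c) \<le> DIM('b)"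
  shows "absolutely_continuous lborel (distr M borel (\<lambda>\<omega>. g (X \<omega>)))"
  unfolding absolutely_continuous_distr_iff[OF gX]
proof
  fix N :: "'c set" assume N: "N \<in> null_sets lborel"
  then have "negligible N"
    by (auto simp: negligible_iff_null_sets intro: null_sets_completionI)
  then have "negligible (N \<inter> T)" by (rule negligible_subset) auto
  then have "negligible (h ` (N \<inter> T))"
    by (rule negligible_differentiable_image_negligible[OF dim])
       (rule differentiable_on_subset[OF h(1)], auto)
  \<comment> \<open>The image under \<open>h\<close> need not be a Borel set, hence the passage to a
    Borel null set containing it.\<close>
  then obtain N' where N': "N' \<in> null_sets lborel" "h ` (N \<inter> T) \<subseteq> N'"
    unfolding negligible_iff_null_sets null_sets_completion_iff2 by auto
  then have "AE \<omega> in M. X \<omega> \<notin> N'" using ac absolutely_continuous_distr_iff[OF X] by auto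
  then show "AE \<omega> in M. g (X \<omega>) \<notin> N"
  proof (rule AE_mp, intro AE_I2 impI notI)
    fix \<omega> assume "\<omega> \<in> space M" "X \<omega> \<notin> N'" "g (X \<omega>) \<in> N"
    then show False using h(2)[of \<omega>] N'(2) by (metis IntI imageI subsetD)
  qed
qed

lemma AE_lborel_translate:
  fixes c :: "'a::euclidean_space"
  assumes "AE y in lborel. P y" "{y. P y} \<in> sets borel"
  shows "AE y in lborel. P (c + y)"
proof -
  have "AE y in distr lborel borel ((+) c). P y" unfolding lborel_distr_plus by (rule assms(1))
  then show ?thesis using assms(2) by (subst (asm) AE_distr_iff) auto
qed

text \<open>Given \<open>T\<close>, the second vector is the translate of \<open>y U\<close> by \<open>v T\<close>, hence its conditional
  law is still absolutely continuous.\<close>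

lemma (in prob_space) absolutely_continuous_translate_indep:
  fixes T U :: "'a \<Rightarrow> 'b::second_countable_topology" and y :: "'b \<Rightarrow> 'c::euclidean_space" and x :: "'b \<Rightarrow> real"
  assumes ind: "indep_var borel T borel U"
    and m [measurable]: "x \<in> borel_measurable borel" "v \<in> borel_measurable borel" "y \<in> borel_measurable borel"
    and acT: "absolutely_continuous lborel (distr M borel (\<lambda>\<omega>. x (T \<omega>)))"
    and acU: "absolutely_continuous lborel (distr M borel (\<lambda>\<omega>. y (U \<omega>)))"
  shows "absolutely_continuous lborel (distr M borel (\<lambda>\<omega>. (x (T \<omega>), v (T \<omega>) + y (U \<omega>))))"
proof -
  have T [measurable]: "T \<in> borel_measurable M" and U [measurable]: "U \<in> borel_measurable M"
    using indep_var_rv1[OF ind] indep_var_rv2[OF ind] by auto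
  define G where "G p = (x (fst p), v (fst p) + y (snd p))" for p :: "'b \<times> 'b"
  have G: "G \<in> borel_measurable (borel \<Otimes>\<^sub>M borel)"
    unfolding G_def[abs_def] by (intro borel_measurable_Pair borel_measurable_add) measurable
  have Gm: "(\<lambda>\<omega>. (x (T \<omega>), v (T \<omega>) + y (U \<omega>))) \<in> borel_measurable M"
    using measurable_compose[OF measurable_Pair[OF T U] G] by (simp add: G_def)
  have dT: "distr M borel (\<lambda>\<omega>. x (T \<omega>)) = distr (distr M borel T) borel x"
    by (subst distr_distr) (auto simp: comp_def)
  have dU: "distr M borel (\<lambda>\<omega>. y (U \<omega>)) = distr (distr M borel U) borel y"
    by (subst distr_distr) (auto simp: comp_def)
  show ?thesis unfolding absolutely_continuous_distr_iff[OF Gm]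
  proof
    fix N :: "(real \<times> 'c) set" assume N: "N \<in> null_sets lborel"
    then have Nb: "N \<in> sets borel" by (auto simp: null_sets_def)
    have sect: "{z. (r, z) \<notin> N} \<in> sets borel" for r
    proof -
      have "(\<lambda>z. (r, z)) \<in> borel_measurable borel" by (intro borel_measurable_continuous_onI continuous_intros)
      from measurable_sets[OF this, of "- N"] Nb show ?thesis by (simp add: vimage_def)
    qed
    have "AE p in lborel \<Otimes>\<^sub>M lborel. p \<notin> N" unfolding lborel_prod by (rule AE_not_in[OF N])
    \<comment> \<open>Fubini for \<open>N\<close>: almost every section is null. Absolute continuity
      of the law of \<open>x (T \<omega>)\<close> turns "almost every real" into "almost every value
      of \<open>T\<close>".\<close>
    then have "AE r in lborel. AE z in lborel. (r, z) \<notin> N" by (rule lborel_pair.AE_pair)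
    then have "AE r in distr (distr M borel T) borel x. AE z in lborel. (r, z) \<notin> N"
      by (rule absolutely_continuous_AE[OF _ acT[unfolded dT], rotated]) simp
    then have "AE b in distr M borel T. AE z in lborel. (x b, z) \<notin> N"
      by (rule AE_distrD[rotated]) simp
    then have "AE b in distr M borel T. AE u in distr M borel U. G (b, u) \<notin> N"
    proof eventually_elim
      case (elim b)
      then have "AE z in lborel. (x b, v b + z) \<notin> N" by (rule AE_lborel_translate[OF _ sect])
      then have "AE z in distr (distr M borel U) borel y. (x b, v b + z) \<notin> N"
        by (rule absolutely_continuous_AE[OF _ acU[unfolded dU], rotated]) simp
      then have "AE u in distr M borel U. (x b, v b + y u) \<notin> N"
        by (rule AE_distrD[rotated]) simp
      then show "AE u in distr M borel U. G (b, u) \<notin> N" by (simp add: G_def)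
    qed
    moreover interpret DT: prob_space "distr M borel T" using T by (rule prob_space_distr)
    interpret DU: prob_space "distr M borel U" using U by (rule prob_space_distr)
    interpret DP: pair_sigma_finite "distr M borel T" "distr M borel U" ..
    have "{p \<in> space (distr M borel T \<Otimes>\<^sub>M distr M borel U). G p \<notin> N} \<in> sets (distr M borel T \<Otimes>\<^sub>M distr M borel U)"
    proof -
      have "G -` (- N) \<inter> space (borel \<Otimes>\<^sub>M borel) \<in> sets (borel \<Otimes>\<^sub>M borel)"
        by (rule measurable_sets[OF G]) (use Nb in simp)
      moreover have "sets (distr M borel T \<Otimes>\<^sub>M distr M borel U) = sets (borel \<Otimes>\<^sub>M borel)"
        by (intro sets_pair_measure_cong) auto
      ultimately show ?thesis by (simp add: space_pair_measure vimage_def Int_def conj_commute)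
    qed
    ultimately have "AE p in distr M borel T \<Otimes>\<^sub>M distr M borel U. G p \<notin> N"
      by (intro DP.AE_pair_measure)
    moreover have "distr M borel T \<Otimes>\<^sub>M distr M borel U = distr M (borel \<Otimes>\<^sub>M borel) (\<lambda>\<omega>. (T \<omega>, U \<omega>))"
      using ind by (simp add: indep_var_distribution_eq)
    ultimately have "AE p in distr M (borel \<Otimes>\<^sub>M borel) (\<lambda>\<omega>. (T \<omega>, U \<omega>)). G p \<notin> N"
      by (simp only:)
    then have "AE \<omega> in M. G (T \<omega>, U \<omega>) \<notin> N"
      by (rule AE_distrD[rotated]) (intro measurable_Pair T U)
    then show "AE \<omega> in M. (x (T \<omega>), v (T \<omega>) + y (U \<omega>)) \<notin> N" by (simp add: G_def)
  qed
qed

lemma borel_measurable_triple_projections: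
  "fst \<in> borel_measurable (borel :: (real \<times> real \<times> real) measure)"
  "(\<lambda>p. fst (snd p)) \<in> borel_measurable (borel :: (real \<times> real \<times> real) measure)"
  "(\<lambda>p. snd (snd p)) \<in> borel_measurable (borel :: (real \<times> real \<times> real) measure)"
  by (auto intro!: borel_measurable_continuous_onI continuous_intros)

context wiener_process
begin

lemma two_blocks_indep:
  assumes "0 < s" "s < t"
  shows "indep_var borel (path_triple W s) borel (path_triple (shifted W s) (t - s))"
proof -
  \<comment> \<open>Only the times \<open>0\<close>, \<open>s\<close>, \<open>t\<close> matter; the
    unit steps after \<open>t\<close> serve to obtain a strictly increasing sequence.\<close>
  define \<sigma> where "\<sigma> i = (if i = 0 then 0 else if i = 1 then s else t + real (i - 2))" for i :: nat
  have "\<sigma> i < \<sigma> (Suc i)" for i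
  proof -
    consider "i = 0" | "i = 1" | "i \<ge> 2" by linarith
    then show ?thesis using assms by cases (auto simp: \<sigma>_def)
  qed
  then have "strict_mono \<sigma>" by (simp add: strict_mono_Suc_iff)
  then have "indep_vars (\<lambda>_. borel) (\<lambda>i. path_triple (shifted W (\<sigma> i)) (\<sigma> (Suc i) - \<sigma> i)) {..<2}"
    by (intro block_triples_indep) (simp_all add: \<sigma>_def[of 0])
  from indep_var_of_indep_vars[OF this, of 0 1]
  have "indep_var borel (path_triple (shifted W 0) s) borel (path_triple (shifted W s) (t - s))"
    by (simp add: \<sigma>_def)
  then show ?thesis
    by (rule indep_var_cong_space) (auto simp: path_triple_shifted_0 wiener_start)
qed

lemma path_triple_shifted_bounds:
  assumes "0 \<le> s" "s < t" "\<omega> \<in> space \<Omega>" "u \<in> {s..t}"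
  shows "running_min (shifted W s) (t - s) \<omega> \<le> W u \<omega> - W s \<omega>" "W u \<omega> - W s \<omega> \<le> running_max (shifted W s) (t - s) \<omega>"
proof -
  interpret S: wiener_process \<Omega> "shifted W s" by (rule wiener_process_shifted[OF assms(1)])
  show "running_min (shifted W s) (t - s) \<omega> \<le> W u \<omega> - W s \<omega>" "W u \<omega> - W s \<omega> \<le> running_max (shifted W s) (t - s) \<omega>"
    using S.running_bounds[of "t - s" \<omega> "u - s"] assms by (auto simp: shifted_def)
qed

text \<open>The event is preserved by scaling and is a Borel condition on the path triple, so its
  probability depends neither on the process nor on the time.\<close>

lemma prob_value_eq_max_unique:
  assumes V: "wiener_process \<Omega> V" and t: "0 < t"
  shows "prob {\<omega> \<in> space \<Omega>. V t \<omega> = running_max V t \<omega>} = prob {\<omega> \<in> space \<Omega>. W 1 \<omega> = running_max W 1 \<omega>}"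
proof -
  interpret V: wiener_process \<Omega> V by fact
  interpret R: wiener_process \<Omega> "rescaled V t" by (rule V.wiener_process_rescaled[OF t])
  let ?E = "{p :: real \<times> real \<times> real. fst p = fst (snd p)}"
  have "closed ?E" by (intro closed_Collect_eq continuous_intros)
  then have E: "?E \<in> sets borel" by (rule borel_closed)
  have "measure (distr \<Omega> borel (path_triple (rescaled V t) 1)) ?E = measure (distr \<Omega> borel (path_triple W 1)) ?E"
    by (subst path_triple_distr_unique[OF R.wiener_process_axioms wiener_process_axioms]) auto
  then have "prob {\<omega> \<in> space \<Omega>. path_triple (rescaled V t) 1 \<omega> \<in> ?E} = prob {\<omega> \<in> space \<Omega>. path_triple W 1 \<omega> \<in> ?E}"
    using E path_triple_measurable R.path_triple_measurable
    by (simp add: measure_distr vimage_def Int_def conj_commute)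
  moreover have "{\<omega> \<in> space \<Omega>. path_triple (rescaled V t) 1 \<omega> \<in> ?E} = {\<omega> \<in> space \<Omega>. V t \<omega> = running_max V t \<omega>}"
    using V.path_triple_rescaled[OF t, of 1] t by auto
  ultimately show ?thesis by (simp add: path_triple_def)
qed

lemma prob_value_greater_rescale:
  assumes "0 < t"
  shows "prob {\<omega> \<in> space \<Omega>. a < W t \<omega>} = prob {\<omega> \<in> space \<Omega>. a / sqrt t < W 1 \<omega>}"
proof -
  interpret R: wiener_process \<Omega> "rescaled W t" by (rule wiener_process_rescaled[OF assms])
  have "prob {\<omega> \<in> space \<Omega>. rescaled W t 1 \<omega> \<in> {a / sqrt t<..}} = prob {\<omega> \<in> space \<Omega>. W 1 \<omega> \<in> {a / sqrt t<..}}"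
    using R.prob_value[of 1 "{a / sqrt t<..}"] prob_value[of 1 "{a / sqrt t<..}"] by simp
  moreover have "{\<omega> \<in> space \<Omega>. rescaled W t 1 \<omega> \<in> {a / sqrt t<..}} = {\<omega> \<in> space \<Omega>. a < W t \<omega>}"
    using assms by (auto simp: rescaled_def divide_less_cancel)
  ultimately show ?thesis by simp
qed

text \<open>Let \<open>p\<close> be this probability; it does not depend on the time. If the maximum over \<open>[0,1]\<close> is
  attained at \<open>1\<close>, then so is the one over \<open>[s,1]\<close>, and \<open>W s \<ge> - (W 1 - W s)\<close>. As \<open>s\<close> tends to \<open>1\<close>
  these events become independent, of probabilities \<open>p\<close> and \<open>1/2\<close>, so \<open>p \<le> p/2\<close>.\<close>

lemma prob_value_eq_max:
  assumes "0 < t"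
  shows "prob {\<omega> \<in> space \<Omega>. W t \<omega> = running_max W t \<omega>} = 0"
proof -
  define p where "p = prob {\<omega> \<in> space \<Omega>. W 1 \<omega> = running_max W 1 \<omega>}"
  \<comment> \<open>The maximum at time \<open>1\<close> forces \<open>0 \<le> W 1 \<omega>\<close>,
    so either \<open>W s \<omega>\<close> is above \<open>- 2 * e\<close> or the last increment
    exceeds \<open>e\<close>. The first alternative is independent of the event that the path after
    \<open>s\<close> ends at its maximum.\<close>
  have bound: "p \<le> p * prob {\<omega> \<in> space \<Omega>. - (2 * e) / sqrt s < W 1 \<omega>} + prob {\<omega> \<in> space \<Omega>. e / sqrt (1 - s) < W 1 \<omega>}"
    if s: "0 < s" "s < 1" and e: "0 < e" for s e
  proof -
    interpret S: wiener_process \<Omega> "shifted W s" by (rule wiener_process_shifted) (use s in simp)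
    let ?h = "1 - s"
    have h: "0 < ?h" using s by simp
    define A where "A = {\<omega> \<in> space \<Omega>. - (2 * e) < W s \<omega>}"
    define B where "B = {\<omega> \<in> space \<Omega>. shifted W s ?h \<omega> = running_max (shifted W s) ?h \<omega>}"
    define C where "C = {\<omega> \<in> space \<Omega>. e < shifted W s ?h \<omega>}"
    have Wm: "W s \<in> borel_measurable \<Omega>" "shifted W s ?h \<in> borel_measurable \<Omega>"
      using s by (auto intro: wiener_measurable S.wiener_measurable)
    have ev: "A \<in> events" "B \<in> events" "C \<in> events"
      unfolding A_def B_def C_def
      by (intro borel_measurable_less borel_measurable_eq Wm borel_measurable_const S.running_max_measurable[OF h])+
    have "{\<omega> \<in> space \<Omega>. W 1 \<omega> = running_max W 1 \<omega>} \<subseteq> (A \<inter> B) \<union> C"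
    proof
      fix \<omega> assume "\<omega> \<in> {\<omega> \<in> space \<Omega>. W 1 \<omega> = running_max W 1 \<omega>}"
      then have \<omega>: "\<omega> \<in> space \<Omega>" and eq: "W 1 \<omega> = running_max W 1 \<omega>" by auto
      have up: "W u \<omega> \<le> W 1 \<omega>" if "u \<in> {0..1}" for u using running_bounds(2)[of 1 \<omega> u] \<omega> eq that by simp
      have "0 \<le> W 1 \<omega>" using up[of 0] wiener_start[OF \<omega>] by simp
      then have "\<omega> \<in> A \<or> \<omega> \<in> C" using \<omega> e by (auto simp: A_def C_def shifted_def)
      moreover have "running_max (shifted W s) ?h \<omega> = shifted W s ?h \<omega>"
        by (rule S.running_max_eqI) (use up s in \<open>auto simp: shifted_def\<close>)
      then have "\<omega> \<in> B" using \<omega> by (simp add: B_def)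
      ultimately show "\<omega> \<in> (A \<inter> B) \<union> C" by blast
    qed
    then have "p \<le> prob ((A \<inter> B) \<union> C)" unfolding p_def using ev by (intro finite_measure_mono) auto
    also have "\<dots> \<le> prob (A \<inter> B) + prob C" using ev by (intro measure_Un_le) auto
    also have "prob (A \<inter> B) = prob A * prob B"
    proof -
      let ?A = "{q :: real \<times> real \<times> real. - (2 * e) < fst q}" and ?B = "{q :: real \<times> real \<times> real. fst q = fst (snd q)}"
      have "open ?A" "closed ?B" by (intro open_Collect_less closed_Collect_eq continuous_intros)+
      then have AB: "?A \<in> sets borel" "?B \<in> sets borel" by (auto intro: borel_open borel_closed)
      have 1: "path_triple W s -` ?A \<inter> space \<Omega> = A" by (auto simp: path_triple_def A_def)
      have 2: "path_triple (shifted W s) ?h -` ?B \<inter> space \<Omega> = B" by (auto simp: path_triple_def B_def)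
      have "(\<lambda>\<omega>. (path_triple W s \<omega>, path_triple (shifted W s) ?h \<omega>)) -` (?A \<times> ?B) \<inter> space \<Omega> = A \<inter> B"
        unfolding 1[symmetric] 2[symmetric] by auto
      then show ?thesis using indep_varD[OF two_blocks_indep[OF s] AB] unfolding 1 2 by simp
    qed
    also have "prob B = p"
      unfolding B_def p_def by (rule prob_value_eq_max_unique[OF S.wiener_process_axioms h])
    also have "prob A = prob {\<omega> \<in> space \<Omega>. - (2 * e) / sqrt s < W 1 \<omega>}"
      unfolding A_def by (rule prob_value_greater_rescale[OF s(1)])
    also have "prob C = prob {\<omega> \<in> space \<Omega>. e / sqrt ?h < shifted W s 1 \<omega>}"
      unfolding C_def by (rule S.prob_value_greater_rescale[OF h])
    also have "\<dots> = prob {\<omega> \<in> space \<Omega>. e / sqrt ?h < W 1 \<omega>}"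
      using S.prob_value[of 1 "{e / sqrt ?h<..}"] prob_value[of 1 "{e / sqrt ?h<..}"] by simp
    finally show ?thesis by (simp add: mult.commute)
  qed
  \<comment> \<open>The margin must vanish, yet dominate the size \<open>sqrt (1 - s)\<close> of the
    last increment. With \<open>1 - s = e ^ 4\<close> the ratio \<open>e / sqrt (1 - s)\<close>
    equals \<open>1 / e\<close> and diverges, while \<open>2 * e / sqrt s\<close> tends to
    \<open>0\<close>. The factor \<open>1 / 2\<close> keeps \<open>e\<close> below \<open>1\<close>
    and \<open>s\<close> positive.\<close>
  define e where "e m = 1 / real (Suc m) / 2" for m
  define s where "s m = 1 - (e m) ^ 4" for m
  have e: "0 < e m" "e m < 1" for m by (auto simp: e_def field_simps)
  have e4: "0 < (e m) ^ 4" "(e m) ^ 4 < 1" for m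
    using e(1)[of m] power_strict_mono[OF e(2), of m 4] by (auto intro: less_imp_le)
  have s: "0 < s m" "s m < 1" for m using e4 by (auto simp: s_def)
  have sq: "sqrt (1 - s m) = (e m)^2" for m
    using e(1)[of m] real_sqrt_abs[of "(e m)^2"] by (simp add: s_def flip: power_mult)
  have Wm: "W 1 \<in> borel_measurable \<Omega>" by (rule wiener_measurable) simp
  have lim1: "(\<lambda>m. - (2 * e m) / sqrt (s m)) \<longlonglongrightarrow> 0" unfolding s_def e_def by real_asymp
  have lim2: "filterlim (\<lambda>m. e m / (e m)^2) at_top sequentially" unfolding e_def by real_asymp
  have L1: "(\<lambda>m. prob {\<omega> \<in> space \<Omega>. - (2 * e m) / sqrt (s m) < W 1 \<omega>}) \<longlonglongrightarrow> prob {\<omega> \<in> space \<Omega>. 0 \<le> W 1 \<omega>}"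
  proof (rule prob_LIMSEQ_eventually)
    fix \<omega>
    show "\<forall>\<^sub>F m in sequentially. \<omega> \<in> {\<omega> \<in> space \<Omega>. - (2 * e m) / sqrt (s m) < W 1 \<omega>} \<longleftrightarrow> \<omega> \<in> {\<omega> \<in> space \<Omega>. 0 \<le> W 1 \<omega>}"
    proof (cases "0 \<le> W 1 \<omega>")
      case True
      have "- (2 * e m) / sqrt (s m) < 0" for m using e(1)[of m] s(1)[of m] by (simp add: divide_neg_pos)
      then have "- (2 * e m) / sqrt (s m) < W 1 \<omega>" for m using True less_le_trans by blast
      then show ?thesis using True by simp
    next
      case False
      then have "\<forall>\<^sub>F m in sequentially. W 1 \<omega> < - (2 * e m) / sqrt (s m)"
        by (intro order_tendstoD(1)[OF lim1]) simp
      then show ?thesis by eventually_elim (use False in auto)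
    qed
  qed (intro borel_measurable_less borel_measurable_le borel_measurable_const Wm)+
  have L2: "(\<lambda>m. prob {\<omega> \<in> space \<Omega>. e m / (e m)^2 < W 1 \<omega>}) \<longlonglongrightarrow> prob {}"
  proof (rule prob_LIMSEQ_eventually)
    fix \<omega>
    have "\<forall>\<^sub>F m in sequentially. W 1 \<omega> \<le> e m / (e m)^2"
      using lim2 by (simp add: filterlim_at_top)
    then show "\<forall>\<^sub>F m in sequentially. \<omega> \<in> {\<omega> \<in> space \<Omega>. e m / (e m)^2 < W 1 \<omega>} \<longleftrightarrow> \<omega> \<in> {}"
      by eventually_elim auto
  qed (auto intro!: borel_measurable_less borel_measurable_const Wm)
  have "(\<lambda>m. p * prob {\<omega> \<in> space \<Omega>. - (2 * e m) / sqrt (s m) < W 1 \<omega>} + prob {\<omega> \<in> space \<Omega>. e m / (e m)^2 < W 1 \<omega>})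
     \<longlonglongrightarrow> p * prob {\<omega> \<in> space \<Omega>. 0 \<le> W 1 \<omega>} + prob {}"
    by (intro tendsto_intros L1 L2)
  then have "(\<lambda>m. p * prob {\<omega> \<in> space \<Omega>. - (2 * e m) / sqrt (s m) < W 1 \<omega>} + prob {\<omega> \<in> space \<Omega>. e m / (e m)^2 < W 1 \<omega>})
     \<longlonglongrightarrow> p / 2" using prob_value_pos(2)[of 1] by simp
  then have "p \<le> p / 2"
    by (rule LIMSEQ_le_const) (use bound[OF s e(1)] sq in auto)
  moreover have "0 \<le> p" by (simp add: p_def)
  ultimately have "p = 0" by linarith
  then show ?thesis using prob_value_eq_max_unique[OF wiener_process_axioms assms] by (simp add: p_def)
qed


section \<open>Absolute continuity for one, two and three coordinates\<close>

lemma absolutely_continuous_value: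
  assumes "0 < t"
  shows "absolutely_continuous lborel (distr \<Omega> borel (W t))"
  unfolding value_distr[OF assms] by (rule absolutely_continuousI_density) simp

lemma absolutely_continuous_running_max:
  assumes t: "0 < t"
  shows "absolutely_continuous lborel (distr \<Omega> borel (running_max W t))"
proof -
  interpret N: wiener_process \<Omega> "\<lambda>t \<omega>. - W t \<omega>" by (rule wiener_process_uminus)
  have Wm: "W t \<in> borel_measurable \<Omega>" "(\<lambda>\<omega>. - W t \<omega>) \<in> borel_measurable \<Omega>" "(\<lambda>\<omega>. \<bar>W t \<omega>\<bar>) \<in> borel_measurable \<Omega>"
    using t by (auto intro!: wiener_measurable N.wiener_measurable borel_measurable_abs)
  show ?thesis unfolding running_max_distr[OF t] absolutely_continuous_distr_iff[OF Wm(3)]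
  proof
    fix A :: "real set" assume A: "A \<in> null_sets lborel"
    have "AE \<omega> in \<Omega>. W t \<omega> \<notin> A"
      using A absolutely_continuous_value[OF t] absolutely_continuous_distr_iff[OF Wm(1)] by blast
    moreover have "AE \<omega> in \<Omega>. - W t \<omega> \<notin> A"
      using A N.absolutely_continuous_value[OF t] absolutely_continuous_distr_iff[OF Wm(2)] by blast
    ultimately show "AE \<omega> in \<Omega>. \<bar>W t \<omega>\<bar> \<notin> A"
      by eventually_elim (simp add: abs_if)
  qed
qed

lemma running_max_uminus: "running_max (\<lambda>t \<omega>. - W t \<omega>) t \<omega> = - running_min W t \<omega>"
  by (simp add: running_max_def running_min_def Inf_real_def image_image)

lemma absolutely_continuous_running_min:
  assumes t: "0 < t"
  shows "absolutely_continuous lborel (distr \<Omega> borel (running_min W t))"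
proof -
  interpret N: wiener_process \<Omega> "\<lambda>t \<omega>. - W t \<omega>" by (rule wiener_process_uminus)
  have "absolutely_continuous lborel (distr \<Omega> borel (\<lambda>\<omega>. - running_max (\<lambda>t \<omega>. - W t \<omega>) t \<omega>))"
    by (rule absolutely_continuous_distr_map[where h=uminus and T=UNIV])
       (use N.absolutely_continuous_running_max[OF t] N.running_max_measurable[OF t] in
         \<open>auto intro!: derivative_intros simp: differentiable_on_minus\<close>)
  then show ?thesis by (simp add: running_max_uminus)
qed

lemma AE_value_neq_max: "0 < t \<Longrightarrow> AE \<omega> in \<Omega>. W t \<omega> \<noteq> running_max W t \<omega>"
proof -
  assume t: "0 < t"
  have "{\<omega> \<in> space \<Omega>. W t \<omega> = running_max W t \<omega>} \<in> events"
    using t by (intro borel_measurable_eq wiener_measurable running_max_measurable) auto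
  then show ?thesis using prob_value_eq_max[OF t]
    by (subst AE_iff_measurable[OF _ refl]) (auto simp: emeasure_eq_measure)
qed

lemma AE_value_neq_0: "0 < t \<Longrightarrow> AE \<omega> in \<Omega>. W t \<omega> \<noteq> 0"
proof -
  assume t: "0 < t"
  then have "{\<omega> \<in> space \<Omega>. W t \<omega> \<in> {0}} \<in> events" by (intro value_event) auto
  then show ?thesis using prob_value_eq[OF t, of 0]
    by (subst AE_iff_measurable[OF _ refl]) (auto simp: emeasure_eq_measure)
qed

text \<open>Almost surely a maximizer lies before \<open>t\<close>, so the maximum up to some
  rational \<open>s < t\<close> is already the maximum up to \<open>t\<close>. For each such
  \<open>s\<close> the pair consists of \<open>running_max W s \<omega>\<close> and a translate of
  an independent increment; countably many null sets are discarded.\<close>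

lemma absolutely_continuous_max_value:
  assumes t: "0 < t"
  shows "absolutely_continuous lborel (distr \<Omega> borel (\<lambda>\<omega>. (running_max W t \<omega>, W t \<omega>)))"
proof -
  have m: "(\<lambda>\<omega>. (running_max W t \<omega>, W t \<omega>)) \<in> borel_measurable \<Omega>"
    using t by (intro borel_measurable_Pair running_max_measurable wiener_measurable) auto
  show ?thesis unfolding absolutely_continuous_distr_iff[OF m]
  proof
    fix N :: "(real \<times> real) set" assume N: "N \<in> null_sets lborel"
    have split: "AE \<omega> in \<Omega>. (running_max W s \<omega>, W s \<omega> + shifted W s (t - s) \<omega>) \<notin> N" if s: "0 < s" "s < t" for s
    proof -
      interpret S: wiener_process \<Omega> "shifted W s" by (rule wiener_process_shifted) (use s in simp)
      have "absolutely_continuous lborel (distr \<Omega> borel (\<lambda>\<omega>. (fst (snd (path_triple W s \<omega>)),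
         fst (path_triple W s \<omega>) + fst (path_triple (shifted W s) (t - s) \<omega>))))"
        using absolutely_continuous_running_max[OF s(1)] S.absolutely_continuous_value[of "t - s"] s
        by (intro absolutely_continuous_translate_indep[OF two_blocks_indep[OF s]] borel_measurable_triple_projections)
           (simp_all add: path_triple_def)
      moreover have "(\<lambda>\<omega>. (running_max W s \<omega>, W s \<omega> + shifted W s (t - s) \<omega>)) \<in> borel_measurable \<Omega>"
        using s by (intro borel_measurable_Pair borel_measurable_add running_max_measurable wiener_measurable S.wiener_measurable) auto
      ultimately show ?thesis using N by (simp add: path_triple_def absolutely_continuous_distr_iff)
    qed
    have "countable (\<rat> \<inter> {0<..<t})" by (intro countable_Int1 countable_rat)
    then have "AE \<omega> in \<Omega>. \<forall>s\<in>\<rat> \<inter> {0<..<t}. (running_max W s \<omega>, W s \<omega> + shifted W s (t - s) \<omega>) \<notin> N"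
      using split by (subst AE_ball_countable) auto
    with AE_value_neq_max[OF t] show "AE \<omega> in \<Omega>. (running_max W t \<omega>, W t \<omega>) \<notin> N"
    proof (rule AE_mp[OF AE_conjI], intro AE_I2 impI, elim conjE)
      fix \<omega> assume \<omega>: "\<omega> \<in> space \<Omega>" and ne: "W t \<omega> \<noteq> running_max W t \<omega>"
        and *: "\<forall>s\<in>\<rat> \<inter> {0<..<t}. (running_max W s \<omega>, W s \<omega> + shifted W s (t - s) \<omega>) \<notin> N"
      obtain u where u: "u \<in> {0..t}" "running_max W t \<omega> = W u \<omega>" "\<And>s. s \<in> {0..t} \<Longrightarrow> W s \<omega> \<le> W u \<omega>"
        using extrema_attained[of t \<omega>] t \<omega> by (metis less_imp_le)
      have "u < t" using u ne by (cases "u = t") auto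
      then obtain s where s: "s \<in> \<rat>" "u < s" "s < t" using Rats_dense_in_real by blast
      have "running_max W s \<omega> = W u \<omega>" by (rule running_max_eqI) (use u s in auto)
      moreover have "W s \<omega> + shifted W s (t - s) \<omega> = W t \<omega>" by (simp add: shifted_def)
      moreover have "s \<in> \<rat> \<inter> {0<..<t}" using s u by auto
      ultimately show "(running_max W t \<omega>, W t \<omega>) \<notin> N" using * u(2) by metis
    qed
  qed
qed

lemma absolutely_continuous_min_value:
  assumes t: "0 < t"
  shows "absolutely_continuous lborel (distr \<Omega> borel (\<lambda>\<omega>. (running_min W t \<omega>, W t \<omega>)))"
proof -
  interpret N: wiener_process \<Omega> "\<lambda>t \<omega>. - W t \<omega>" by (rule wiener_process_uminus)
  have m: "(\<lambda>\<omega>. (running_max (\<lambda>t \<omega>. - W t \<omega>) t \<omega>, - W t \<omega>)) \<in> borel_measurable \<Omega>"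
    using t by (intro borel_measurable_Pair N.running_max_measurable N.wiener_measurable) auto
  have "absolutely_continuous lborel (distr \<Omega> borel (\<lambda>\<omega>. - (running_max (\<lambda>t \<omega>. - W t \<omega>) t \<omega>, - W t \<omega>)))"
    by (rule absolutely_continuous_distr_map[where h=uminus and T=UNIV, OF m borel_measurable_uminus[OF m] N.absolutely_continuous_max_value[OF t]])
       (auto intro!: derivative_intros simp: differentiable_on_minus)
  then show ?thesis by (simp add: running_max_uminus)
qed

text \<open>The extremum before \<open>s\<close> plays the role of the real coordinate in the
  translation lemma. \<open>W s \<omega>\<close> translates both coordinates of the pair formed by
  the other extremum and the value after \<open>s\<close>, hence the diagonal map. The order of
  coordinates is repaired by a linear permutation.\<close>

lemma absolutely_continuous_split:
  assumes s: "0 < s" "s < t"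
  shows "absolutely_continuous lborel (distr \<Omega> borel (\<lambda>\<omega>. (W t \<omega>, running_max W s \<omega>, W s \<omega> + running_min (shifted W s) (t - s) \<omega>)))"
    and "absolutely_continuous lborel (distr \<Omega> borel (\<lambda>\<omega>. (W t \<omega>, W s \<omega> + running_max (shifted W s) (t - s) \<omega>, running_min W s \<omega>)))"
proof -
  interpret S: wiener_process \<Omega> "shifted W s" by (rule wiener_process_shifted) (use s in simp)
  have ts: "0 < t - s" using s by simp
  have W: "W s \<in> borel_measurable \<Omega>" "shifted W s (t - s) \<in> borel_measurable \<Omega>" "W t \<in> borel_measurable \<Omega>"
    using s by (auto intro!: wiener_measurable S.wiener_measurable)
  note M = running_max_measurable[OF s(1)] running_min_measurable[OF s(1)] S.running_max_measurable[OF ts] S.running_min_measurable[OF ts]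
  have Wt: "W s \<omega> + shifted W s (t - s) \<omega> = W t \<omega>" for \<omega> by (simp add: shifted_def)
  have proj: "(\<lambda>p :: real \<times> real \<times> real. (fst p, fst p)) \<in> borel_measurable borel"
    "(\<lambda>p :: real \<times> real \<times> real. (snd (snd p), fst p)) \<in> borel_measurable borel"
    "(\<lambda>p :: real \<times> real \<times> real. (fst (snd p), fst p)) \<in> borel_measurable borel"
    by (auto intro!: borel_measurable_continuous_onI continuous_intros)
  have "absolutely_continuous lborel (distr \<Omega> borel (\<lambda>\<omega>. (fst (snd (path_triple W s \<omega>)),
       (\<lambda>p. (fst p, fst p)) (path_triple W s \<omega>) + (\<lambda>p. (snd (snd p), fst p)) (path_triple (shifted W s) (t - s) \<omega>))))"
    using absolutely_continuous_running_max[OF s(1)] S.absolutely_continuous_min_value[OF ts]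
    by (intro absolutely_continuous_translate_indep[OF two_blocks_indep[OF s]] borel_measurable_triple_projections proj)
       (simp_all add: path_triple_def)
  then have ac1: "absolutely_continuous lborel (distr \<Omega> borel (\<lambda>\<omega>. (running_max W s \<omega>, W s \<omega> + running_min (shifted W s) (t - s) \<omega>, W t \<omega>)))"
    by (simp add: path_triple_def Wt)
  have m1: "(\<lambda>\<omega>. (running_max W s \<omega>, W s \<omega> + running_min (shifted W s) (t - s) \<omega>, W t \<omega>)) \<in> borel_measurable \<Omega>"
    "(\<lambda>\<omega>. (W t \<omega>, running_max W s \<omega>, W s \<omega> + running_min (shifted W s) (t - s) \<omega>)) \<in> borel_measurable \<Omega>"
    by (intro borel_measurable_Pair borel_measurable_add M W)+
  have "absolutely_continuous lborel (distr \<Omega> borel (\<lambda>\<omega>. (\<lambda>(a, b, c). (c, a, b)) (running_max W s \<omega>, W s \<omega> + running_min (shifted W s) (t - s) \<omega>, W t \<omega>)))"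
    by (rule absolutely_continuous_distr_map[where h="\<lambda>p. (fst (snd p), snd (snd p), fst p)" and T=UNIV, OF m1(1) _ ac1])
       (use m1 in \<open>auto intro!: bounded_linear_imp_differentiable_on bounded_linear_intros\<close>)
  then show "absolutely_continuous lborel (distr \<Omega> borel (\<lambda>\<omega>. (W t \<omega>, running_max W s \<omega>, W s \<omega> + running_min (shifted W s) (t - s) \<omega>)))"
    by simp
  have "absolutely_continuous lborel (distr \<Omega> borel (\<lambda>\<omega>. (snd (snd (path_triple W s \<omega>)),
       (\<lambda>p. (fst p, fst p)) (path_triple W s \<omega>) + (\<lambda>p. (fst (snd p), fst p)) (path_triple (shifted W s) (t - s) \<omega>))))"
    using absolutely_continuous_running_min[OF s(1)] S.absolutely_continuous_max_value[OF ts]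
    by (intro absolutely_continuous_translate_indep[OF two_blocks_indep[OF s]] borel_measurable_triple_projections proj)
       (simp_all add: path_triple_def)
  then have ac2: "absolutely_continuous lborel (distr \<Omega> borel (\<lambda>\<omega>. (running_min W s \<omega>, W s \<omega> + running_max (shifted W s) (t - s) \<omega>, W t \<omega>)))"
    by (simp add: path_triple_def Wt)
  have m2: "(\<lambda>\<omega>. (running_min W s \<omega>, W s \<omega> + running_max (shifted W s) (t - s) \<omega>, W t \<omega>)) \<in> borel_measurable \<Omega>"
    "(\<lambda>\<omega>. (W t \<omega>, W s \<omega> + running_max (shifted W s) (t - s) \<omega>, running_min W s \<omega>)) \<in> borel_measurable \<Omega>"
    by (intro borel_measurable_Pair borel_measurable_add M W)+
  have "absolutely_continuous lborel (distr \<Omega> borel (\<lambda>\<omega>. (\<lambda>(a, b, c). (c, b, a)) (running_min W s \<omega>, W s \<omega> + running_max (shifted W s) (t - s) \<omega>, W t \<omega>)))"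
    by (rule absolutely_continuous_distr_map[where h="\<lambda>p. (snd (snd p), fst (snd p), fst p)" and T=UNIV, OF m2(1) _ ac2])
       (use m2 in \<open>auto intro!: bounded_linear_imp_differentiable_on bounded_linear_intros\<close>)
  then show "absolutely_continuous lborel (distr \<Omega> borel (\<lambda>\<omega>. (W t \<omega>, W s \<omega> + running_max (shifted W s) (t - s) \<omega>, running_min W s \<omega>)))"
    by simp
qed

text \<open>Almost surely some rational \<open>s\<close> separates the times at which the two extrema are attained.
  Then one extremum is determined by the path up to \<open>s\<close> and the other one by the path after \<open>s\<close>.\<close>

lemma absolutely_continuous_path_triple:
  assumes t: "0 < t"
  shows "absolutely_continuous lborel (distr \<Omega> borel (path_triple W t))"
  unfolding absolutely_continuous_distr_iff[OF path_triple_measurable[OF t]]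
proof
  fix N :: "(real \<times> real \<times> real) set" assume N: "N \<in> null_sets lborel"
  have c: "countable (\<rat> \<inter> {0<..<t})" by (intro countable_Int1 countable_rat)
  have split: "AE \<omega> in \<Omega>. (W t \<omega>, running_max W s \<omega>, W s \<omega> + running_min (shifted W s) (t - s) \<omega>) \<notin> N"
    "AE \<omega> in \<Omega>. (W t \<omega>, W s \<omega> + running_max (shifted W s) (t - s) \<omega>, running_min W s \<omega>) \<notin> N"
    if s: "0 < s" "s < t" for s
  proof -
    interpret S: wiener_process \<Omega> "shifted W s" by (rule wiener_process_shifted) (use s in simp)
    have ts: "0 < t - s" using s by simp
    note M = running_max_measurable[OF s(1)] running_min_measurable[OF s(1)] S.running_max_measurable[OF ts] S.running_min_measurable[OF ts]
    have W: "W s \<in> borel_measurable \<Omega>" "W t \<in> borel_measurable \<Omega>" using s by (auto intro!: wiener_measurable)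
    have m: "(\<lambda>\<omega>. (W t \<omega>, running_max W s \<omega>, W s \<omega> + running_min (shifted W s) (t - s) \<omega>)) \<in> borel_measurable \<Omega>"
      "(\<lambda>\<omega>. (W t \<omega>, W s \<omega> + running_max (shifted W s) (t - s) \<omega>, running_min W s \<omega>)) \<in> borel_measurable \<Omega>"
      by (intro borel_measurable_Pair borel_measurable_add M W)+
    show "AE \<omega> in \<Omega>. (W t \<omega>, running_max W s \<omega>, W s \<omega> + running_min (shifted W s) (t - s) \<omega>) \<notin> N"
      using absolutely_continuous_split(1)[OF s] N unfolding absolutely_continuous_distr_iff[OF m(1)] by blast
    show "AE \<omega> in \<Omega>. (W t \<omega>, W s \<omega> + running_max (shifted W s) (t - s) \<omega>, running_min W s \<omega>) \<notin> N"
      using absolutely_continuous_split(2)[OF s] N unfolding absolutely_continuous_distr_iff[OF m(2)] by blast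
  qed
  have 1: "AE \<omega> in \<Omega>. \<forall>s\<in>\<rat> \<inter> {0<..<t}. (W t \<omega>, running_max W s \<omega>, W s \<omega> + running_min (shifted W s) (t - s) \<omega>) \<notin> N"
    using split by (subst AE_ball_countable[OF c]) auto
  have 2: "AE \<omega> in \<Omega>. \<forall>s\<in>\<rat> \<inter> {0<..<t}. (W t \<omega>, W s \<omega> + running_max (shifted W s) (t - s) \<omega>, running_min W s \<omega>) \<notin> N"
    using split by (subst AE_ball_countable[OF c]) auto
  from 1 2 AE_value_neq_0[OF t] AE_space show "AE \<omega> in \<Omega>. path_triple W t \<omega> \<notin> N"
  proof eventually_elim
    case (elim \<omega>)
    note \<omega> = elim(4)
    obtain u v where uv: "u \<in> {0..t}" "v \<in> {0..t}" "running_max W t \<omega> = W u \<omega>" "running_min W t \<omega> = W v \<omega>"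
      "\<And>s. s \<in> {0..t} \<Longrightarrow> W v \<omega> \<le> W s \<omega> \<and> W s \<omega> \<le> W u \<omega>"
      using extrema_attained[of t \<omega>] t \<omega> by (metis less_imp_le)
    \<comment> \<open>If the maximum and the minimum were attained at one time, the path would be
      constant on the interval and end at \<open>0\<close>.\<close>
    have "u \<noteq> v"
    proof
      assume "u = v"
      then have "W 0 \<omega> = W t \<omega>" using uv(5)[of 0] uv(5)[of t] t by auto
      then show False using elim(3) wiener_start[OF \<omega>] by simp
    qed
    then consider "u < v" | "v < u" by linarith
    then show ?case
    proof cases
      case 1
      then obtain s where s: "s \<in> \<rat>" "u < s" "s < v" using Rats_dense_in_real by blast
      then have s': "s \<in> \<rat> \<inter> {0<..<t}" using uv by auto
      interpret S: wiener_process \<Omega> "shifted W s" by (rule wiener_process_shifted) (use s' in simp)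
      have "running_max W s \<omega> = W u \<omega>" by (rule running_max_eqI) (use uv s in auto)
      moreover have "running_min (shifted W s) (t - s) \<omega> = shifted W s (v - s) \<omega>"
        by (rule S.running_min_eqI) (use uv s s' in \<open>auto simp: shifted_def\<close>)
      then have "W s \<omega> + running_min (shifted W s) (t - s) \<omega> = W v \<omega>" by (simp add: shifted_def)
      ultimately show ?thesis using bspec[OF elim(1) s'] uv(3,4) by (simp add: path_triple_def)
    next
      case 2
      then obtain s where s: "s \<in> \<rat>" "v < s" "s < u" using Rats_dense_in_real by blast
      then have s': "s \<in> \<rat> \<inter> {0<..<t}" using uv by auto
      interpret S: wiener_process \<Omega> "shifted W s" by (rule wiener_process_shifted) (use s' in simp)
      have "running_min W s \<omega> = W v \<omega>" by (rule running_min_eqI) (use uv s in auto)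
      moreover have "running_max (shifted W s) (t - s) \<omega> = shifted W s (u - s) \<omega>"
        by (rule S.running_max_eqI) (use uv s s' in \<open>auto simp: shifted_def\<close>)
      then have "W s \<omega> + running_max (shifted W s) (t - s) \<omega> = W u \<omega>" by (simp add: shifted_def)
      ultimately show ?thesis using bspec[OF elim(2) s'] uv(3,4) by (simp add: path_triple_def)
    qed
  qed
qed

end

section \<open>Full support\<close>

context wiener_process
begin

text \<open>The maximum has the law of \<open>\<bar>W h \<omega>\<bar>\<close>, and
  \<open>W h\<close> has mean \<open>0\<close> and variance \<open>h\<close>, so Chebyshev's
  inequality applies.\<close>

lemma prob_max_ge_bound:
  assumes h: "0 < h" and d: "0 < d"
  shows "prob {\<omega> \<in> space \<Omega>. d \<le> running_max W h \<omega>} \<le> h / d\<^sup>2"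
proof -
  have D: "distributed \<Omega> lborel (W h) (normal_density 0 (sqrt h))"
    using value_distr[OF h] wiener_measurable[of h] h
    by (auto simp: distributed_def distr_cong[of \<Omega> \<Omega> lborel borel])
  have var: "variance (W h) = h" and exp: "expectation (W h) = 0"
    using normal_distributed_variance[OF _ D] normal_distributed_expectation[OF _ D] h by auto
  have Wm: "W h \<in> borel_measurable \<Omega>" "(\<lambda>\<omega>. \<bar>W h \<omega>\<bar>) \<in> borel_measurable \<Omega>"
    using h by (auto intro!: wiener_measurable borel_measurable_abs)
  have int: "integrable \<Omega> (\<lambda>\<omega>. (W h \<omega>)\<^sup>2)"
    using integrable_normal_moment[of "sqrt h" 0 2] h distributed_integrable[OF D, of "\<lambda>x. x^2"] by simp
  have "prob {\<omega> \<in> space \<Omega>. d \<le> running_max W h \<omega>} = measure (distr \<Omega> borel (running_max W h)) {d..}"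
    using running_max_measurable[OF h] by (simp add: measure_distr vimage_def Int_def conj_commute)
  also have "\<dots> = prob {\<omega> \<in> space \<Omega>. d \<le> \<bar>W h \<omega>\<bar>}"
    unfolding running_max_distr[OF h] using Wm by (simp add: measure_distr vimage_def Int_def conj_commute)
  also have "\<dots> = prob {\<omega> \<in> space \<Omega>. d \<le> \<bar>W h \<omega> - expectation (W h)\<bar>}" by (simp add: exp)
  also have "\<dots> \<le> variance (W h) / d\<^sup>2"
    by (rule Chebyshev_inequality) (use Wm int d in auto)
  finally show ?thesis by (simp only: var)
qed

lemma prob_min_le_bound:
  assumes h: "0 < h" and d: "0 < d"
  shows "prob {\<omega> \<in> space \<Omega>. running_min W h \<omega> \<le> - d} \<le> h / d\<^sup>2"
proof -
  interpret N: wiener_process \<Omega> "\<lambda>t \<omega>. - W t \<omega>" by (rule wiener_process_uminus)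
  have "{\<omega> \<in> space \<Omega>. running_min W h \<omega> \<le> - d} = {\<omega> \<in> space \<Omega>. d \<le> running_max (\<lambda>t \<omega>. - W t \<omega>) h \<omega>}"
    by (auto simp: running_max_uminus)
  then show ?thesis using N.prob_max_ge_bound[OF h d] by simp
qed

text \<open>The target interval lies within distance \<open>(K + d) * h\<close> of \<open>0\<close>,
  where for \<open>h \<le> 1\<close> the exponent \<open>x\<^sup>2 / (2 * h)\<close> is at most
  \<open>(K + d)\<^sup>2 / 2\<close>. The density is thus at least a constant over
  \<open>sqrt h\<close>, on an interval of length \<open>2 * d * h\<close>.\<close>

lemma prob_value_near_bound:
  assumes h: "0 < h" "h \<le> 1" and d: "0 < d" and c: "\<bar>c\<bar> \<le> K"
  shows "2 * d * sqrt h * (exp (- (K + d)\<^sup>2 / 2) / sqrt (2 * pi)) \<le> prob {\<omega> \<in> space \<Omega>. \<bar>W h \<omega> - c * h\<bar> < d * h}"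
proof -
  define A where "A = {(c - d) * h <..< (c + d) * h}"
  define b where "b = exp (- (K + d)\<^sup>2 / 2) / sqrt (2 * pi * h)"
  have b0: "0 \<le> b" unfolding b_def using h by (intro divide_nonneg_nonneg) auto
  have low: "b \<le> normal_density 0 (sqrt h) x" if "x \<in> A" for x
  proof -
    have "\<bar>x - c * h\<bar> < d * h" using that by (auto simp: A_def algebra_simps abs_less_iff)
    moreover have "\<bar>c * h\<bar> \<le> K * h" using c h by (simp add: abs_mult)
    ultimately have "\<bar>x\<bar> \<le> (K + d) * h" by (simp add: algebra_simps)
    then have "\<bar>x\<bar>\<^sup>2 \<le> ((K + d) * h)\<^sup>2" by (intro power_mono) auto
    then have "x\<^sup>2 \<le> (K + d)\<^sup>2 * (h * h)" by (simp add: power_mult_distrib power2_eq_square[of h])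
    also have "\<dots> \<le> (K + d)\<^sup>2 * (1 * h)" using h by (intro mult_left_mono mult_right_mono) auto
    finally have "x\<^sup>2 / (2 * h) \<le> (K + d)\<^sup>2 * h / (2 * h)" using h by (intro divide_right_mono) auto
    then have "x\<^sup>2 / (2 * h) \<le> (K + d)\<^sup>2 / 2" using h by simp
    then have "exp (- (K + d)\<^sup>2 / 2) \<le> exp (- x\<^sup>2 / (2 * h))" by simp
    then have "exp (- (K + d)\<^sup>2 / 2) / sqrt (2 * pi * h) \<le> exp (- x\<^sup>2 / (2 * h)) / sqrt (2 * pi * h)"
      using h by (intro divide_right_mono) auto
    then show ?thesis using h by (simp add: b_def normal_density_def)
  qed
  have Aeq: "{\<omega> \<in> space \<Omega>. \<bar>W h \<omega> - c * h\<bar> < d * h} = {\<omega> \<in> space \<Omega>. W h \<omega> \<in> A}"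
    by (auto simp: A_def algebra_simps abs_less_iff)
  have len: "emeasure lborel A = ennreal (2 * d * h)"
    using h d by (simp add: A_def algebra_simps)
  have "ennreal (b * (2 * d * h)) = ennreal b * emeasure lborel A"
    using b0 d h by (simp add: len ennreal_mult)
  also have "\<dots> = (\<integral>\<^sup>+x. ennreal b * indicator A x \<partial>lborel)"
    by (simp add: nn_integral_cmult_indicator A_def)
  also have "\<dots> \<le> (\<integral>\<^sup>+x. ennreal (normal_density 0 (sqrt h) x) * indicator A x \<partial>lborel)"
    using low by (intro nn_integral_mono) (auto simp: indicator_def ennreal_leI)
  also have "\<dots> = emeasure (density lborel (\<lambda>x. ennreal (normal_density 0 (sqrt h) x))) A"
    by (subst emeasure_density) (auto simp: A_def)
  also have "\<dots> = emeasure (distr \<Omega> borel (W h)) A" by (simp add: value_distr[OF h(1)])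
  also have "\<dots> = ennreal (prob {\<omega> \<in> space \<Omega>. W h \<omega> \<in> A})"
    using wiener_measurable[of h] h
    by (simp add: emeasure_distr A_def vimage_def Int_def conj_commute emeasure_eq_measure)
  finally have "b * (2 * d * h) \<le> prob {\<omega> \<in> space \<Omega>. W h \<omega> \<in> A}" by simp
  moreover have "b * (2 * d * h) = 2 * d * sqrt h * (exp (- (K + d)\<^sup>2 / 2) / sqrt (2 * pi))"
  proof -
    have "h / sqrt h = sqrt h" using h by (simp add: real_div_sqrt)
    have "b * (2 * d * h) = 2 * d * (h / sqrt h) * (exp (- (K + d)\<^sup>2 / 2) / sqrt (2 * pi))"
      by (simp add: b_def real_sqrt_mult mult_ac)
    then show ?thesis by (simp only: \<open>h / sqrt h = sqrt h\<close>)
  qed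
  ultimately show ?thesis unfolding Aeq by simp
qed

text \<open>The hypothesis \<open>small\<close> is
  \<open>2 * (h / d\<^sup>2) < 2 * d * sqrt h * C\<close> solved for \<open>sqrt h\<close>: the two
  bounds for leaving the tube together stay below the bound for hitting the interval. This is where
  \<open>d ^ 3\<close> comes from.\<close>

lemma prob_small_step_pos:
  assumes h: "0 < h" "h \<le> 1" and d: "0 < d" and c: "\<bar>c\<bar> \<le> K"
    and small: "sqrt h < d ^ 3 * (exp (- (K + d)\<^sup>2 / 2) / sqrt (2 * pi))"
  shows "0 < prob {\<omega> \<in> space \<Omega>. \<bar>W h \<omega> - c * h\<bar> < d * h \<and> running_max W h \<omega> < d \<and> - d < running_min W h \<omega>}" (is "0 < prob ?G")
proof -
  define C where "C = exp (- (K + d)\<^sup>2 / 2) / sqrt (2 * pi)"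
  let ?A = "{\<omega> \<in> space \<Omega>. \<bar>W h \<omega> - c * h\<bar> < d * h}"
  let ?B = "{\<omega> \<in> space \<Omega>. d \<le> running_max W h \<omega>}" and ?B' = "{\<omega> \<in> space \<Omega>. running_min W h \<omega> \<le> - d}"
  have Wm: "W h \<in> borel_measurable \<Omega>" using h by (intro wiener_measurable) simp
  have A: "?A \<in> events"
    by (intro borel_measurable_less borel_measurable_abs borel_measurable_diff borel_measurable_const Wm)
  have B: "?B \<in> events" "?B' \<in> events"
    by (intro borel_measurable_le borel_measurable_const running_max_measurable[OF h(1)] running_min_measurable[OF h(1)])+
  have G: "?G \<in> events"
    by (intro sets.sets_Collect_conj borel_measurable_less borel_measurable_abs borel_measurable_diff borel_measurable_const Wm
        running_max_measurable[OF h(1)] running_min_measurable[OF h(1)])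
  have "?A \<subseteq> ?G \<union> (?B \<union> ?B')" by auto
  then have "prob ?A \<le> prob (?G \<union> (?B \<union> ?B'))" using A B G by (intro finite_measure_mono) auto
  also have "\<dots> \<le> prob ?G + prob (?B \<union> ?B')" using B G by (intro measure_Un_le) auto
  also have "prob (?B \<union> ?B') \<le> prob ?B + prob ?B'" using B by (intro measure_Un_le) auto
  finally have le: "prob ?A \<le> prob ?G + (prob ?B + prob ?B')" by simp
  have "prob ?B + prob ?B' \<le> 2 * (h / d\<^sup>2)"
    using prob_max_ge_bound[OF h(1) d] prob_min_le_bound[OF h(1) d] by simp
  moreover have "2 * d * sqrt h * C \<le> prob ?A" unfolding C_def by (rule prob_value_near_bound[OF h d c])
  moreover have "2 * (h / d\<^sup>2) < 2 * d * sqrt h * C"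
  proof -
    have "sqrt h * sqrt h < sqrt h * (d ^ 3 * C)"
      using small h by (intro mult_strict_left_mono) (auto simp: C_def)
    then have "h / d\<^sup>2 < sqrt h * (d ^ 3 * C) / d\<^sup>2" using h d by (intro divide_strict_right_mono) auto
    also have "\<dots> = d * sqrt h * C" using d by (simp add: power2_eq_square power3_eq_cube)
    finally show ?thesis by simp
  qed
  ultimately show ?thesis using le by linarith
qed

text \<open>The \<open>n\<close> blocks of length \<open>1 / n\<close> are independent, so the
  probability is a product of positive factors. The conclusion is about an event inside the
  described set, because that set restricts the path at uncountably many times and its own
  measurability is not established.\<close>

lemma prob_polygonal_path_pos:
  assumes d: "0 < d" and c: "\<And>i. \<bar>c i\<bar> \<le> K" and n: "0 < n"
    and small: "sqrt (1 / real n) < d ^ 3 * (exp (- (K + d)\<^sup>2 / 2) / sqrt (2 * pi))"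
  shows "\<exists>E. E \<in> events \<and> 0 < prob E \<and> E \<subseteq> {\<omega> \<in> space \<Omega>. \<forall>i<n. \<bar>W (real (Suc i) / real n) \<omega> - W (real i / real n) \<omega> - c i / real n\<bar> < d / real n \<and>
     (\<forall>u\<in>{real i / real n..real (Suc i) / real n}. \<bar>W u \<omega> - W (real i / real n) \<omega>\<bar> < d)}" (is "\<exists>E. _ \<and> _ \<and> E \<subseteq> ?E")
proof -
  define s where "s i = real i / real n" for i
  have mono: "strict_mono s" using n by (auto simp: s_def strict_mono_def divide_strict_right_mono)
  have s: "0 \<le> s i" "s (Suc i) - s i = 1 / real n" for i using n by (simp_all add: s_def flip: diff_divide_distrib)
  \<comment> \<open>The block triple carries all that is required: its end value controls the
    increment, its extrema bound the oscillation within the block.\<close>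
  define Q where "Q i = {p :: real \<times> real \<times> real. \<bar>fst p - c i / real n\<bar> < d / real n \<and> fst (snd p) < d \<and> - d < snd (snd p)}" for i
  have "Q i = {p. \<bar>fst p - c i / real n\<bar> < d / real n} \<inter> {p. fst (snd p) < d} \<inter> {p. - d < snd (snd p)}" for i
    by (auto simp: Q_def)
  moreover have "open ({p :: real \<times> real \<times> real. \<bar>fst p - c i / real n\<bar> < d / real n} \<inter> {p. fst (snd p) < d} \<inter> {p. - d < snd (snd p)})" for i
    by (intro open_Int open_Collect_less continuous_intros)
  ultimately have "open (Q i)" for i by simp
  then have Q: "Q i \<in> sets borel" for i by (intro borel_open)
  define T where "T i = path_triple (shifted W (s i)) (1 / real n)" for i
  define B where "B i = T i -` Q i \<inter> space \<Omega>" for i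
  have ind: "indep_vars (\<lambda>_. borel) T {..<n}"
    using block_triples_indep[OF mono s(1) n] unfolding s(2) T_def .
  have pos: "0 < prob (B i)" for i
  proof -
    interpret S: wiener_process \<Omega> "shifted W (s i)" by (rule wiener_process_shifted[OF s(1)])
    have "B i = {\<omega> \<in> space \<Omega>. \<bar>shifted W (s i) (1 / real n) \<omega> - c i * (1 / real n)\<bar> < d * (1 / real n) \<and>
       running_max (shifted W (s i)) (1 / real n) \<omega> < d \<and> - d < running_min (shifted W (s i)) (1 / real n) \<omega>}"
      by (auto simp: B_def T_def Q_def path_triple_def)
    moreover have "1 / real n \<le> 1" "0 < 1 / real n" using n by simp_all
    ultimately show ?thesis using S.prob_small_step_pos[OF _ _ d c small] by simp
  qed
  have "prob (\<Inter>i\<in>{..<n}. T i -` Q i \<inter> space \<Omega>) = (\<Prod>i\<in>{..<n}. prob (T i -` Q i \<inter> space \<Omega>))"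
    by (rule indep_varsD_finite[OF ind]) (use n Q in auto)
  also have "0 < \<dots>" using pos by (intro prod_pos) (simp add: B_def)
  finally have P: "0 < prob (\<Inter>i\<in>{..<n}. T i -` Q i \<inter> space \<Omega>)" .
  show ?thesis
  proof (rule exI[of _ "\<Inter>i\<in>{..<n}. T i -` Q i \<inter> space \<Omega>"], intro conjI P)
    show "(\<Inter>i\<in>{..<n}. T i -` Q i \<inter> space \<Omega>) \<in> events"
    proof (intro sets.finite_INT)
      show "T i -` Q i \<inter> space \<Omega> \<in> events" if "i \<in> {..<n}" for i
      proof -
        have "T i \<in> borel_measurable \<Omega>" using ind that by (auto simp: indep_vars_def)
        then show ?thesis using Q by (rule measurable_sets)
      qed
    qed (use n in auto)
    show "(\<Inter>i\<in>{..<n}. T i -` Q i \<inter> space \<Omega>) \<subseteq> ?E"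
    proof (rule subsetI, rule CollectI, intro conjI allI impI ballI)
      fix \<omega> assume \<omega>: "\<omega> \<in> (\<Inter>i\<in>{..<n}. T i -` Q i \<inter> space \<Omega>)"
      moreover have "0 \<in> {..<n}" using n by simp
      ultimately show sp: "\<omega> \<in> space \<Omega>" by blast
      fix i assume i: "i < n"
      then have "i \<in> {..<n}" by simp
      then have q: "T i \<omega> \<in> Q i" using \<omega> by blast
      have e: "s i + 1 / real n = s (Suc i)" using s(2)[of i] by simp
      show "\<bar>W (real (Suc i) / real n) \<omega> - W (real i / real n) \<omega> - c i / real n\<bar> < d / real n"
        using q by (simp add: Q_def T_def path_triple_def shifted_def e) (simp add: s_def)
      fix u assume u: "u \<in> {real i / real n..real (Suc i) / real n}"
      have len: "s (Suc i) - s i = 1 / real n" by (rule s(2))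
      have "s i < s (Suc i)" using strict_monoD[OF mono, of i "Suc i"] by simp
      moreover have "u \<in> {s i..s (Suc i)}" using u by (simp add: s_def)
      ultimately have "running_min (shifted W (s i)) (1 / real n) \<omega> \<le> W u \<omega> - W (s i) \<omega>"
         "W u \<omega> - W (s i) \<omega> \<le> running_max (shifted W (s i)) (1 / real n) \<omega>"
        using path_triple_shifted_bounds[OF s(1), of i "s (Suc i)" \<omega> u] sp unfolding len by auto
      then show "\<bar>W u \<omega> - W (real i / real n) \<omega>\<bar> < d"
        using q by (simp add: Q_def T_def path_triple_def s_def abs_less_iff)
    qed
  qed
qed

text \<open>The targeted polygonal path has its corners at times \<open>1/3\<close> and
  \<open>2/3\<close>. A path following it closely has its maximum near the first corner, its minimum
  near the second one, and its end near \<open>x\<close>, because \<open>z\<close> and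
  \<open>y\<close> are the extreme values of the polygonal path.\<close>

lemma path_triple_full_support:
  assumes xyz: "z < x" "x < y" "z < 0" "0 < y" and e: "0 < e"
  shows "0 < prob {\<omega> \<in> space \<Omega>. \<bar>W 1 \<omega> - x\<bar> < e \<and> \<bar>running_max W 1 \<omega> - y\<bar> < e \<and> \<bar>running_min W 1 \<omega> - z\<bar> < e}"
    (is "0 < prob ?F")
proof -
  \<comment> \<open>The grid values will be within \<open>d\<close> of the polygonal path, and the
    oscillation between grid points adds less than \<open>d\<close>; so \<open>e / 3\<close> leaves
    room.\<close>
  define d where "d = e / 3"
  have d: "0 < d" using e by (simp add: d_def)
  \<comment> \<open>A bound for the three slopes \<open>3 * y\<close>, \<open>3 * (z - y)\<close>
    and \<open>3 * (x - z)\<close>; each leg lasts one third of the time.\<close>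
  define K where "K = 3 * (\<bar>y\<bar> + \<bar>z - y\<bar> + \<bar>x - z\<bar>)"
  define L where "L = d ^ 3 * (exp (- (K + d)\<^sup>2 / 2) / sqrt (2 * pi))"
  have "0 < L" using d by (simp add: L_def)
  have "\<forall>\<^sub>F m in sequentially. sqrt (1 / real (3 * m)) < L" using \<open>0 < L\<close> by real_asymp
  then have "\<forall>\<^sub>F m in sequentially. sqrt (1 / real (3 * m)) < L \<and> 0 < m"
    by (rule eventually_conj) (rule eventually_gt_at_top)
  then obtain m :: nat where m: "sqrt (1 / real (3 * m)) < L" "0 < m"
    by (auto dest!: eventually_happens)
  \<comment> \<open>A multiple of three, so that the corners of the polygonal path fall on grid
    points.\<close>
  define n where "n = 3 * m"
  have n: "0 < n" using m by (simp add: n_def)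
  \<comment> \<open>\<open>c\<close> is the slope on each small step, and \<open>g\<close>, defined
    next, the value of the polygonal path at each grid point.\<close>
  define c where "c i = (if i < m then 3 * y else if i < 2 * m then 3 * (z - y) else 3 * (x - z))" for i
  define g where "g k = (if k \<le> m then y * (real k / real m) else if k \<le> 2 * m then y + (z - y) * (real (k - m) / real m)
     else z + (x - z) * (real (k - 2 * m) / real m))" for k
  have c: "\<bar>c i\<bar> \<le> K" for i unfolding c_def K_def by (smt (verit))
  have mn: "3 * a / real n = a / real m" for a by (simp add: n_def)
  have step: "g (Suc k) - g k = c k / real n" for k
  proof -
    consider "k < m" | "m \<le> k" "k < 2 * m" | "2 * m \<le> k" by linarith
    then show ?thesis
    proof cases
      case 1
      then show ?thesis by (simp add: g_def c_def mn add_divide_distrib distrib_left)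
    next
      case 2
      then have k: "real (Suc k - m) / real m = real (k - m) / real m + 1 / real m"
        by (simp add: Suc_diff_le add_divide_distrib)
      have "g k = y + (z - y) * (real (k - m) / real m)" using 2 m(2) by (auto simp: g_def)
      moreover have "g (Suc k) = y + (z - y) * (real (Suc k - m) / real m)" using 2 by (simp add: g_def)
      moreover have "c k = 3 * (z - y)" using 2 by (simp add: c_def)
      then have "c k / real n = (z - y) / real m" by (simp only: mn)
      ultimately show ?thesis unfolding k by (simp add: distrib_left)
    next
      case 3
      then have k: "real (Suc k - 2 * m) / real m = real (k - 2 * m) / real m + 1 / real m"
        by (simp add: Suc_diff_le add_divide_distrib)
      have "g k = z + (x - z) * (real (k - 2 * m) / real m)" using 3 m(2) by (auto simp: g_def)
      moreover have "g (Suc k) = z + (x - z) * (real (Suc k - 2 * m) / real m)" using 3 m(2) by (auto simp: g_def)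
      moreover have "c k = 3 * (x - z)" using 3 m(2) by (simp add: c_def)
      then have "c k / real n = (x - z) / real m" by (simp only: mn)
      ultimately show ?thesis unfolding k by (simp add: distrib_left)
    qed
  qed
  have range: "z \<le> g k \<and> g k \<le> y" if "k \<le> n" for k
  proof -
    have conv: "min a b \<le> a + (b - a) * r \<and> a + (b - a) * r \<le> max a b" if "0 \<le> r" "r \<le> 1" for a b r :: real
    proof (cases "a \<le> b")
      case True
      then have "0 \<le> (b - a) * r" "(b - a) * r \<le> (b - a) * 1" using that mult_left_mono[OF that(2), of "b - a"] by auto
      then show ?thesis using True by (auto simp: min_def max_def)
    next
      case False
      then have "0 \<le> (a - b) * r" "(a - b) * r \<le> (a - b) * 1" using that mult_left_mono[OF that(2), of "a - b"] by auto
      then show ?thesis using False by (auto simp: min_def max_def algebra_simps)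
    qed
    consider "k \<le> m" | "m < k" "k \<le> 2 * m" | "2 * m < k" by linarith
    then show ?thesis
    proof cases
      case 1
      then have "0 \<le> real k / real m" "real k / real m \<le> 1" using m(2) by simp_all
      then have "0 \<le> y * (real k / real m)" "y * (real k / real m) \<le> y * 1"
        using xyz by (intro mult_nonneg_nonneg mult_left_mono; simp)+
      then have "z \<le> y * (real k / real m) \<and> y * (real k / real m) \<le> y" using xyz by linarith
      then show ?thesis using 1 by (simp only: g_def if_True)
    next
      case 2
      then show ?thesis using conv[of "real (k - m) / real m" y z] m(2) xyz by (simp add: g_def)
    next
      case 3
      then show ?thesis using conv[of "real (k - 2 * m) / real m" z x] m(2) xyz that by (simp add: g_def n_def)
    qed
  qed
  have g: "g 0 = 0" "g m = y" "g (2 * m) = z" "g n = x" using m(2) by (auto simp: g_def n_def)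
  let ?E = "{\<omega> \<in> space \<Omega>. \<forall>i<n. \<bar>W (real (Suc i) / real n) \<omega> - W (real i / real n) \<omega> - c i / real n\<bar> < d / real n \<and>
     (\<forall>u\<in>{real i / real n..real (Suc i) / real n}. \<bar>W u \<omega> - W (real i / real n) \<omega>\<bar> < d)}"
  have sub: "?E \<subseteq> ?F"
  proof
    fix \<omega> assume "\<omega> \<in> ?E"
    then have \<omega>: "\<omega> \<in> space \<Omega>"
      and inc: "\<And>i. i < n \<Longrightarrow> \<bar>W (real (Suc i) / real n) \<omega> - W (real i / real n) \<omega> - c i / real n\<bar> < d / real n"
      and osc: "\<And>i u. i < n \<Longrightarrow> u \<in> {real i / real n..real (Suc i) / real n} \<Longrightarrow> \<bar>W u \<omega> - W (real i / real n) \<omega>\<bar> < d"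
      by auto
    \<comment> \<open>Each step misses its prescribed increment by less than \<open>d / n\<close>,
      so after at most \<open>n\<close> steps the accumulated error is at most \<open>d\<close>.
      This explains a target interval proportional to the step length.\<close>
    have close: "\<bar>W (real k / real n) \<omega> - g k\<bar> \<le> real k * (d / real n)" if "k \<le> n" for k
      using that
    proof (induction k)
      case 0
      then show ?case using wiener_start[OF \<omega>] g by simp
    next
      case (Suc k)
      have "W (real (Suc k) / real n) \<omega> - g (Suc k) =
         (W (real (Suc k) / real n) \<omega> - W (real k / real n) \<omega> - c k / real n) + (W (real k / real n) \<omega> - g k)"
        using step[of k] by simp
      also have "\<bar>\<dots>\<bar> \<le> d / real n + real k * (d / real n)"
        using inc[of k] Suc by (intro order_trans[OF abs_triangle_ineq] add_mono) auto
      also have "\<dots> = real (Suc k) * (d / real n)" by (simp add: distrib_right add_divide_distrib)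
      finally show ?case .
    qed
    have grid: "\<bar>W (real k / real n) \<omega> - g k\<bar> \<le> d" if "k \<le> n" for k
    proof -
      have "real k * (d / real n) \<le> real n * (d / real n)" using that d by (intro mult_right_mono) auto
      then show ?thesis using close[OF that] n by simp
    qed
    have all: "z - 2 * d < W u \<omega> \<and> W u \<omega> < y + 2 * d" if "u \<in> {0..1}" for u
    proof -
      \<comment> \<open>The index of the step containing \<open>u\<close>. At \<open>u = 1\<close>
        the floor would give \<open>n\<close>, one past the last step.\<close>
      define i where "i = (if u = 1 then n - 1 else nat \<lfloor>u * real n\<rfloor>)"
      have "i < n \<and> real i \<le> u * real n \<and> u * real n \<le> real (Suc i)"
      proof (cases "u = 1")
        case True
        then show ?thesis using n by (simp add: i_def of_nat_diff)
      next
        case False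
        then have "u * real n < 1 * real n" using that n by (intro mult_strict_right_mono) auto
        moreover have "0 \<le> u * real n" using that by simp
        ultimately show ?thesis using False unfolding i_def by (simp, linarith)
      qed
      then have i: "i < n" "u \<in> {real i / real n..real (Suc i) / real n}"
        using n by (auto simp: divide_le_eq le_divide_eq)
      from osc[OF i] grid[of i] range[of i] i(1) show ?thesis by linarith
    qed
    obtain u v where uv: "u \<in> {0..1}" "v \<in> {0..1}" "running_max W 1 \<omega> = W u \<omega>" "running_min W 1 \<omega> = W v \<omega>"
      "\<And>s. s \<in> {0..1} \<Longrightarrow> W v \<omega> \<le> W s \<omega> \<and> W s \<omega> \<le> W u \<omega>"
      using extrema_attained[of 1 \<omega>] \<omega> by (metis zero_le_one)
    have "real m / real n \<in> {0..1}" "real (2 * m) / real n \<in> {0..1}" using n by (auto simp: n_def)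
    then have "W (real m / real n) \<omega> \<le> W u \<omega>" "W v \<omega> \<le> W (real (2 * m) / real n) \<omega>" using uv(5) by blast+
    moreover have "\<bar>W (real m / real n) \<omega> - y\<bar> \<le> d" "\<bar>W (real (2 * m) / real n) \<omega> - z\<bar> \<le> d" "\<bar>W 1 \<omega> - x\<bar> \<le> d"
      using grid[of m] grid[of "2 * m"] grid[of n] g n by (simp_all add: n_def)
    moreover note all[OF uv(1)] all[OF uv(2)]
    ultimately have "\<bar>W 1 \<omega> - x\<bar> < 3 * d" "\<bar>W u \<omega> - y\<bar> < 3 * d" "\<bar>W v \<omega> - z\<bar> < 3 * d" using d by linarith+
    then show "\<omega> \<in> ?F" using \<omega> by (simp add: uv(3,4) d_def)
  qed
  have small: "sqrt (1 / real n) < d ^ 3 * (exp (- (K + d)\<^sup>2 / 2) / sqrt (2 * pi))"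
    using m(1) unfolding n_def L_def .
  obtain E' where E': "E' \<in> events" "0 < prob E'" "E' \<subseteq> ?E"
    using prob_polygonal_path_pos[where c=c, OF d c n small] by blast
  have "W 1 \<in> borel_measurable \<Omega>" by (rule wiener_measurable) simp
  note meas = this running_max_measurable[of 1] running_min_measurable[of 1]
  have "?F \<in> events"
    by (intro sets.sets_Collect_conj borel_measurable_less borel_measurable_abs borel_measurable_diff borel_measurable_const meas) auto
  then have "prob E' \<le> prob ?F" using E' sub by (intro finite_measure_mono) auto
  then show ?thesis using E'(2) by linarith
qed

end

section \<open>Copulas of continuous margins\<close>

lemma box_sets_borel: "{..a} \<times> {..b} \<times> {..c} \<in> sets (borel :: (real \<times> real \<times> real) measure)"
  by (intro borel_closed closed_Times closed_atMost)

text \<open>Each coordinate half-space is a countable union of boxes with the other two bounds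
  tending to infinity. All coordinates, and with them the identity, are therefore measurable for the
  sigma algebra generated by the boxes.\<close>

lemma borel_eq_sigma_boxes:
  "sets (borel :: (real \<times> real \<times> real) measure) = sigma_sets UNIV {{..a} \<times> {..b} \<times> {..c} | a b c. True}"
proof
  let ?E = "{{..a :: real} \<times> {..b :: real} \<times> {..c :: real} | a b c. True}"
  have "sigma_sets (space borel) ?E \<subseteq> sets borel"
    by (rule sets.sigma_sets_subset) (use box_sets_borel in blast)
  then show "sigma_sets UNIV ?E \<subseteq> sets borel" by (simp only: space_borel)
  define S where "S = sigma UNIV ?E"
  have S: "sets S = sigma_sets UNIV ?E" "space S = UNIV" by (simp_all add: S_def)
  have box: "{..a} \<times> {..b} \<times> {..c} \<in> sets S" for a b c unfolding S by (rule sigma_sets.Basic) blast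
  have arch: "\<exists>n. y \<le> real n" for y by (rule real_arch_simple)
  have m1: "fst \<in> borel_measurable S"
  proof (rule borel_measurable_iff_le[THEN iffD2], rule allI)
    fix a
    have "{p \<in> space S. fst p \<le> a} = (\<Union>n::nat. {..a} \<times> {..real n} \<times> {..real n})"
    proof (intro set_eqI iffI)
      fix p assume p: "p \<in> {p \<in> space S. fst p \<le> a}"
      obtain n where "max (fst (snd p)) (snd (snd p)) \<le> real n" using arch by blast
      then show "p \<in> (\<Union>n::nat. {..a} \<times> {..real n} \<times> {..real n})" using p by (cases p) auto
    qed (auto simp: S)
    then show "{p \<in> space S. fst p \<le> a} \<in> sets S" by (simp only: sets.countable_nat_UN[OF image_subsetI[OF box]])
  qed
  have m2: "(\<lambda>p. fst (snd p)) \<in> borel_measurable S"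
  proof (rule borel_measurable_iff_le[THEN iffD2], rule allI)
    fix a
    have "{p \<in> space S. fst (snd p) \<le> a} = (\<Union>n::nat. {..real n} \<times> {..a} \<times> {..real n})"
    proof (intro set_eqI iffI)
      fix p assume p: "p \<in> {p \<in> space S. fst (snd p) \<le> a}"
      obtain n where "max (fst p) (snd (snd p)) \<le> real n" using arch by blast
      then show "p \<in> (\<Union>n::nat. {..real n} \<times> {..a} \<times> {..real n})" using p by (cases p) auto
    qed (auto simp: S)
    then show "{p \<in> space S. fst (snd p) \<le> a} \<in> sets S" by (simp only: sets.countable_nat_UN[OF image_subsetI[OF box]])
  qed
  have m3: "(\<lambda>p. snd (snd p)) \<in> borel_measurable S"
  proof (rule borel_measurable_iff_le[THEN iffD2], rule allI)
    fix a
    have "{p \<in> space S. snd (snd p) \<le> a} = (\<Union>n::nat. {..real n} \<times> {..real n} \<times> {..a})"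
    proof (intro set_eqI iffI)
      fix p assume p: "p \<in> {p \<in> space S. snd (snd p) \<le> a}"
      obtain n where "max (fst p) (fst (snd p)) \<le> real n" using arch by blast
      then show "p \<in> (\<Union>n::nat. {..real n} \<times> {..real n} \<times> {..a})" using p by (cases p) auto
    qed (auto simp: S)
    then show "{p \<in> space S. snd (snd p) \<le> a} \<in> sets S" by (simp only: sets.countable_nat_UN[OF image_subsetI[OF box]])
  qed
  have "(\<lambda>p. (fst p, fst (snd p), snd (snd p))) \<in> borel_measurable S"
    by (intro borel_measurable_Pair m1 m2 m3)
  then have id: "(\<lambda>p. p) \<in> borel_measurable S" by simp
  show "sets (borel :: (real \<times> real \<times> real) measure) \<subseteq> sigma_sets UNIV ?E"
  proof
    fix B :: "(real \<times> real \<times> real) set" assume "B \<in> sets borel"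
    from measurable_sets[OF id this] show "B \<in> sigma_sets UNIV ?E" by (simp add: S)
  qed
qed

lemma measure_eqI_cdf3:
  assumes "prob_space D" "prob_space D'" and sets: "sets D = sets borel" "sets D' = sets borel"
    and eq: "\<And>a b c. cdf3 D a b c = cdf3 D' a b c"
  shows "D = D'"
proof -
  interpret D: prob_space D by fact
  interpret D': prob_space D' by fact
  have eqE: "emeasure D X = emeasure D' X" if "X \<in> {{..a} \<times> {..b} \<times> {..c} | a b c. True}" for X
    using that eq by (auto simp: cdf3_def D.emeasure_eq_measure D'.emeasure_eq_measure)
  define A where "A n = {..real n} \<times> {..real n} \<times> {..real n}" for n :: nat
  show ?thesis
  proof (rule measure_eqI_generator_eq[where E="{{..a} \<times> {..b} \<times> {..c} | a b c. True}" and \<Omega>=UNIV and A=A])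
    show "Int_stable {{..a :: real} \<times> {..b :: real} \<times> {..c :: real} | a b c. True}"
    proof (rule Int_stableI, safe)
      fix a b c a' b' c' :: real
      show "\<exists>a'' b'' c''. ({..a} \<times> {..b} \<times> {..c}) \<inter> ({..a'} \<times> {..b'} \<times> {..c'}) = {..a''} \<times> {..b''} \<times> {..c''} \<and> True"
        by (rule exI[of _ "min a a'"], rule exI[of _ "min b b'"], rule exI[of _ "min c c'"]) auto
    qed
    show "(\<Union>i. A i) = UNIV"
    proof (intro set_eqI iffI UNIV_I)
      fix p :: "real \<times> real \<times> real"
      obtain n where "max (fst p) (max (fst (snd p)) (snd (snd p))) \<le> real n" using real_arch_simple by blast
      then show "p \<in> (\<Union>i. A i)" by (cases p) (auto simp: A_def)
    qed
    show "range A \<subseteq> {{..a} \<times> {..b} \<times> {..c} | a b c. True}" by (auto simp: A_def)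
    show "emeasure D (A i) \<noteq> \<infinity>" for i by simp
  qed (use eqE sets borel_eq_sigma_boxes in auto)
qed

section \<open>The probability integral transform\<close>

context prob_space
begin

lemma cdf_distr: "X \<in> borel_measurable M \<Longrightarrow> cdf (distr M borel X) x = prob {\<omega> \<in> space M. X \<omega> \<le> x}"
  by (simp add: cdf_def measure_distr vimage_def Int_def conj_commute)

text \<open>The distribution function may be flat, so an arbitrary preimage of \<open>u\<close>
  would not do; the supremum of the set where the function is at most \<open>u\<close> satisfies the
  equivalence. Continuity makes this set closed, and the limit from the right gives the value
  \<open>u\<close> there.\<close>

lemma cdf_attains:
  assumes X: "X \<in> borel_measurable M" and cont: "\<And>x. isCont (cdf (distr M borel X)) x" and u: "0 < u" "u < 1"
  shows "\<exists>x. cdf (distr M borel X) x = u \<and> (\<forall>y. cdf (distr M borel X) y \<le> u \<longleftrightarrow> y \<le> x)"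
proof -
  interpret D: real_distribution "distr M borel X" using X by simp
  let ?F = "cdf (distr M borel X)"
  define S where "S = {y. ?F y \<le> u}"
  have "\<forall>\<^sub>F x in at_bot. ?F x < u" by (rule order_tendstoD(2)[OF D.cdf_lim_at_bot u(1)])
  then obtain a where "?F a < u" by (auto simp: eventually_at_bot_linorder)
  then have ne: "S \<noteq> {}" by (auto simp: S_def intro: less_imp_le)
  have "\<forall>\<^sub>F x in at_top. u < ?F x" by (rule order_tendstoD(1)[OF D.cdf_lim_at_top_prob u(2)])
  then obtain b where b: "u < ?F b" by (auto simp: eventually_at_top_linorder)
  have ub: "y \<le> b" if "y \<in> S" for y
    using that b D.cdf_nondecreasing[of b y] by (auto simp: S_def not_le intro: leI)
  then have bdd: "bdd_above S" by (rule bdd_aboveI)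
  have "continuous_on UNIV ?F" using cont by (simp add: continuous_on_eq_continuous_at)
  then have "closed S" unfolding S_def by (intro closed_Collect_le continuous_on_const)
  then have inS: "Sup S \<in> S" using ne bdd closed_contains_Sup by blast
  have iff: "?F y \<le> u \<longleftrightarrow> y \<le> Sup S" for y
  proof
    assume "?F y \<le> u" then show "y \<le> Sup S" using bdd by (intro cSup_upper) (auto simp: S_def)
  next
    assume "y \<le> Sup S"
    then have "?F y \<le> ?F (Sup S)" by (rule D.cdf_nondecreasing)
    then show "?F y \<le> u" using inS by (simp add: S_def)
  qed
  have "u \<le> ?F (Sup S)"
  proof (rule tendsto_lowerbound)
    show "((\<lambda>y. ?F y) \<longlongrightarrow> ?F (Sup S)) (at_right (Sup S))"
      using D.cdf_is_right_cont by (simp add: continuous_within)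
    show "\<forall>\<^sub>F y in at_right (Sup S). u \<le> ?F y"
      using iff by (auto simp: eventually_at_filter not_le intro!: always_eventually) (metis le_less_linear less_le_not_le)
  qed simp
  moreover have "?F (Sup S) \<le> u" using inS by (simp add: S_def)
  ultimately have "?F (Sup S) = u" by (rule antisym[rotated])
  with iff show ?thesis by (intro exI[of _ "Sup S"] conjI allI)
qed

lemma prob_cdf_transform_le:
  assumes X: "X \<in> borel_measurable M" and cont: "\<And>x. isCont (cdf (distr M borel X)) x" and u: "0 \<le> u" "u \<le> 1"
  shows "prob {\<omega> \<in> space M. cdf (distr M borel X) (X \<omega>) \<le> u} = u"
proof -
  interpret D: real_distribution "distr M borel X" using X by simp
  let ?F = "cdf (distr M borel X)"
  have "?F \<in> borel_measurable borel" by (rule borel_measurable_continuous_onI) (simp add: continuous_on_eq_continuous_at cont)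
  then have FX: "(\<lambda>\<omega>. ?F (X \<omega>)) \<in> borel_measurable M" using X by measurable
  have ev: "{\<omega> \<in> space M. ?F (X \<omega>) \<le> v} \<in> events" for v by (intro borel_measurable_le FX borel_measurable_const)
  have mid: "prob {\<omega> \<in> space M. ?F (X \<omega>) \<le> v} = v" if v: "0 < v" "v < 1" for v
  proof -
    obtain x where x: "?F x = v" "\<forall>y. ?F y \<le> v \<longleftrightarrow> y \<le> x"
      using cdf_attains[OF X cont v] by (elim exE conjE)
    have "prob {\<omega> \<in> space M. ?F (X \<omega>) \<le> v} = prob {\<omega> \<in> space M. X \<omega> \<le> x}" by (simp only: x(2)[rule_format])
    also have "\<dots> = ?F x" by (rule cdf_distr[OF X, symmetric])
    finally show ?thesis by (simp only: x(1))
  qed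
  consider "u = 0" | "0 < u" "u < 1" | "u = 1" using u by linarith
  then show ?thesis
  proof cases
    \<comment> \<open>The value \<open>0\<close> is compared with positive ones; the minimum with
      \<open>1/2\<close> keeps the comparison value strictly between \<open>0\<close> and
      \<open>1\<close>.\<close>
    case 1
    have "prob {\<omega> \<in> space M. ?F (X \<omega>) \<le> 0} \<le> e" if "0 < e" for e
    proof -
      have "prob {\<omega> \<in> space M. ?F (X \<omega>) \<le> 0} \<le> prob {\<omega> \<in> space M. ?F (X \<omega>) \<le> min e (1/2)}"
        using that by (intro finite_measure_mono ev) auto
      also have "\<dots> = min e (1/2)" using that by (intro mid) auto
      finally show ?thesis by simp
    qed
    then have "prob {\<omega> \<in> space M. ?F (X \<omega>) \<le> 0} \<le> 0" by (rule field_le_epsilon) simp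
    then show ?thesis unfolding 1 by (intro antisym measure_nonneg)
  next
    case 2 then show ?thesis by (rule mid)
  next
    case 3
    have "{\<omega> \<in> space M. ?F (X \<omega>) \<le> 1} = space M" using D.cdf_bounded_prob by auto
    then show ?thesis using 3 by (simp add: prob_space)
  qed
qed

text \<open>Without strict monotonicity the equivalence can fail at individual points. One event is
  contained in the other by monotonicity, and both have probability
  \<open>cdf (distr M borel X) x\<close>, so they differ by a null set.\<close>

lemma AE_cdf_transform_le_iff:
  assumes X: "X \<in> borel_measurable M" and cont: "\<And>x. isCont (cdf (distr M borel X)) x"
  shows "AE \<omega> in M. cdf (distr M borel X) (X \<omega>) \<le> cdf (distr M borel X) x \<longleftrightarrow> X \<omega> \<le> x"
proof -
  interpret D: real_distribution "distr M borel X" using X by simp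
  let ?F = "cdf (distr M borel X)"
  have "?F \<in> borel_measurable borel" by (rule borel_measurable_continuous_onI) (simp add: continuous_on_eq_continuous_at cont)
  then have FX: "(\<lambda>\<omega>. ?F (X \<omega>)) \<in> borel_measurable M" using X by measurable
  let ?A = "{\<omega> \<in> space M. ?F (X \<omega>) \<le> ?F x}" and ?B = "{\<omega> \<in> space M. X \<omega> \<le> x}"
  have ev: "?A \<in> events" "?B \<in> events" by (intro borel_measurable_le FX X borel_measurable_const)+
  have sub: "?B \<subseteq> ?A" by (intro Collect_mono) (blast intro: D.cdf_nondecreasing)
  have "prob ?A = ?F x" by (rule prob_cdf_transform_le[OF X cont D.cdf_nonneg D.cdf_bounded_prob])
  moreover have "prob ?B = ?F x" by (rule cdf_distr[OF X, symmetric])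
  ultimately have "prob (?A - ?B) = 0" using finite_measure_Diff[OF ev sub] by linarith
  then have "?A - ?B \<in> null_sets M" using ev by (auto simp: null_sets_def emeasure_eq_measure)
  then have "AE \<omega> in M. \<omega> \<notin> ?A - ?B" by (rule AE_not_in)
  then show ?thesis
    using AE_space
  proof eventually_elim
    case (elim \<omega>)
    then show ?case using D.cdf_nondecreasing[of "X \<omega>" x] by blast
  qed
qed

lemma uniform_cdf_transform:
  assumes X: "X \<in> borel_measurable M" and cont: "\<And>x. isCont (cdf (distr M borel X)) x"
  shows "distr M borel (\<lambda>\<omega>. cdf (distr M borel X) (X \<omega>)) = uniform_measure lborel {0..1}"
proof -
  interpret D: real_distribution "distr M borel X" using X by simp
  let ?F = "cdf (distr M borel X)"
  have "?F \<in> borel_measurable borel" by (rule borel_measurable_continuous_onI) (simp add: continuous_on_eq_continuous_at cont)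
  then have FX: "(\<lambda>\<omega>. ?F (X \<omega>)) \<in> borel_measurable M" using X by measurable
  have U: "real_distribution (uniform_measure lborel {0..1::real})"
    by (auto simp: real_distribution_def real_distribution_axioms_def intro!: prob_space_uniform_measure)
  show ?thesis
  proof (rule cdf_unique[OF _ U])
    show "cdf (distr M borel (\<lambda>\<omega>. ?F (X \<omega>))) = cdf (uniform_measure lborel {0..1})"
    proof
      fix u
      have r: "cdf (uniform_measure lborel {0..1}) u = measure lborel ({0..1} \<inter> {..u})"
        by (simp add: cdf_def)
      consider "u < 0" | "0 \<le> u" "u \<le> 1" | "1 < u" by linarith
      then show "cdf (distr M borel (\<lambda>\<omega>. ?F (X \<omega>))) u = cdf (uniform_measure lborel {0..1}) u"
      proof cases
        case 1
        then have "{\<omega> \<in> space M. ?F (X \<omega>) \<le> u} = {}" "{0..1} \<inter> {..u} = {}"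
          using less_le_trans[OF 1 D.cdf_nonneg] by (auto simp: not_le)
        then show ?thesis unfolding r cdf_distr[OF FX] by (simp only: measure_empty)
      next
        case 2
        then have "{0..1} \<inter> {..u} = {0..u}" by auto
        then show ?thesis unfolding r cdf_distr[OF FX] using prob_cdf_transform_le[OF X cont 2] 2 by simp
      next
        case 3
        then have "{\<omega> \<in> space M. ?F (X \<omega>) \<le> u} = space M" "{0..1} \<inter> {..u} = {0..1}"
          using order_trans[OF D.cdf_bounded_prob less_imp_le[OF 3]] by auto
        then show ?thesis unfolding r cdf_distr[OF FX] by (simp add: prob_space)
      qed
    qed
  qed (simp add: FX)
qed

end

lemma uniform_margin_AE:
  assumes "prob_space D" and X: "X \<in> borel_measurable D" and u: "distr D borel X = uniform_measure lborel {0..1::real}"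
  shows "AE p in D. 0 < X p \<and> X p < 1"
proof -
  have "AE x in lborel. x \<noteq> 0 \<and> x \<noteq> (1 :: real)" by (intro AE_conjI AE_lborel_singleton)
  then have "AE x in lborel. x \<in> {0..1} \<longrightarrow> 0 < x \<and> x < (1 :: real)" by eventually_elim auto
  then have "AE x in uniform_measure lborel {0..1::real}. 0 < x \<and> x < 1"
    by (intro AE_uniform_measureI) simp
  then have "AE x in distr D borel X. 0 < x \<and> x < 1" by (simp only: u)
  then show ?thesis by (rule AE_distrD[OF X])
qed

lemma copula_AE_unit_cube:
  assumes "is_copula D"
  shows "AE p in D. 0 < fst p \<and> fst p < 1 \<and> 0 < fst (snd p) \<and> fst (snd p) < 1 \<and> 0 < snd (snd p) \<and> snd (snd p) < 1"
proof -
  have D: "prob_space D" "sets D = sets borel" using assms by (auto simp: is_copula_def)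
  have m: "fst \<in> borel_measurable D" "(\<lambda>p. fst (snd p)) \<in> borel_measurable D" "(\<lambda>p. snd (snd p)) \<in> borel_measurable D"
    unfolding measurable_cong_sets[OF D(2) refl]
    by (auto intro!: borel_measurable_continuous_onI continuous_intros)
  have "distr D borel fst = uniform_measure lborel {0..1}" "distr D borel (\<lambda>p. fst (snd p)) = uniform_measure lborel {0..1}"
    "distr D borel (\<lambda>p. snd (snd p)) = uniform_measure lborel {0..1}"
    using assms by (simp_all add: is_copula_def case_prod_unfold)
  from uniform_margin_AE[OF D(1) m(1) this(1)] uniform_margin_AE[OF D(1) m(2) this(2)] uniform_margin_AE[OF D(1) m(3) this(3)]
  show ?thesis by eventually_elim simp
qed

text \<open>Distribution functions need not attain the values \<open>0\<close> and \<open>1\<close>, so the boundary of the cube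
  has to be reached by a limit.\<close>

lemma copula_eqI:
  assumes D: "is_copula D" and D': "is_copula D'"
    and eq: "\<And>a b c. a \<in> {0<..<1} \<Longrightarrow> b \<in> {0<..<1} \<Longrightarrow> c \<in> {0<..<1} \<Longrightarrow> cdf3 D a b c = cdf3 D' a b c"
  shows "D = D'"
proof (rule measure_eqI_cdf3)
  \<comment> \<open>Arguments that are at least \<open>1\<close> are replaced by values approaching
    \<open>1\<close> from below, others are kept. The uniform margins make this harmless in the
    limit: almost surely all coordinates are strictly below \<open>1\<close>.\<close>
  define t where "t k a = (if a < 1 then a else 1 - 1 / real (Suc k))" for k :: nat and a :: real
  have t1: "t k a < 1" for k a by (auto simp: t_def)
  have lim: "(\<lambda>k. cdf3 E (t k a) (t k b) (t k c)) \<longlonglongrightarrow> cdf3 E a b c" if E: "is_copula E" for E a b c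
  proof -
    interpret E: prob_space E using E by (simp add: is_copula_def)
    have sE: "sets E = sets borel" using E by (simp add: is_copula_def)
    have spE: "space E = UNIV" using sets_eq_imp_space_eq[OF sE] by simp
    define U where "U = {p :: real \<times> real \<times> real. fst p < 1} \<inter> {p. fst (snd p) < 1} \<inter> {p. snd (snd p) < 1}"
    have "open U" unfolding U_def by (intro open_Int open_Collect_less continuous_intros)
    then have U: "U \<in> sets E" by (simp add: sE)
    have AU: "AE p in E. p \<in> U" using copula_AE_unit_cube[OF E] by eventually_elim (auto simp: U_def)
    have box: "{..x} \<times> {..y} \<times> {..z} \<in> sets E" for x y z using box_sets_borel by (simp add: sE)
    have int: "cdf3 E x y z = E.prob (({..x} \<times> {..y} \<times> {..z}) \<inter> U)" for x y z
      unfolding cdf3_def using AU box U by (intro E.finite_measure_eq_AE) (auto elim!: eventually_mono)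
    have ev: "\<forall>\<^sub>F k in sequentially. (x \<le> t k a) = (x \<le> a)" if "x < 1" for x a
    proof (cases "a < 1")
      case True then show ?thesis by (simp add: t_def)
    next
      case False
      have "\<forall>\<^sub>F k in sequentially. x < 1 - 1 / real (Suc k)" using that by real_asymp
      then show ?thesis by eventually_elim (use False that in \<open>auto simp: t_def\<close>)
    qed
    show ?thesis unfolding int
    proof (rule E.prob_LIMSEQ_eventually)
      fix p
      show "\<forall>\<^sub>F k in sequentially. (p \<in> ({..t k a} \<times> {..t k b} \<times> {..t k c}) \<inter> U) = (p \<in> ({..a} \<times> {..b} \<times> {..c}) \<inter> U)"
      proof (cases "p \<in> U")
        case True
        then have "fst p < 1" "fst (snd p) < 1" "snd (snd p) < 1" by (auto simp: U_def)
        from ev[OF this(1), of a] ev[OF this(2), of b] ev[OF this(3), of c]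
        show ?thesis by eventually_elim (cases p, simp)
      qed simp
    qed (use box U in auto)
  qed
  have zero: "cdf3 E a b c = 0" if E: "is_copula E" and abc: "a \<le> 0 \<or> b \<le> 0 \<or> c \<le> 0" for E a b c
  proof -
    interpret E: prob_space E using E by (simp add: is_copula_def)
    have sE: "sets E = sets borel" using E by (simp add: is_copula_def)
    have "AE p in E. p \<notin> {..a} \<times> {..b} \<times> {..c}"
      using copula_AE_unit_cube[OF E] by eventually_elim (use abc in auto)
    then have "E.prob ({..a} \<times> {..b} \<times> {..c}) = E.prob {}"
      using box_sets_borel sE by (intro E.finite_measure_eq_AE) (auto elim!: eventually_mono)
    then show ?thesis by (simp add: cdf3_def)
  qed
  have lt1: "cdf3 D a b c = cdf3 D' a b c" if "a < 1" "b < 1" "c < 1" for a b c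
  proof (cases "a \<le> 0 \<or> b \<le> 0 \<or> c \<le> 0")
    case True then show ?thesis using zero[OF D] zero[OF D'] by simp
  next
    case False then show ?thesis using eq that by auto
  qed
  fix a b c
  have "(\<lambda>k. cdf3 D (t k a) (t k b) (t k c)) \<longlonglongrightarrow> cdf3 D' a b c"
    using lim[OF D', of a b c] lt1[OF t1 t1 t1] by simp
  then show "cdf3 D a b c = cdf3 D' a b c" using lim[OF D] LIMSEQ_unique by blast
qed (use D D' in \<open>auto simp: is_copula_def\<close>)

text \<open>Sklar's theorem for continuous margins. The law of the transformed vector satisfies the
  relation; conversely, every point of the open cube is a triple of values of the marginal
  distribution functions, so the relation prescribes the copula there, which suffices.\<close>

lemma (in prob_space) is_copula_of_iff:
  assumes X: "X \<in> borel_measurable M" "Y \<in> borel_measurable M" "Z \<in> borel_measurable M"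
    and cont: "\<And>x. isCont (cdf (distr M borel X)) x" "\<And>x. isCont (cdf (distr M borel Y)) x" "\<And>x. isCont (cdf (distr M borel Z)) x"
  shows "is_copula_of M X Y Z D \<longleftrightarrow>
    D = distr M borel (\<lambda>\<omega>. (cdf (distr M borel X) (X \<omega>), cdf (distr M borel Y) (Y \<omega>), cdf (distr M borel Z) (Z \<omega>)))"
    (is "_ \<longleftrightarrow> D = ?C")
proof -
  let ?F = "cdf (distr M borel X)" and ?G = "cdf (distr M borel Y)" and ?H = "cdf (distr M borel Z)"
  have b: "?F \<in> borel_measurable borel" "?G \<in> borel_measurable borel" "?H \<in> borel_measurable borel"
    using cont by (auto intro!: borel_measurable_continuous_onI simp: continuous_on_eq_continuous_at)
  have m: "(\<lambda>\<omega>. ?F (X \<omega>)) \<in> borel_measurable M" "(\<lambda>\<omega>. ?G (Y \<omega>)) \<in> borel_measurable M" "(\<lambda>\<omega>. ?H (Z \<omega>)) \<in> borel_measurable M"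
    using measurable_compose[OF X(1) b(1)] measurable_compose[OF X(2) b(2)] measurable_compose[OF X(3) b(3)] by auto
  have mC: "(\<lambda>\<omega>. (?F (X \<omega>), ?G (Y \<omega>), ?H (Z \<omega>))) \<in> borel_measurable M"
    by (intro borel_measurable_Pair m)
  have mXYZ: "(\<lambda>\<omega>. (X \<omega>, Y \<omega>, Z \<omega>)) \<in> borel_measurable M" by (intro borel_measurable_Pair X)
  have proj: "(\<lambda>(u, v, w). u) \<in> borel_measurable (borel :: (real \<times> real \<times> real) measure)"
    "(\<lambda>(u, v, w). v) \<in> borel_measurable (borel :: (real \<times> real \<times> real) measure)"
    "(\<lambda>(u, v, w). w) \<in> borel_measurable (borel :: (real \<times> real \<times> real) measure)"
    unfolding case_prod_unfold by (intro borel_measurable_continuous_onI continuous_intros)+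
  have cop: "is_copula ?C"
  proof -
    have "distr ?C borel (\<lambda>(u, v, w). u) = distr M borel (\<lambda>\<omega>. ?F (X \<omega>))"
      by (subst distr_distr[OF proj(1) mC]) (simp add: comp_def)
    moreover have "distr ?C borel (\<lambda>(u, v, w). v) = distr M borel (\<lambda>\<omega>. ?G (Y \<omega>))"
      by (subst distr_distr[OF proj(2) mC]) (simp add: comp_def)
    moreover have "distr ?C borel (\<lambda>(u, v, w). w) = distr M borel (\<lambda>\<omega>. ?H (Z \<omega>))"
      by (subst distr_distr[OF proj(3) mC]) (simp add: comp_def)
    ultimately show ?thesis
      unfolding is_copula_def
      using prob_space_distr[OF mC] uniform_cdf_transform[OF X(1) cont(1)] uniform_cdf_transform[OF X(2) cont(2)]
        uniform_cdf_transform[OF X(3) cont(3)]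
      by (simp only: sets_distr simp_thms)
  qed
  have rel: "cdf3 (distr M borel (\<lambda>\<omega>. (X \<omega>, Y \<omega>, Z \<omega>))) x y z = cdf3 ?C (?F x) (?G y) (?H z)" for x y z
  proof -
    have "cdf3 (distr M borel (\<lambda>\<omega>. (X \<omega>, Y \<omega>, Z \<omega>))) x y z =
        prob ((\<lambda>\<omega>. (X \<omega>, Y \<omega>, Z \<omega>)) -` ({..x} \<times> {..y} \<times> {..z}) \<inter> space M)"
      unfolding cdf3_def by (rule measure_distr[OF mXYZ box_sets_borel])
    also have "\<dots> = prob ((\<lambda>\<omega>. (?F (X \<omega>), ?G (Y \<omega>), ?H (Z \<omega>))) -` ({..?F x} \<times> {..?G y} \<times> {..?H z}) \<inter> space M)"
    proof (rule finite_measure_eq_AE)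
      show "AE \<omega> in M. (\<omega> \<in> (\<lambda>\<omega>. (X \<omega>, Y \<omega>, Z \<omega>)) -` ({..x} \<times> {..y} \<times> {..z}) \<inter> space M) =
          (\<omega> \<in> (\<lambda>\<omega>. (?F (X \<omega>), ?G (Y \<omega>), ?H (Z \<omega>))) -` ({..?F x} \<times> {..?G y} \<times> {..?H z}) \<inter> space M)"
        using AE_cdf_transform_le_iff[OF X(1) cont(1), of x] AE_cdf_transform_le_iff[OF X(2) cont(2), of y]
          AE_cdf_transform_le_iff[OF X(3) cont(3), of z]
        by eventually_elim simp
    qed (rule measurable_sets[OF mXYZ box_sets_borel], rule measurable_sets[OF mC box_sets_borel])
    also have "\<dots> = cdf3 ?C (?F x) (?G y) (?H z)"
      unfolding cdf3_def by (rule measure_distr[OF mC box_sets_borel, symmetric])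
    finally show ?thesis .
  qed
  show ?thesis
  proof
    assume "D = ?C"
    then show "is_copula_of M X Y Z D"
      unfolding is_copula_of_def using cop rel by (simp only: simp_thms)
  next
    assume D: "is_copula_of M X Y Z D"
    show "D = ?C"
    proof (rule copula_eqI[OF _ cop])
      show "is_copula D" using D by (simp add: is_copula_of_def)
      fix a b c :: real assume "a \<in> {0<..<1}" "b \<in> {0<..<1}" "c \<in> {0<..<1}"
      then have abc: "0 < a" "a < 1" "0 < b" "b < 1" "0 < c" "c < 1" by auto
      obtain x where x: "?F x = a" using cdf_attains[OF X(1) cont(1) abc(1,2)] by (elim exE conjE)
      obtain y where y: "?G y = b" using cdf_attains[OF X(2) cont(2) abc(3,4)] by (elim exE conjE)
      obtain z where z: "?H z = c" using cdf_attains[OF X(3) cont(3) abc(5,6)] by (elim exE conjE)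
      have "cdf3 (distr M borel (\<lambda>\<omega>. (X \<omega>, Y \<omega>, Z \<omega>))) x y z = cdf3 D (?F x) (?G y) (?H z)"
        using D unfolding is_copula_of_def by blast
      then show "cdf3 D a b c = cdf3 ?C a b c"
        using rel[of x y z] by (simp only: x y z)
    qed
  qed
qed

section \<open>The copula of the Wiener process and its running extrema\<close>

definition std_normal_cdf :: "real \<Rightarrow> real" where
  "std_normal_cdf = cdf std_normal_distribution"

lemma std_normal_cdf_diff:
  assumes "a \<le> b"
  shows "std_normal_cdf b - std_normal_cdf a = integral {a..b} std_normal_density"
proof (cases "a = b")
  case False
  then have ab: "a < b" using assms by simp
  interpret N: real_distribution std_normal_distribution by (rule real_dist_normal_dist)
  have int: "set_integrable lborel {a<..b} std_normal_density"
    unfolding set_integrable_def by (rule integrable_mult_indicator) auto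
  have "std_normal_cdf b - std_normal_cdf a = measure std_normal_distribution {a<..b}"
    unfolding std_normal_cdf_def by (rule N.cdf_diff_eq[OF ab])
  also have "\<dots> = (\<integral>x. indicator {a<..b} x \<partial>std_normal_distribution)" by simp
  also have "\<dots> = (\<integral>x. std_normal_density x * indicator {a<..b} x \<partial>lborel)"
    by (rule integral_real_density) auto
  also have "\<dots> = (LINT x:{a<..b}|lborel. std_normal_density x)"
    unfolding set_lebesgue_integral_def by (simp add: mult.commute)
  also have "\<dots> = integral {a<..b} std_normal_density" by (rule set_borel_integral_eq_integral(2)[OF int])
  also have "\<dots> = integral {a..b} std_normal_density"
    by (rule integral_spike_set) (auto intro: negligible_subset[of "{a}"])
  finally show ?thesis .
qed simp

lemma DERIV_std_normal_cdf: "DERIV std_normal_cdf x :> std_normal_density x"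
proof -
  have "continuous_on {x - 1..x + 1} std_normal_density"
    unfolding std_normal_density_def by (intro continuous_intros) auto
  from integral_has_real_derivative[OF this, of x]
  have "((\<lambda>y. integral {x - 1..y} std_normal_density) has_real_derivative std_normal_density x) (at x within {x - 1..x + 1})"
    by simp
  then have "((\<lambda>y. std_normal_cdf (x - 1) + integral {x - 1..y} std_normal_density) has_real_derivative std_normal_density x) (at x within {x - 1..x + 1})"
    by (auto intro!: derivative_eq_intros)
  then have "(std_normal_cdf has_real_derivative std_normal_density x) (at x within {x - 1..x + 1})"
  proof (rule has_field_derivative_transform_within[where d=1])
    fix y assume "y \<in> {x - 1..x + 1}"
    then show "std_normal_cdf (x - 1) + integral {x - 1..y} std_normal_density = std_normal_cdf y"
      using std_normal_cdf_diff[of "x - 1" y] by simp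
  qed auto
  then show ?thesis by (simp add: at_within_Icc_at)
qed

lemma isCont_std_normal_cdf: "isCont std_normal_cdf x"
  by (rule DERIV_isCont[OF DERIV_std_normal_cdf])

lemma std_normal_cdf_strict_mono: "x < y \<Longrightarrow> std_normal_cdf x < std_normal_cdf y"
  by (rule DERIV_pos_imp_increasing) (use DERIV_std_normal_cdf normal_density_pos[of 1 0] in auto)

lemma std_normal_cdf_less_iff: "std_normal_cdf x < std_normal_cdf y \<longleftrightarrow> x < y"
  using std_normal_cdf_strict_mono by (metis less_asym linorder_neqE_linordered_idom)

lemma std_normal_cdf_mono: "x \<le> y \<Longrightarrow> std_normal_cdf x \<le> std_normal_cdf y"
  using std_normal_cdf_less_iff by (meson leD leI)

lemma std_normal_cdf_bounds: "0 < std_normal_cdf x" "std_normal_cdf x < 1"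
proof -
  interpret N: real_distribution std_normal_distribution by (rule real_dist_normal_dist)
  show "0 < std_normal_cdf x"
    using std_normal_cdf_strict_mono[of "x - 1" x] N.cdf_nonneg[of "x - 1"] by (simp add: std_normal_cdf_def)
  show "std_normal_cdf x < 1"
    using std_normal_cdf_strict_mono[of x "x + 1"] N.cdf_bounded_prob[of "x + 1"] by (simp add: std_normal_cdf_def)
qed

lemma std_normal_cdf_attains:
  assumes "0 < u" "u < 1"
  shows "\<exists>x. std_normal_cdf x = u"
proof -
  interpret N: real_distribution std_normal_distribution by (rule real_dist_normal_dist)
  have "distr std_normal_distribution borel (\<lambda>x. x) = std_normal_distribution"
    by (rule distr_id2) simp
  then show ?thesis
    using N.cdf_attains[of "\<lambda>x. x" u] isCont_std_normal_cdf assms unfolding std_normal_cdf_def by auto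
qed

text \<open>A total function; its values are meaningful on the open unit interval, which is the
  range of \<open>std_normal_cdf\<close>.\<close>

definition std_normal_quantile :: "real \<Rightarrow> real" where
  "std_normal_quantile = inv std_normal_cdf"

lemma std_normal_quantile_cdf: "std_normal_quantile (std_normal_cdf x) = x"
proof -
  have "inj std_normal_cdf"
    by (rule injI) (metis less_irrefl linorder_neqE_linordered_idom std_normal_cdf_strict_mono)
  then show ?thesis by (simp add: std_normal_quantile_def)
qed

lemma std_normal_cdf_quantile: "0 < u \<Longrightarrow> u < 1 \<Longrightarrow> std_normal_cdf (std_normal_quantile u) = u"
  using std_normal_cdf_attains[of u] std_normal_quantile_cdf by auto

lemma DERIV_std_normal_quantile:
  assumes u: "0 < u" "u < 1"
  shows "DERIV std_normal_quantile u :> inverse (std_normal_density (std_normal_quantile u))"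
proof (rule DERIV_inverse_function[where f=std_normal_cdf and a=0 and b=1])
  have "isCont std_normal_quantile (std_normal_cdf (std_normal_quantile u))"
    by (rule isCont_inverse_function[where d=1]) (auto simp: std_normal_quantile_cdf isCont_std_normal_cdf)
  then show "isCont std_normal_quantile u" by (simp add: std_normal_cdf_quantile u)
  show "std_normal_density (std_normal_quantile u) \<noteq> 0" using normal_density_pos[of 1 0 "std_normal_quantile u"] by simp
qed (use DERIV_std_normal_cdf std_normal_cdf_quantile u in auto)

text \<open>Given by one formula on the whole space. Its last two components are the distribution
  functions of the maximum and minimum at time \<open>1\<close> only where the maximum is
  nonnegative and the minimum nonpositive, which holds on all paths.\<close>

definition wiener_copula_map :: "real \<times> real \<times> real \<Rightarrow> real \<times> real \<times> real" where
  "wiener_copula_map p = (std_normal_cdf (fst p), 2 * std_normal_cdf (fst (snd p)) - 1, 2 * std_normal_cdf (snd (snd p)))"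

lemma continuous_wiener_copula_map: "continuous_on UNIV wiener_copula_map"
proof -
  have "continuous_on UNIV std_normal_cdf"
    using isCont_std_normal_cdf by (simp add: continuous_on_eq_continuous_at)
  then have c: "continuous_on UNIV (\<lambda>p. std_normal_cdf (f p))" if "continuous_on UNIV f" for f :: "real \<times> real \<times> real \<Rightarrow> real"
    by (rule continuous_on_compose2[OF _ that]) simp
  show ?thesis unfolding wiener_copula_map_def[abs_def]
    by (intro continuous_intros c)
qed

lemma measurable_wiener_copula_map: "wiener_copula_map \<in> borel_measurable borel"
  by (rule borel_measurable_continuous_onI[OF continuous_wiener_copula_map])

definition wiener_copula_inv :: "real \<times> real \<times> real \<Rightarrow> real \<times> real \<times> real" where
  "wiener_copula_inv p = (std_normal_quantile (fst p), std_normal_quantile ((fst (snd p) + 1) / 2), std_normal_quantile (snd (snd p) / 2))"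

lemma wiener_copula_inv_map: "wiener_copula_inv (wiener_copula_map p) = p"
  by (simp add: wiener_copula_inv_def wiener_copula_map_def std_normal_quantile_cdf)

text \<open>The domain is the range of \<open>wiener_copula_map\<close> on the whole space; it
  extends beyond the unit cube because that map makes no assumption on the signs of the
  extrema.\<close>

lemma differentiable_wiener_copula_inv:
  "wiener_copula_inv differentiable_on {0<..<1} \<times> {-1<..<1} \<times> {0<..<2}"
  unfolding differentiable_on_def
proof
  fix p :: "real \<times> real \<times> real" assume p: "p \<in> {0<..<1} \<times> {-1<..<1} \<times> {0<..<2}"
  let ?S = "{0<..<1} \<times> {-1<..<1} \<times> {0<..<2 :: real} :: (real \<times> real \<times> real) set"
  have d: "((\<lambda>p. std_normal_quantile (f p)) has_derivative (\<lambda>h. f' h * inverse (std_normal_density (std_normal_quantile (f p))))) (at p within ?S)"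
    if "(f has_derivative f') (at p within ?S)" "0 < f p" "f p < 1" for f f'
    by (rule DERIV_compose_FDERIV[OF DERIV_std_normal_quantile[OF that(2,3)] that(1)])
  have "((\<lambda>p. (std_normal_quantile (fst p), std_normal_quantile ((fst (snd p) + 1) / 2), std_normal_quantile (snd (snd p) / 2)))
     has_derivative (\<lambda>h. (fst h * inverse (std_normal_density (std_normal_quantile (fst p))),
        (fst (snd h) / 2) * inverse (std_normal_density (std_normal_quantile ((fst (snd p) + 1) / 2))),
        (snd (snd h) / 2) * inverse (std_normal_density (std_normal_quantile (snd (snd p) / 2)))))) (at p within ?S)"
    by (intro has_derivative_Pair d) (use p in \<open>auto intro!: derivative_eq_intros\<close>)
  then show "wiener_copula_inv differentiable (at p within ?S)"
    unfolding wiener_copula_inv_def[abs_def] by (rule differentiableI)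
qed

section \<open>Marginal distribution functions, absolute continuity and support of the
  copula\<close>

context wiener_process
begin

lemma prob_value_le:
  assumes t: "0 < t"
  shows "prob {\<omega> \<in> space \<Omega>. W t \<omega> \<le> x} = std_normal_cdf (x / sqrt t)"
proof -
  interpret R: wiener_process \<Omega> "rescaled W t" by (rule wiener_process_rescaled[OF t])
  have "prob {\<omega> \<in> space \<Omega>. rescaled W t 1 \<omega> \<in> {..x / sqrt t}} = std_normal_cdf (x / sqrt t)"
    using R.prob_value[of 1 "{..x / sqrt t}"] by (simp add: std_normal_cdf_def cdf_def)
  moreover have "{\<omega> \<in> space \<Omega>. rescaled W t 1 \<omega> \<in> {..x / sqrt t}} = {\<omega> \<in> space \<Omega>. W t \<omega> \<le> x}"
    using t by (auto simp: rescaled_def divide_le_cancel)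
  ultimately show ?thesis by simp
qed

lemma prob_value_greater:
  assumes t: "0 < t"
  shows "prob {\<omega> \<in> space \<Omega>. x < W t \<omega>} = 1 - std_normal_cdf (x / sqrt t)"
proof -
  have "{\<omega> \<in> space \<Omega>. W t \<omega> \<in> {..x}} \<in> events" using t by (intro value_event) auto
  then have "prob (space \<Omega> - {\<omega> \<in> space \<Omega>. W t \<omega> \<le> x}) = 1 - prob {\<omega> \<in> space \<Omega>. W t \<omega> \<le> x}"
    by (intro prob_compl) simp
  moreover have "space \<Omega> - {\<omega> \<in> space \<Omega>. W t \<omega> \<le> x} = {\<omega> \<in> space \<Omega>. x < W t \<omega>}" by auto
  ultimately show ?thesis using prob_value_le[OF t] by simp
qed

lemma std_normal_cdf_0: "std_normal_cdf 0 = 1 / 2"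
  using prob_value_greater[of 1 0] prob_value_pos(1)[of 1] by simp

lemma cdf_value:
  assumes t: "0 < t"
  shows "cdf (distr \<Omega> borel (W t)) x = std_normal_cdf (x / sqrt t)"
proof -
  have "W t \<in> borel_measurable \<Omega>" using t by (intro wiener_measurable) simp
  from cdf_distr[OF this] show ?thesis using prob_value_le[OF t] by simp
qed

lemma cdf_running_max:
  assumes t: "0 < t" and y: "0 \<le> y"
  shows "cdf (distr \<Omega> borel (running_max W t)) y = 2 * std_normal_cdf (y / sqrt t) - 1"
proof -
  have Wm: "(\<lambda>\<omega>. \<bar>W t \<omega>\<bar>) \<in> borel_measurable \<Omega>"
    using t by (intro borel_measurable_abs wiener_measurable) simp
  have ev: "{\<omega> \<in> space \<Omega>. y < \<bar>W t \<omega>\<bar>} \<in> events" by (intro borel_measurable_less Wm borel_measurable_const)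
  have "cdf (distr \<Omega> borel (running_max W t)) y = prob {\<omega> \<in> space \<Omega>. \<bar>W t \<omega>\<bar> \<le> y}"
    unfolding running_max_distr[OF t] by (rule cdf_distr[OF Wm])
  also have "{\<omega> \<in> space \<Omega>. \<bar>W t \<omega>\<bar> \<le> y} = space \<Omega> - {\<omega> \<in> space \<Omega>. y < \<bar>W t \<omega>\<bar>}" by auto
  also have "prob \<dots> = 1 - prob {\<omega> \<in> space \<Omega>. y < \<bar>W t \<omega>\<bar>}" by (rule prob_compl[OF ev])
  finally show ?thesis using prob_abs_value_greater[OF t y] prob_value_greater[OF t] by simp
qed

lemma AE_value_notin_finite:
  assumes "0 < t" "finite A"
  shows "AE \<omega> in \<Omega>. W t \<omega> \<notin> A"
proof -
  have "W t \<in> borel_measurable \<Omega>" using assms by (intro wiener_measurable) simp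
  then show ?thesis
    using absolutely_continuous_value[OF assms(1)] finite_imp_null_set_lborel[OF assms(2)]
    by (simp add: absolutely_continuous_distr_iff)
qed

text \<open>Negating the path turns the minimum into a maximum but also \<open>\<le>\<close> into
  \<open>\<ge>\<close>. Strict and weak inequalities may be exchanged because the normal law has no
  atoms.\<close>

lemma cdf_running_min:
  assumes t: "0 < t" and z: "z \<le> 0"
  shows "cdf (distr \<Omega> borel (running_min W t)) z = 2 * std_normal_cdf (z / sqrt t)"
proof -
  interpret N: wiener_process \<Omega> "\<lambda>t \<omega>. - W t \<omega>" by (rule wiener_process_uminus)
  have Wm: "(\<lambda>\<omega>. \<bar>- W t \<omega>\<bar>) \<in> borel_measurable \<Omega>"
    using t by (intro borel_measurable_abs N.wiener_measurable) simp
  note Mm = N.running_max_measurable[OF t]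
  have "cdf (distr \<Omega> borel (running_min W t)) z = prob {\<omega> \<in> space \<Omega>. running_min W t \<omega> \<le> z}"
    by (rule cdf_distr[OF running_min_measurable[OF t]])
  also have "\<dots> = prob {\<omega> \<in> space \<Omega>. - z \<le> running_max (\<lambda>t \<omega>. - W t \<omega>) t \<omega>}"
    by (rule arg_cong[where f=prob]) (auto simp: running_max_uminus)
  also have "\<dots> = measure (distr \<Omega> borel (running_max (\<lambda>t \<omega>. - W t \<omega>) t)) {- z..}"
    using Mm by (simp add: measure_distr vimage_def Int_def conj_commute)
  also have "\<dots> = prob {\<omega> \<in> space \<Omega>. - z \<le> \<bar>W t \<omega>\<bar>}"
    unfolding N.running_max_distr[OF t] using Wm by (simp add: measure_distr vimage_def Int_def conj_commute)
  also have "\<dots> = prob {\<omega> \<in> space \<Omega>. - z < \<bar>W t \<omega>\<bar>}"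
  proof (rule finite_measure_eq_AE)
    have "AE \<omega> in \<Omega>. W t \<omega> \<notin> {z, - z}" by (rule AE_value_notin_finite[OF t]) simp
    then show "AE \<omega> in \<Omega>. (\<omega> \<in> {\<omega> \<in> space \<Omega>. - z \<le> \<bar>W t \<omega>\<bar>}) = (\<omega> \<in> {\<omega> \<in> space \<Omega>. - z < \<bar>W t \<omega>\<bar>})"
      by eventually_elim (auto simp: abs_if split: if_splits)
    have "(\<lambda>\<omega>. \<bar>W t \<omega>\<bar>) \<in> borel_measurable \<Omega>" using Wm by simp
    then show "{\<omega> \<in> space \<Omega>. - z \<le> \<bar>W t \<omega>\<bar>} \<in> events" "{\<omega> \<in> space \<Omega>. - z < \<bar>W t \<omega>\<bar>} \<in> events"
      by (intro borel_measurable_le borel_measurable_less borel_measurable_const; assumption)+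
  qed
  also have "\<dots> = 2 * prob {\<omega> \<in> space \<Omega>. - z < W t \<omega>}" using z by (intro prob_abs_value_greater[OF t]) simp
  also have "prob {\<omega> \<in> space \<Omega>. - z < W t \<omega>} = prob {\<omega> \<in> space \<Omega>. - W t \<omega> \<in> {- z<..}}"
    using prob_value_uminus[OF t, of "{- z<..}"] by simp
  also have "\<dots> = prob {\<omega> \<in> space \<Omega>. W t \<omega> \<le> z}"
  proof (rule finite_measure_eq_AE)
    have "AE \<omega> in \<Omega>. W t \<omega> \<notin> {z}" by (rule AE_value_notin_finite[OF t]) simp
    then show "AE \<omega> in \<Omega>. (\<omega> \<in> {\<omega> \<in> space \<Omega>. - W t \<omega> \<in> {- z<..}}) = (\<omega> \<in> {\<omega> \<in> space \<Omega>. W t \<omega> \<le> z})"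
      by eventually_elim auto
    show "{\<omega> \<in> space \<Omega>. - W t \<omega> \<in> {- z<..}} \<in> events" using t by (intro N.value_event) auto
    show "{\<omega> \<in> space \<Omega>. W t \<omega> \<le> z} \<in> events" using value_event[of t "{..z}"] t by simp
  qed
  finally show ?thesis using prob_value_le[OF t] by simp
qed

lemma isCont_cdf_absolutely_continuous:
  assumes X: "X \<in> borel_measurable \<Omega>" and ac: "absolutely_continuous lborel (distr \<Omega> borel X)"
  shows "isCont (cdf (distr \<Omega> borel X)) (x :: real)"
proof -
  interpret D: real_distribution "distr \<Omega> borel X" using X by simp
  have "{x} \<in> null_sets (distr \<Omega> borel X)"
    using ac finite_imp_null_set_lborel[of "{x}"] unfolding absolutely_continuous_def by blast
  then show ?thesis by (simp add: D.isCont_cdf measure_def null_sets_def)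
qed

text \<open>The marginal distribution functions at time \<open>t\<close> depend on their argument
  divided by \<open>sqrt t\<close>. The transformed vector is thus \<open>wiener_copula_map\<close>
  applied to the rescaled path at time \<open>1\<close>, whose triple has the same law as that of
  \<open>W\<close>.\<close>

lemma is_copula_of_wiener_iff:
  assumes t: "0 < t"
  shows "is_copula_of \<Omega> (W t) (running_max W t) (running_min W t) D \<longleftrightarrow>
    D = distr \<Omega> borel (\<lambda>\<omega>. wiener_copula_map (path_triple W 1 \<omega>))"
proof -
  interpret R: wiener_process \<Omega> "rescaled W t" by (rule wiener_process_rescaled[OF t])
  have m: "W t \<in> borel_measurable \<Omega>" "running_max W t \<in> borel_measurable \<Omega>" "running_min W t \<in> borel_measurable \<Omega>"
    using t by (auto intro!: wiener_measurable running_max_measurable running_min_measurable)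
  have "distr \<Omega> borel (\<lambda>\<omega>. (cdf (distr \<Omega> borel (W t)) (W t \<omega>), cdf (distr \<Omega> borel (running_max W t)) (running_max W t \<omega>),
       cdf (distr \<Omega> borel (running_min W t)) (running_min W t \<omega>)))
     = distr \<Omega> borel (\<lambda>\<omega>. wiener_copula_map (path_triple (rescaled W t) 1 \<omega>))"
  proof (rule distr_cong)
    fix \<omega> assume \<omega>: "\<omega> \<in> space \<Omega>"
    have "0 \<le> running_max W t \<omega>" "running_min W t \<omega> \<le> 0"
      using running_max_nonneg[OF _ \<omega>] running_min_nonpos[OF _ \<omega>] t by simp_all
    then show "(cdf (distr \<Omega> borel (W t)) (W t \<omega>), cdf (distr \<Omega> borel (running_max W t)) (running_max W t \<omega>),
       cdf (distr \<Omega> borel (running_min W t)) (running_min W t \<omega>)) = wiener_copula_map (path_triple (rescaled W t) 1 \<omega>)"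
      using path_triple_rescaled[OF t _ \<omega>, of 1]
      by (simp add: cdf_value[OF t] cdf_running_max[OF t] cdf_running_min[OF t] wiener_copula_map_def)
  qed simp_all
  also have "\<dots> = distr (distr \<Omega> borel (path_triple (rescaled W t) 1)) borel wiener_copula_map"
    using R.path_triple_measurable[of 1] by (subst distr_distr[OF measurable_wiener_copula_map]) (simp_all add: comp_def)
  also have "distr \<Omega> borel (path_triple (rescaled W t) 1) = distr \<Omega> borel (path_triple W 1)"
    by (rule path_triple_distr_unique[OF R.wiener_process_axioms wiener_process_axioms]) simp
  also have "distr (distr \<Omega> borel (path_triple W 1)) borel wiener_copula_map = distr \<Omega> borel (\<lambda>\<omega>. wiener_copula_map (path_triple W 1 \<omega>))"
    using path_triple_measurable[of 1] by (subst distr_distr[OF measurable_wiener_copula_map]) (simp_all add: comp_def)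
  finally have eq: "distr \<Omega> borel (\<lambda>\<omega>. (cdf (distr \<Omega> borel (W t)) (W t \<omega>), cdf (distr \<Omega> borel (running_max W t)) (running_max W t \<omega>),
       cdf (distr \<Omega> borel (running_min W t)) (running_min W t \<omega>))) = distr \<Omega> borel (\<lambda>\<omega>. wiener_copula_map (path_triple W 1 \<omega>))" .
  show ?thesis
    unfolding eq[symmetric]
    by (rule is_copula_of_iff[OF m isCont_cdf_absolutely_continuous[OF m(1) absolutely_continuous_value[OF t]]
          isCont_cdf_absolutely_continuous[OF m(2) absolutely_continuous_running_max[OF t]]
          isCont_cdf_absolutely_continuous[OF m(3) absolutely_continuous_running_min[OF t]]])
qed

lemma absolutely_continuous_wiener_copula:
  "absolutely_continuous lborel (distr \<Omega> borel (\<lambda>\<omega>. wiener_copula_map (path_triple W 1 \<omega>)))"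
proof (rule absolutely_continuous_distr_map[where g=wiener_copula_map and X="path_triple W 1" and h=wiener_copula_inv and T="{0<..<1} \<times> {-1<..<1} \<times> {0<..<2}"])
  show T: "path_triple W 1 \<in> borel_measurable \<Omega>" by (rule path_triple_measurable) simp
  show "(\<lambda>\<omega>. wiener_copula_map (path_triple W 1 \<omega>)) \<in> borel_measurable \<Omega>"
    by (rule measurable_compose[OF T measurable_wiener_copula_map])
  show "absolutely_continuous lborel (distr \<Omega> borel (path_triple W 1))"
    by (rule absolutely_continuous_path_triple) simp
  show "wiener_copula_inv differentiable_on {0<..<1} \<times> {-1<..<1} \<times> {0<..<2}"
    by (rule differentiable_wiener_copula_inv)
  show "wiener_copula_map (path_triple W 1 \<omega>) \<in> {0<..<1} \<times> {-1<..<1} \<times> {0<..<2} \<and>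
     wiener_copula_inv (wiener_copula_map (path_triple W 1 \<omega>)) = path_triple W 1 \<omega>" for \<omega>
    using std_normal_cdf_bounds by (simp add: wiener_copula_inv_map) (simp add: wiener_copula_map_def)
qed simp

lemma wiener_copula_map_in_polyhedron:
  assumes \<omega>: "\<omega> \<in> space \<Omega>"
  shows "wiener_copula_map (path_triple W 1 \<omega>) \<in> wiener_polyhedron"
proof -
  have "running_min W 1 \<omega> \<le> W 1 \<omega>" "W 1 \<omega> \<le> running_max W 1 \<omega>" "running_min W 1 \<omega> \<le> 0" "0 \<le> running_max W 1 \<omega>"
    using running_bounds[of 1 \<omega> 1] running_max_nonneg[of 1 \<omega>] running_min_nonpos[of 1 \<omega>] \<omega> by auto
  then have "std_normal_cdf (running_min W 1 \<omega>) \<le> std_normal_cdf (W 1 \<omega>)" "std_normal_cdf (W 1 \<omega>) \<le> std_normal_cdf (running_max W 1 \<omega>)"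
    "std_normal_cdf (running_min W 1 \<omega>) \<le> 1 / 2" "1 / 2 \<le> std_normal_cdf (running_max W 1 \<omega>)"
    by (auto dest: std_normal_cdf_mono simp: std_normal_cdf_0)
  then show ?thesis
    using std_normal_cdf_bounds[of "W 1 \<omega>"] std_normal_cdf_bounds[of "running_max W 1 \<omega>"] std_normal_cdf_bounds[of "running_min W 1 \<omega>"]
    by (simp add: wiener_copula_map_def path_triple_def wiener_polyhedron_def)
qed

text \<open>The quantiles pull the point back to a triple \<open>(x, y, z)\<close>, and the strict
  inequalities defining the interior become the order relations required of a polygonal path.
  Continuity pulls \<open>U\<close> back to a neighbourhood of this triple.\<close>

lemma prob_wiener_copula_open_pos:
  assumes U: "open U" and p: "(u, v, w) \<in> U" and uvw: "0 < v" "v < 1" "0 < w" "w < 1" "w < 2 * u" "2 * u < 1 + v"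
  shows "0 < prob {\<omega> \<in> space \<Omega>. wiener_copula_map (path_triple W 1 \<omega>) \<in> U}"
proof -
  define x y z where "x = std_normal_quantile u" and "y = std_normal_quantile ((v + 1) / 2)" and "z = std_normal_quantile (w / 2)"
  have cdfs: "std_normal_cdf x = u" "std_normal_cdf y = (v + 1) / 2" "std_normal_cdf z = w / 2"
    unfolding x_def y_def z_def using uvw by (intro std_normal_cdf_quantile; simp)+
  have xyz: "z < x" "x < y" "z < 0" "0 < y"
    using uvw std_normal_cdf_less_iff[of z x] std_normal_cdf_less_iff[of x y] std_normal_cdf_less_iff[of z 0]
      std_normal_cdf_less_iff[of 0 y] unfolding cdfs std_normal_cdf_0 by auto
  have "wiener_copula_map (x, y, z) = (u, v, w)" by (simp add: wiener_copula_map_def cdfs field_simps)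
  then have "(x, y, z) \<in> wiener_copula_map -` U" using p by simp
  moreover have "open (wiener_copula_map -` U)"
    using open_vimage[OF U continuous_wiener_copula_map] .
  ultimately obtain e where e: "0 < e" "\<And>q. dist q (x, y, z) < e \<Longrightarrow> wiener_copula_map q \<in> U"
    unfolding open_dist vimage_eq by blast
  have "{\<omega> \<in> space \<Omega>. \<bar>W 1 \<omega> - x\<bar> < e / 3 \<and> \<bar>running_max W 1 \<omega> - y\<bar> < e / 3 \<and> \<bar>running_min W 1 \<omega> - z\<bar> < e / 3}
     \<subseteq> {\<omega> \<in> space \<Omega>. wiener_copula_map (path_triple W 1 \<omega>) \<in> U}" (is "?F \<subseteq> ?G")
  proof safe
    fix \<omega> assume d: "\<bar>W 1 \<omega> - x\<bar> < e / 3" "\<bar>running_max W 1 \<omega> - y\<bar> < e / 3" "\<bar>running_min W 1 \<omega> - z\<bar> < e / 3"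
    \<comment> \<open>The Euclidean distance of triples is at most the sum of the three coordinate
      distances, so \<open>e / 3\<close> in each coordinate suffices.\<close>
    have tri: "sqrt ((dist a a')\<^sup>2 + (dist b b')\<^sup>2) \<le> dist a a' + dist b b'" for a a' :: real and b b' :: "'z::metric_space"
      by (rule sqrt_sum_squares_le_sum) auto
    have "dist (path_triple W 1 \<omega>) (x, y, z) \<le> dist (W 1 \<omega>) x + dist (running_max W 1 \<omega>, running_min W 1 \<omega>) (y, z)"
      unfolding path_triple_def dist_Pair_Pair[of "W 1 \<omega>"] by (rule tri)
    also have "dist (running_max W 1 \<omega>, running_min W 1 \<omega>) (y, z) \<le> dist (running_max W 1 \<omega>) y + dist (running_min W 1 \<omega>) z"
      unfolding dist_Pair_Pair by (rule tri)
    finally have "dist (path_triple W 1 \<omega>) (x, y, z) < e" using d by (simp add: dist_real_def)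
    then show "wiener_copula_map (path_triple W 1 \<omega>) \<in> U" by (rule e(2))
  qed
  moreover have "?G \<in> events"
    using measurable_sets[OF measurable_compose[OF path_triple_measurable[of 1] measurable_wiener_copula_map] borel_open[OF U]]
    by (simp add: vimage_def Int_def conj_commute)
  ultimately have "prob ?F \<le> prob ?G" by (intro finite_measure_mono)
  moreover have "0 < prob ?F" using xyz e(1) by (intro path_triple_full_support) auto
  ultimately show ?thesis by linarith
qed

text \<open>A closed set of full measure that missed a point of the polyhedron would also miss
  nearby interior points, and every neighbourhood of an interior point has positive
  probability.\<close>

lemma is_support_wiener_copula:
  assumes cl: "closed wiener_polyhedron"
  shows "is_support (distr \<Omega> borel (\<lambda>\<omega>. wiener_copula_map (path_triple W 1 \<omega>))) wiener_polyhedron"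
proof -
  let ?X = "\<lambda>\<omega>. wiener_copula_map (path_triple W 1 \<omega>)"
  have X: "?X \<in> borel_measurable \<Omega>"
    by (rule measurable_compose[OF path_triple_measurable[of 1] measurable_wiener_copula_map]) simp
  have em: "emeasure (distr \<Omega> borel ?X) B = ennreal (prob {\<omega> \<in> space \<Omega>. ?X \<omega> \<in> B})" if "B \<in> sets borel" for B
    using X that by (simp add: emeasure_distr emeasure_eq_measure vimage_def Int_def conj_commute)
  have tot: "emeasure (distr \<Omega> borel ?X) (space (distr \<Omega> borel ?X)) = 1"
    using em[of UNIV] by (simp add: prob_space)
  have "{\<omega> \<in> space \<Omega>. ?X \<omega> \<in> wiener_polyhedron} = space \<Omega>" using wiener_copula_map_in_polyhedron by auto
  then have full: "emeasure (distr \<Omega> borel ?X) wiener_polyhedron = 1"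
    using em[OF borel_closed[OF cl]] by (simp add: prob_space)
  have "wiener_polyhedron \<subseteq> T" if T: "closed T" "emeasure (distr \<Omega> borel ?X) T = 1" for T
  proof (rule ccontr)
    assume "\<not> wiener_polyhedron \<subseteq> T"
    then obtain p where p: "p \<in> wiener_polyhedron" "p \<in> - T" by blast
    obtain u v w where puvw: "p = (u, v, w)" by (cases p)
    \<comment> \<open>The segment from \<open>p\<close> to the interior point
      \<open>(1/2, 1/2, 1/2)\<close>; for parameters strictly between \<open>0\<close> and
      \<open>1\<close> all inequalities become strict.\<close>
    define f where "f s = (1 - s) *\<^sub>R p + s *\<^sub>R (1/2, 1/2, 1/2 :: real)" for s :: real
    have "open (- T)" by (rule open_Compl[OF T(1)])
    have "isCont f 0" unfolding f_def by (intro continuous_intros)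
    \<comment> \<open>The offset \<open>2\<close> keeps the parameter strictly below
      \<open>1\<close> already for \<open>n = 0\<close>.\<close>
    then have lim: "(\<lambda>n. f (1 / real (n + 2))) \<longlonglongrightarrow> f 0"
      by (rule isCont_tendsto_compose) real_asymp
    have "f 0 \<in> - T" using p(2) by (simp add: f_def puvw)
    with lim \<open>open (- T)\<close> have "\<forall>\<^sub>F n in sequentially. f (1 / real (n + 2)) \<in> - T"
      by (rule topological_tendstoD)
    then obtain n where "f (1 / real (n + 2)) \<in> - T" by (auto dest!: eventually_happens)
    moreover define s where "s = 1 / real (n + 2)"
    ultimately have s: "f s \<in> - T" "0 < s" "s < 1" by simp_all
    have b: "0 \<le> v" "v \<le> 1" "0 \<le> w" "w \<le> 1" "w \<le> 2 * u" "2 * u \<le> 1 + v"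
      using p(1) by (auto simp: puvw wiener_polyhedron_def)
    define u' v' w' where "u' = (1 - s) * u + s / 2" and "v' = (1 - s) * v + s / 2" and "w' = (1 - s) * w + s / 2"
    have fs: "f s = (u', v', w')" by (simp add: f_def puvw u'_def v'_def w'_def)
    have n: "0 \<le> (1 - s) * v" "0 \<le> (1 - s) * (1 - v)" "0 \<le> (1 - s) * w" "0 \<le> (1 - s) * (1 - w)"
       "0 \<le> (1 - s) * (2 * u - w)" "0 \<le> (1 - s) * (1 + v - 2 * u)"
      using b s by (auto intro!: mult_nonneg_nonneg)
    have "0 < v'" "v' < 1" "0 < w'" "w' < 1" "w' < 2 * u'" "2 * u' < 1 + v'"
      using n s by (simp_all add: u'_def v'_def w'_def algebra_simps)
    then have "0 < prob {\<omega> \<in> space \<Omega>. ?X \<omega> \<in> - T}"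
      using s(1) \<open>open (- T)\<close> unfolding fs by (intro prob_wiener_copula_open_pos)
    moreover have "{\<omega> \<in> space \<Omega>. ?X \<omega> \<in> T} \<in> events"
      using measurable_sets[OF X borel_closed[OF T(1)]] by (simp add: vimage_def Int_def conj_commute)
    then have "prob (space \<Omega> - {\<omega> \<in> space \<Omega>. ?X \<omega> \<in> T}) = 1 - prob {\<omega> \<in> space \<Omega>. ?X \<omega> \<in> T}" by (rule prob_compl)
    moreover have "space \<Omega> - {\<omega> \<in> space \<Omega>. ?X \<omega> \<in> T} = {\<omega> \<in> space \<Omega>. ?X \<omega> \<in> - T}" by auto
    moreover have "prob {\<omega> \<in> space \<Omega>. ?X \<omega> \<in> T} = 1" using T em[OF borel_closed[OF T(1)]] by simp
    ultimately show False by simp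
  qed
  then show ?thesis unfolding is_support_def tot using cl full by simp
qed

end

section \<open>The polyhedron\<close>

definition wp_vertices :: "(real \<times> real \<times> real) set" where
  "wp_vertices = {(0, 0, 0), (0, 1, 0), (1, 1, 0), (1, 1, 1), (1/2, 0, 1), (1/2, 0, 0), (1/2, 1, 1)}"

text \<open>Pairs of an outer normal and a right-hand side, in the order \<open>0 \<le> v\<close>,
  \<open>v \<le> 1\<close>, \<open>0 \<le> w\<close>, \<open>w \<le> 1\<close>,
  \<open>w \<le> 2 * u\<close>, \<open>2 * u \<le> 1 + v\<close>. They serve as indices of the
  facets throughout.\<close>

definition wp_normals :: "((real \<times> real \<times> real) \<times> real) set" where
  "wp_normals = {((0,-1,0),0), ((0,1,0),1), ((0,0,-1),0), ((0,0,1),1), ((-2,0,1),0), ((2,-1,0),1)}"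

lemma mem_wiener_polyhedron:
  "(u, v, w) \<in> wiener_polyhedron \<longleftrightarrow> 0 \<le> v \<and> v \<le> 1 \<and> 0 \<le> w \<and> w \<le> 1 \<and> w \<le> 2 * u \<and> 2 * u \<le> 1 + v"
  by (auto simp: wiener_polyhedron_def)

lemma wiener_polyhedron_eq_halfspaces:
  "wiener_polyhedron = (\<Inter>(a, b)\<in>wp_normals. {x. a \<bullet> x \<le> b})"
  by (auto simp: wp_normals_def mem_wiener_polyhedron)

lemma polyhedron_wiener_polyhedron: "polyhedron wiener_polyhedron"
  unfolding wiener_polyhedron_eq_halfspaces
  by (rule polyhedron_Inter) (auto simp: wp_normals_def polyhedron_halfspace_le)

lemma convex_wiener_polyhedron: "convex wiener_polyhedron"
  using polyhedron_wiener_polyhedron polyhedron_imp_convex by blast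

lemma closed_wiener_polyhedron: "closed wiener_polyhedron"
  using polyhedron_wiener_polyhedron polyhedron_imp_closed by blast

lemma wp_vertices_subset: "wp_vertices \<subseteq> wiener_polyhedron"
  by (auto simp: wp_vertices_def mem_wiener_polyhedron)

text \<open>For fixed \<open>v, w\<close> the coordinate \<open>u\<close> runs between the two rectangular faces, on each of
  which the point is a bilinear combination of the four corners.\<close>

lemma wiener_polyhedron_eq_hull: "wiener_polyhedron = convex hull wp_vertices"
proof
  show "convex hull wp_vertices \<subseteq> wiener_polyhedron"
    by (intro hull_minimal wp_vertices_subset convex_wiener_polyhedron)
  have seg: "(1 - t) *\<^sub>R x + t *\<^sub>R y \<in> convex hull wp_vertices"
    if "x \<in> convex hull wp_vertices" "y \<in> convex hull wp_vertices" "0 \<le> t" "t \<le> 1" for x y t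
    using that convex_convex_hull[of wp_vertices] by (simp add: convex_alt)
  have V: "(0,0,0) \<in> convex hull wp_vertices" "(0,1,0) \<in> convex hull wp_vertices"
      "(1,1,0) \<in> convex hull wp_vertices" "(1,1,1) \<in> convex hull wp_vertices"
      "(1/2,0,1) \<in> convex hull wp_vertices" "(1/2,0,0) \<in> convex hull wp_vertices"
      "(1/2,1,1) \<in> convex hull wp_vertices"
    by (auto intro!: hull_inc simp: wp_vertices_def)
  have "(u, v, w) \<in> convex hull wp_vertices" if P: "(u, v, w) \<in> wiener_polyhedron" for u v w
  proof -
    have b: "0 \<le> v" "v \<le> 1" "0 \<le> w" "w \<le> 1" "w \<le> 2 * u" "2 * u \<le> 1 + v"
      using P by (auto simp: mem_wiener_polyhedron)
    have L: "(w/2, v, w) \<in> convex hull wp_vertices"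
      using seg[OF seg[OF V(1) V(5) b(3,4)] seg[OF V(2) V(7) b(3,4)] b(1,2)]
      by (simp add: field_simps)
    have "(1 - v) / 2 + v = (1 + v) / 2" by (simp add: field_simps)
    then have R: "((1 + v)/2, v, w) \<in> convex hull wp_vertices"
      using seg[OF seg[OF V(6) V(5) b(3,4)] seg[OF V(3) V(4) b(3,4)] b(1,2)]
      by (simp add: field_simps)
    show ?thesis
    \<comment> \<open>The denominator of \<open>t\<close> vanishes exactly at \<open>v = 0\<close>,
      \<open>w = 1\<close>, the vertex where the two rectangular faces meet.\<close>
    proof (cases "1 + v = w")
      case True
      then have "u = w/2" using b by simp
      then show ?thesis using L by (simp only:)
    next
      case False
      define t where "t = (2 * u - w) / (1 + v - w)"
      have pos: "1 + v - w > 0" using b False by simp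
      have "0 \<le> t" "t \<le> 1" using pos b by (auto simp: t_def field_simps)
      moreover have "(1 - t) * (w/2) + t * ((1 + v)/2) = u"
      proof -
        have "t * (1 + v - w) = 2 * u - w" using pos by (simp add: t_def)
        then show ?thesis by (simp add: field_simps)
      qed
      moreover have "(1 - t) * v + t * v = v" "(1 - t) * w + t * w = w"
        by (simp_all add: algebra_simps)
      ultimately show ?thesis using seg[OF L R, of t] by simp
    qed
  qed
  then show "wiener_polyhedron \<subseteq> convex hull wp_vertices" by auto
qed

lemma extreme_point_linear_maximizer:
  fixes S :: "'a::euclidean_space set"
  assumes "convex S" "x \<in> S" "\<And>y. y \<in> S \<Longrightarrow> c \<bullet> y \<le> d" "\<And>y. y \<in> S \<Longrightarrow> c \<bullet> y = d \<Longrightarrow> y = x" "c \<bullet> x = d"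
  shows "x extreme_point_of S"
proof -
  have "S \<inter> {y. c \<bullet> y = d} = {x}" using assms(2,4,5) by blast
  moreover have "(S \<inter> {y. c \<bullet> y = d}) face_of S"
    by (rule face_of_Int_supporting_hyperplane_le) (use assms(1,3) in auto)
  ultimately show ?thesis by (simp add: face_of_singleton)
qed

text \<open>Each listed point is the unique maximizer of a linear functional, a positive combination
  of the outer normals of the facets through that point. The hull representation gives the other
  inclusion.\<close>

lemma extreme_points_wiener_polyhedron: "{x. x extreme_point_of wiener_polyhedron} = wp_vertices"
proof
  show "{x. x extreme_point_of wiener_polyhedron} \<subseteq> wp_vertices"
    unfolding wiener_polyhedron_eq_hull by (rule extreme_points_of_convex_hull)
  have max: "(x, y, z) extreme_point_of wiener_polyhedron"
    if "(x, y, z) \<in> wiener_polyhedron"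
      "\<And>u v w. (u, v, w) \<in> wiener_polyhedron \<Longrightarrow> a * u + b * v + c * w \<le> d"
      "\<And>u v w. (u, v, w) \<in> wiener_polyhedron \<Longrightarrow> a * u + b * v + c * w = d \<Longrightarrow> u = x \<and> v = y \<and> w = z"
      "a * x + b * y + c * z = d" for x y z a b c d
  proof (rule extreme_point_linear_maximizer[OF convex_wiener_polyhedron that(1), where c="(a, b, c)" and d=d])
    fix y' assume "y' \<in> wiener_polyhedron"
    then show "(a, b, c) \<bullet> y' \<le> d"
      using that(2)[of "fst y'" "fst (snd y')" "snd (snd y')"] by (simp add: inner_prod_def)
  next
    fix y' assume "y' \<in> wiener_polyhedron" "(a, b, c) \<bullet> y' = d"
    then show "y' = (x, y, z)"
      using that(3)[of "fst y'" "fst (snd y')" "snd (snd y')"] by (simp add: inner_prod_def prod_eq_iff)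
  next
    show "(a, b, c) \<bullet> (x, y, z) = d" using that(4) by (simp add: inner_prod_def)
  qed
  have "(0,0,0) extreme_point_of wiener_polyhedron"
    by (rule max[where a="-2" and b="-1" and c="-1" and d=0]) (unfold mem_wiener_polyhedron, (intro conjI)?, linarith+)
  moreover have "(0,1,0) extreme_point_of wiener_polyhedron"
    by (rule max[where a="-2" and b="1" and c="-1" and d=1]) (unfold mem_wiener_polyhedron, (intro conjI)?, linarith+)
  moreover have "(1,1,0) extreme_point_of wiener_polyhedron"
    by (rule max[where a="2" and b="1" and c="-1" and d=3]) (unfold mem_wiener_polyhedron, (intro conjI)?, linarith+)
  moreover have "(1,1,1) extreme_point_of wiener_polyhedron"
    by (rule max[where a="2" and b="1" and c="1" and d=4]) (unfold mem_wiener_polyhedron, (intro conjI)?, linarith+)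
  moreover have "(1/2,0,1) extreme_point_of wiener_polyhedron"
    by (rule max[where a="0" and b="-1" and c="1" and d=1]) (unfold mem_wiener_polyhedron, (intro conjI)?, linarith+)
  moreover have "(1/2,0,0) extreme_point_of wiener_polyhedron"
    by (rule max[where a="2" and b="-2" and c="-1" and d=1]) (unfold mem_wiener_polyhedron, (intro conjI)?, linarith+)
  moreover have "(1/2,1,1) extreme_point_of wiener_polyhedron"
    by (rule max[where a="-2" and b="1" and c="2" and d=2]) (unfold mem_wiener_polyhedron, (intro conjI)?, linarith+)
  ultimately show "wp_vertices \<subseteq> {x. x extreme_point_of wiener_polyhedron}"
    by (simp add: wp_vertices_def)
qed

lemma interior_wiener_polyhedron:
  "{(u, v, w). 0 < v \<and> v < 1 \<and> 0 < w \<and> w < 1 \<and> w < 2 * u \<and> 2 * u < 1 + v} \<subseteq> interior wiener_polyhedron"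
    (is "?I \<subseteq> _")
proof (rule interior_maximal)
  show "?I \<subseteq> wiener_polyhedron" by (clarsimp simp: mem_wiener_polyhedron)
  have "?I = {x. 0 < fst (snd x)} \<inter> {x. fst (snd x) < 1} \<inter> {x. 0 < snd (snd x)} \<inter> {x. snd (snd x) < 1}
     \<inter> {x. snd (snd x) < 2 * fst x} \<inter> {x. 2 * fst x < 1 + fst (snd x)}"
    by auto
  also have "open \<dots>"
    by (intro open_Int open_Collect_less continuous_intros)
  finally show "open ?I" .
qed

lemma interior_wiener_polyhedron_nonempty: "interior wiener_polyhedron \<noteq> {}"
proof -
  have "(1/2, 1/2, 1/2) \<in> interior wiener_polyhedron"
    by (rule subsetD[OF interior_wiener_polyhedron]) simp
  then show ?thesis by auto
qed

lemma aff_dim_wiener_polyhedron: "aff_dim wiener_polyhedron = 3"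
  using aff_dim_nonempty_interior[OF interior_wiener_polyhedron_nonempty] by simp

text \<open>An inequality of an irredundant description cuts out a facet, and every facet arises in
  this way. Irredundancy is shown by a point violating one inequality and satisfying the other
  five.\<close>

lemma facets_wiener_polyhedron:
  "{F. F facet_of wiener_polyhedron} = (\<lambda>n. wiener_polyhedron \<inter> {x. fst n \<bullet> x = snd n}) ` wp_normals"
proof -
  define hs :: "(real \<times> real \<times> real) \<times> real \<Rightarrow> (real \<times> real \<times> real) set"
    where "hs n = {x. fst n \<bullet> x \<le> snd n}" for n
  have wit: "\<exists>x. x \<notin> hs n \<and> (\<forall>m\<in>wp_normals. m \<noteq> n \<longrightarrow> x \<in> hs m)" if "n \<in> wp_normals" for n
  proof -
    consider "n = ((0,-1,0),0)" | "n = ((0,1,0),1)" | "n = ((0,0,-1),0)" | "n = ((0,0,1),1)"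
      | "n = ((-2,0,1),0)" | "n = ((2,-1,0),1)"
      using \<open>n \<in> wp_normals\<close> unfolding wp_normals_def by blast
    then show ?thesis
    proof cases
      case 1 then show ?thesis by (intro exI[of _ "(1/4,-1/4,1/4)"]) (simp add: hs_def wp_normals_def)
    next
      case 2 then show ?thesis by (intro exI[of _ "(1/2,2,1/2)"]) (simp add: hs_def wp_normals_def)
    next
      case 3 then show ?thesis by (intro exI[of _ "(1/2,1/2,-1)"]) (simp add: hs_def wp_normals_def)
    next
      case 4 then show ?thesis by (intro exI[of _ "(3/4,3/4,3/2)"]) (simp add: hs_def wp_normals_def)
    next
      case 5 then show ?thesis by (intro exI[of _ "(0,1/2,1/2)"]) (simp add: hs_def wp_normals_def)
    next
      case 6 then show ?thesis by (intro exI[of _ "(1,1/2,1/2)"]) (simp add: hs_def wp_normals_def)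
    qed
  qed
  have inj: "inj_on hs wp_normals"
  proof (rule inj_onI, rule ccontr)
    fix n m assume nm: "n \<in> wp_normals" "m \<in> wp_normals" "hs n = hs m" "n \<noteq> m"
    from wit[OF nm(1)] obtain x where "x \<notin> hs n" "x \<in> hs m" using nm(2,4) by auto
    then show False using nm(3) by simp
  qed
  \<comment> \<open>\<open>facet_of_polyhedron_explicit\<close> takes normals as functions of the
    half-space, so each half-space must determine its index; the same witness points show that it
    does.\<close>
  define nrm where "nrm = inv_into wp_normals hs"
  have nrm: "nrm (hs n) = n" if "n \<in> wp_normals" for n
    unfolding nrm_def using inj that by (rule inv_into_f_f)
  have aff: "affine hull wiener_polyhedron = UNIV"
    using interior_wiener_polyhedron_nonempty by (rule affine_hull_nonempty_interior)
  have Peq: "wiener_polyhedron = affine hull wiener_polyhedron \<inter> \<Inter>(hs ` wp_normals)"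
    unfolding aff by (subst wiener_polyhedron_eq_halfspaces) (simp add: hs_def case_prod_beta)
  have "C facet_of wiener_polyhedron \<longleftrightarrow>
     (\<exists>h. h \<in> hs ` wp_normals \<and> C = wiener_polyhedron \<inter> {x. fst (nrm h) \<bullet> x = snd (nrm h)})" for C
  proof (rule facet_of_polyhedron_explicit[where F="hs ` wp_normals" and a="\<lambda>h. fst (nrm h)" and b="\<lambda>h. snd (nrm h)"])
    show "finite (hs ` wp_normals)" by (simp add: wp_normals_def)
    show "wiener_polyhedron = affine hull wiener_polyhedron \<inter> \<Inter>(hs ` wp_normals)" by (rule Peq)
    show "fst (nrm h) \<noteq> 0 \<and> h = {x. fst (nrm h) \<bullet> x \<le> snd (nrm h)}" if h: "h \<in> hs ` wp_normals" for h
    proof -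
      obtain n where n: "n \<in> wp_normals" "h = hs n" using h by auto
      then have "fst n \<noteq> 0" by (auto simp: wp_normals_def zero_prod_def)
      then show ?thesis using nrm[OF n(1)] n(2) by (simp add: hs_def)
    qed
    show "wiener_polyhedron \<subset> affine hull wiener_polyhedron \<inter> \<Inter>F'" if F': "F' \<subset> hs ` wp_normals" for F'
    proof -
      obtain n where n: "n \<in> wp_normals" "hs n \<notin> F'" using F' by auto
      obtain x where x: "x \<notin> hs n" "\<forall>m\<in>wp_normals. m \<noteq> n \<longrightarrow> x \<in> hs m" using wit[OF n(1)] by blast
      have "x \<in> \<Inter>F'"
      proof
        fix X assume "X \<in> F'"
        then obtain m where m: "m \<in> wp_normals" "X = hs m" using F' by blast
        then have "m \<noteq> n" using n(2) \<open>X \<in> F'\<close> by auto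
        then show "x \<in> X" using x(2) m by simp
      qed
      moreover have "x \<notin> wiener_polyhedron" using x(1) n(1) by (subst Peq) auto
      moreover have "wiener_polyhedron \<subseteq> \<Inter>F'" using F' by (subst Peq) auto
      ultimately show ?thesis unfolding aff by auto
    qed
  qed
  then have "C facet_of wiener_polyhedron \<longleftrightarrow>
     (\<exists>n\<in>wp_normals. C = wiener_polyhedron \<inter> {x. fst n \<bullet> x = snd n})" for C
    using nrm by auto
  then show ?thesis by (simp add: set_eq_iff image_iff)
qed

text \<open>A compact convex set is the hull of its extreme points, and the extreme points of a face
  are the vertices lying on it.\<close>

lemma face_of_wiener_polyhedron_hull:
  assumes "F face_of wiener_polyhedron"
  shows "F = convex hull (wp_vertices \<inter> F)"
proof -
  have "compact wiener_polyhedron" unfolding wiener_polyhedron_eq_hull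
    by (simp add: finite_imp_compact_convex_hull wp_vertices_def)
  then have "compact F" using assms face_of_imp_compact convex_wiener_polyhedron by blast
  then have "F = convex hull {x. x extreme_point_of F}"
    using assms face_of_imp_convex Krein_Milman_Minkowski by blast
  moreover have "{x. x extreme_point_of F} = wp_vertices \<inter> F"
    using extreme_point_of_face[OF assms] extreme_points_wiener_polyhedron by auto
  ultimately show ?thesis by simp
qed

section \<open>Corners of quadrilaterals and the shapes of the facets\<close>

lemma extreme_point_of_convex_hull_insert:
  fixes x :: "'a::euclidean_space"
  assumes "T \<noteq> {}" "finite T" "\<And>y. y \<in> T \<Longrightarrow> c \<bullet> y < c \<bullet> x"
  shows "x extreme_point_of (convex hull (insert x T))"
proof (rule extreme_point_linear_maximizer[where c=c and d="c \<bullet> x"])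
  have "convex hull T \<subseteq> {y. c \<bullet> y < c \<bullet> x}"
    by (rule hull_minimal) (use assms(3) in \<open>auto simp: convex_halfspace_lt\<close>)
  then have lt: "c \<bullet> t < c \<bullet> x" if "t \<in> convex hull T" for t using that by auto
  have *: "c \<bullet> y \<le> c \<bullet> x \<and> (c \<bullet> y = c \<bullet> x \<longrightarrow> y = x)" if y: "y \<in> convex hull (insert x T)" for y
  proof -
    obtain u v t where u: "u \<ge> 0" "v \<ge> 0" "u + v = 1" "t \<in> convex hull T" "y = u *\<^sub>R x + v *\<^sub>R t"
      using y unfolding convex_hull_insert[OF assms(1)] by blast
    have "c \<bullet> y = c \<bullet> x - v * (c \<bullet> x - c \<bullet> t)"
    proof -
      have "u = 1 - v" using u(3) by simp
      then have "c \<bullet> y = (1 - v) * (c \<bullet> x) + v * (c \<bullet> t)" unfolding u(5) by (simp add: inner_add_right)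
      then show ?thesis by (simp add: algebra_simps)
    qed
    moreover have "v * (c \<bullet> x - c \<bullet> t) \<ge> 0" using lt[OF u(4)] u(2) by simp
    moreover have "y = x" if "v * (c \<bullet> x - c \<bullet> t) = 0"
    proof -
      have "v = 0" using that lt[OF u(4)] by auto
      moreover from this have "u = 1" using u(3) by simp
      ultimately show ?thesis using u(5) by simp
    qed
    ultimately show ?thesis by auto
  qed
  show "c \<bullet> y \<le> c \<bullet> x" if "y \<in> convex hull (insert x T)" for y using *[OF that] by simp
  show "y = x" if "y \<in> convex hull (insert x T)" "c \<bullet> y = c \<bullet> x" for y using *[OF that(1)] that(2) by simp
qed (auto intro: hull_inc)

text \<open>In the affine coordinates with origin \<open>a\<close> and axes \<open>b - a\<close>,
  \<open>d - a\<close> the four points are \<open>(0,0)\<close>, \<open>(1,0)\<close>,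
  \<open>(k,1)\<close> and \<open>(0,1)\<close>. For each of them a linear functional is strictly
  largest there. The case \<open>k = 1\<close> covers rectangles.\<close>

lemma extreme_points_quadrilateral:
  fixes a b c d :: "'a::euclidean_space"
  assumes nc: "\<not> collinear {a, b, d}" and k: "0 < k" and c: "c - d = k *\<^sub>R (b - a)"
  shows "{x. x extreme_point_of (convex hull {a, b, c, d})} = {a, b, c, d} \<and> card {a, b, c, d} = 4"
proof -
  define e f where "e = b - a" and "f = d - a"
  have "{a, b, d} = {b, a, d}" by auto
  then have "\<not> collinear {0, e, f}"
    using nc collinear_3[of b a d] by (simp add: e_def f_def)
  then have "\<bar>e \<bullet> f\<bar> \<noteq> norm e * norm f" by (simp add: norm_cauchy_schwarz_equal)
  then have "\<bar>e \<bullet> f\<bar> < norm e * norm f" using Cauchy_Schwarz_ineq2[of e f] by linarith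
  then have "\<bar>e \<bullet> f\<bar>\<^sup>2 < (norm e * norm f)\<^sup>2" by (intro power_strict_mono) auto
  then have D: "(e \<bullet> e) * (f \<bullet> f) - (e \<bullet> f)\<^sup>2 > 0"
    by (simp add: power_mult_distrib power2_norm_eq_inner)
  define D where "D = (e \<bullet> e) * (f \<bullet> f) - (e \<bullet> f)\<^sup>2"
  have "D > 0" using D by (simp add: D_def)
  \<comment> \<open>The dual basis of \<open>e\<close> and \<open>f\<close>, obtained by inverting
    their Gram matrix; its determinant \<open>D\<close> is positive because the vectors are not
    parallel.\<close>
  define al where "al = ((f \<bullet> f) / D) *\<^sub>R e - ((e \<bullet> f) / D) *\<^sub>R f"
  define be where "be = ((e \<bullet> e) / D) *\<^sub>R f - ((e \<bullet> f) / D) *\<^sub>R e"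
  have dual: "al \<bullet> e = 1" "al \<bullet> f = 0" "be \<bullet> e = 0" "be \<bullet> f = 1"
    using \<open>D > 0\<close>
    by (simp_all add: al_def be_def inner_diff_left inner_commute[of f e] field_simps)
       (simp_all add: D_def power2_eq_square algebra_simps)
  have ex: "x extreme_point_of (convex hull S)"
    if "x \<in> S" "finite S" "S - {x} \<noteq> {}" "\<And>y. y \<in> S - {x} \<Longrightarrow> (s *\<^sub>R al + t *\<^sub>R be) \<bullet> y < (s *\<^sub>R al + t *\<^sub>R be) \<bullet> x"
    for x S s t
  proof -
    have "insert x (S - {x}) = S" using that(1) by auto
    then show ?thesis using extreme_point_of_convex_hull_insert[of "S - {x}" "s *\<^sub>R al + t *\<^sub>R be" x] that by auto
  qed
  have pts: "b = a + e" "d = a + f" "c = a + f + k *\<^sub>R e" using c by (auto simp: e_def f_def algebra_simps)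
  have val: "al \<bullet> b = al \<bullet> a + 1" "al \<bullet> d = al \<bullet> a" "al \<bullet> c = al \<bullet> a + k"
      "be \<bullet> b = be \<bullet> a" "be \<bullet> d = be \<bullet> a + 1" "be \<bullet> c = be \<bullet> a + 1"
    by (simp_all add: pts inner_add_right dual)
  have ne: "a \<noteq> b" "a \<noteq> c" "a \<noteq> d" "b \<noteq> c" "b \<noteq> d" "c \<noteq> d" using val k by auto
  have "a extreme_point_of (convex hull {a, b, c, d})"
    by (rule ex[where s="-1" and t="-1"]) (use ne k in \<open>auto simp: inner_add_left inner_diff_left val\<close>)
  moreover have "b extreme_point_of (convex hull {a, b, c, d})"
    by (rule ex[where s="1" and t="-k"]) (use ne k in \<open>auto simp: inner_add_left inner_diff_left val algebra_simps\<close>)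
  moreover have "c extreme_point_of (convex hull {a, b, c, d})"
    by (rule ex[where s="1" and t="1"]) (use ne k in \<open>auto simp: inner_add_left inner_diff_left val\<close>)
  moreover have "d extreme_point_of (convex hull {a, b, c, d})"
    by (rule ex[where s="-1" and t="1"]) (use ne k in \<open>auto simp: inner_add_left inner_diff_left val\<close>)
  ultimately have "{a, b, c, d} \<subseteq> {x. x extreme_point_of (convex hull {a, b, c, d})}" by auto
  moreover have "{x. x extreme_point_of (convex hull {a, b, c, d})} \<subseteq> {a, b, c, d}"
    by (rule extreme_points_of_convex_hull)
  ultimately show ?thesis using ne by auto
qed

text \<open>Shapes are defined through some representation as a hull. The extreme points recover the
  corners from the set itself, so that a facet can be shown not to have a shape by inspecting its
  finitely many vertices.\<close>

lemma rectangle_extreme_points: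
  fixes F :: "'a::euclidean_space set"
  assumes "is_rectangle F"
  obtains a b c d where "{x. x extreme_point_of F} = {a, b, c, d}" "card {a, b, c, d} = 4"
    "c - d = b - a" "(b - a) \<bullet> (d - a) = 0"
proof -
  obtain a b c d where r: "a \<noteq> b" "a \<noteq> d" "(b - a) \<bullet> (d - a) = 0" "c - d = b - a"
     "F = convex hull {a, b, c, d}"
    using assms unfolding is_rectangle_def by blast
  have "\<not> collinear {0, b - a, d - a}"
    using r(1-3) by (auto simp: norm_cauchy_schwarz_equal[symmetric])
  moreover have "{a, b, d} = {b, a, d}" by auto
  ultimately have "\<not> collinear {a, b, d}" using collinear_3[of b a d] by simp
  from extreme_points_quadrilateral[OF this, of 1 c] r show ?thesis by (intro that[of a b c d]) simp_all
qed

lemma trapezoid_extreme_points: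
  fixes F :: "'a::euclidean_space set"
  assumes "is_trapezoid F"
  obtains a b c d k where "{x. x extreme_point_of F} = {a, b, c, d}" "card {a, b, c, d} = 4"
    "c - d = k *\<^sub>R (b - a)" "0 < k" "k \<noteq> 1"
proof -
  obtain a b c d k where r: "\<not> collinear {a, b, d}" "0 < k" "k \<noteq> 1" "c - d = k *\<^sub>R (b - a)"
     "F = convex hull {a, b, c, d}"
    using assms unfolding is_trapezoid_def by blast
  from extreme_points_quadrilateral[OF r(1,2,4)] r show ?thesis by (intro that[of a b c d k]) simp_all
qed

lemma triangle_extreme_points_card:
  fixes F :: "'a::euclidean_space set"
  assumes "is_triangle F"
  shows "card {x. x extreme_point_of F} \<le> 3"
proof -
  obtain a b c where "F = convex hull {a, b, c}" using assms unfolding is_triangle_def by blast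
  then have "{x. x extreme_point_of F} \<subseteq> {a, b, c}" by (simp add: extreme_points_of_convex_hull)
  then have "card {x. x extreme_point_of F} \<le> card {a, b, c}" by (intro card_mono) auto
  also have "\<dots> \<le> 3" by (simp add: card_insert_if)
  finally show ?thesis .
qed

definition wp_facet :: "(real \<times> real \<times> real) \<times> real \<Rightarrow> (real \<times> real \<times> real) set" where
  "wp_facet n = wiener_polyhedron \<inter> {x. fst n \<bullet> x = snd n}"

definition wp_facet_vertices :: "(real \<times> real \<times> real) \<times> real \<Rightarrow> (real \<times> real \<times> real) set" where
  "wp_facet_vertices n = {v \<in> wp_vertices. fst n \<bullet> v = snd n}"

lemma wp_facet_vertices:
  "wp_facet_vertices ((0,-1,0),0) = {(0,0,0), (1/2,0,0), (1/2,0,1)}"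
  "wp_facet_vertices ((0,1,0),1) = {(0,1,0), (1,1,0), (1,1,1), (1/2,1,1)}"
  "wp_facet_vertices ((0,0,-1),0) = {(0,0,0), (1/2,0,0), (1,1,0), (0,1,0)}"
  "wp_facet_vertices ((0,0,1),1) = {(1/2,0,1), (1,1,1), (1/2,1,1)}"
  "wp_facet_vertices ((-2,0,1),0) = {(0,0,0), (0,1,0), (1/2,1,1), (1/2,0,1)}"
  "wp_facet_vertices ((2,-1,0),1) = {(1/2,0,0), (1/2,0,1), (1,1,1), (1,1,0)}"
  by (auto simp: wp_facet_vertices_def wp_vertices_def)

lemma facets_wiener_polyhedron': "{F. F facet_of wiener_polyhedron} = wp_facet ` wp_normals"
  unfolding facets_wiener_polyhedron wp_facet_def ..

lemma wp_facet_facet: "n \<in> wp_normals \<Longrightarrow> wp_facet n facet_of wiener_polyhedron"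
  using facets_wiener_polyhedron' by blast

lemma vertices_Int_wp_facet: "wp_vertices \<inter> wp_facet n = wp_facet_vertices n"
  using wp_vertices_subset by (auto simp: wp_facet_def wp_facet_vertices_def)

lemma extreme_points_wp_face:
  assumes "F face_of wiener_polyhedron"
  shows "{x. x extreme_point_of F} = wp_vertices \<inter> F"
  using extreme_point_of_face[OF assms] extreme_points_wiener_polyhedron by auto

lemma wp_facet_hull: "n \<in> wp_normals \<Longrightarrow> wp_facet n = convex hull (wp_facet_vertices n)"
  using face_of_wiener_polyhedron_hull[OF facet_of_imp_face_of[OF wp_facet_facet]]
  by (simp add: vertices_Int_wp_facet)

lemma extreme_points_wp_facet: "n \<in> wp_normals \<Longrightarrow> {x. x extreme_point_of wp_facet n} = wp_facet_vertices n"
  using extreme_points_wp_face[OF facet_of_imp_face_of[OF wp_facet_facet]]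
  by (simp add: vertices_Int_wp_facet)

lemma wp_normals_cases [consumes 1]:
  assumes "n \<in> wp_normals"
  obtains "n = ((0,-1,0),0)" | "n = ((0,1,0),1)" | "n = ((0,0,-1),0)" | "n = ((0,0,1),1)"
      | "n = ((-2,0,1),0)" | "n = ((2,-1,0),1)"
  using assms unfolding wp_normals_def by blast

text \<open>No two facets contain the same vertices.\<close>

lemma inj_on_wp_facet: "inj_on wp_facet wp_normals"
proof (rule inj_onI)
  fix n m assume n: "n \<in> wp_normals" "m \<in> wp_normals" and "wp_facet n = wp_facet m"
  then have "fst n \<bullet> v = snd n \<longleftrightarrow> fst m \<bullet> v = snd m" if "v \<in> wp_vertices" for v
    using that wp_vertices_subset unfolding wp_facet_def by blast
  then have "fst n \<bullet> v = snd n \<longleftrightarrow> fst m \<bullet> v = snd m"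
    if "v \<in> {(0, 0, 0), (0, 1, 0), (1, 1, 0), (1, 1, 1), (1/2, 0, 1), (1/2, 0, 0), (1/2, 1, 1)}" for v
    using that by (simp add: wp_vertices_def)
  then have *: "list_all (\<lambda>v. fst n \<bullet> v = snd n \<longleftrightarrow> fst m \<bullet> v = snd m)
     [(0, 0, 0), (0, 1, 0), (1, 1, 0), (1, 1, 1), (1/2, 0, 1), (1/2, 0, 0), (1/2, 1, 1)]"
    by (simp add: list_all_iff)
  from n(1) show "n = m"
    by (cases rule: wp_normals_cases; use n(2) in \<open>cases rule: wp_normals_cases\<close>; use * in simp)
qed

lemma card_wp_normals: "card wp_normals = 6"
  by (simp add: wp_normals_def)

lemma is_triangle_wp_facet:
  assumes "n \<in> wp_normals"
  shows "is_triangle (wp_facet n) \<longleftrightarrow> n \<in> {((0,-1,0),0), ((0,0,1),1)}"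
proof
  assume "is_triangle (wp_facet n)"
  then have "card (wp_facet_vertices n) \<le> 3"
    using triangle_extreme_points_card[of "wp_facet n"] extreme_points_wp_facet[OF assms] by simp
  with assms show "n \<in> {((0,-1,0),0), ((0,0,1),1)}"
    by (cases rule: wp_normals_cases) (simp_all add: wp_facet_vertices)
next
  assume n: "n \<in> {((0,-1,0),0), ((0,0,1),1)}"
  have "\<not> collinear {(0,0,0), (1/2,0,0), (1/2,0,1::real)::real\<times>real\<times>real}"
    unfolding collinear_3_expand by simp
  then have 1: "is_triangle (convex hull {(0,0,0), (1/2,0,0), (1/2,0,1::real)::real\<times>real\<times>real})"
    unfolding is_triangle_def by blast
  have "\<not> collinear {(1/2,0,1), (1,1,1), (1/2,1,1)::real\<times>real\<times>real}"
    unfolding collinear_3_expand by simp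
  then have 2: "is_triangle (convex hull {(1/2,0,1), (1,1,1), (1/2,1,1)::real\<times>real\<times>real})"
    unfolding is_triangle_def by blast
  show "is_triangle (wp_facet n)"
    using n 1 2 unfolding wp_facet_hull[OF assms] by (elim insertE emptyE) (simp_all only: wp_facet_vertices)
qed

text \<open>The diagonals of a rectangle bisect each other, so the sum of all corners is twice the
  sum of two opposite ones. The trapezoids have no pair of vertices with this property, and the
  triangles have too few vertices.\<close>

lemma is_rectangle_wp_facet:
  assumes "n \<in> wp_normals"
  shows "is_rectangle (wp_facet n) \<longleftrightarrow> n \<in> {((-2,0,1),0), ((2,-1,0),1)}"
proof
  assume "is_rectangle (wp_facet n)"
  then obtain a b c d where r0: "{x. x extreme_point_of wp_facet n} = {a, b, c, d}"
    and r: "card {a, b, c, d} = 4" "c - d = b - a" "(b - a) \<bullet> (d - a) = 0"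
    by (rule rectangle_extreme_points)
  note r = r0[unfolded extreme_points_wp_facet[OF assms]] r
  then have cd: "card (wp_facet_vertices n) = 4" by simp
  have el: "a \<in> wp_facet_vertices n" "b \<in> wp_facet_vertices n" "c \<in> wp_facet_vertices n" "d \<in> wp_facet_vertices n"
    using r(1) by auto
  have dist: "a \<noteq> b" "a \<noteq> c" "a \<noteq> d" "b \<noteq> c" "b \<noteq> d" "c \<noteq> d"
    using r(2) by (auto simp: card_insert_if split: if_splits)
  have "\<Sum>(wp_facet_vertices n) = (a + c) + (b + d)"
    unfolding r(1) using dist by (simp add: algebra_simps)
  also have "b + d = a + c" using r(3) by (simp add: algebra_simps)
  finally have diag: "\<Sum>(wp_facet_vertices n) = 2 *\<^sub>R (a + c)"
    by (simp only: scaleR_2)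
  from assms show "n \<in> {((-2,0,1),0), ((2,-1,0),1)}"
  proof (cases rule: wp_normals_cases)
    case 2
    have "\<Sum>(wp_facet_vertices n) = (5/2,4,2)"
      unfolding 2 wp_facet_vertices by simp
    moreover have "\<forall>a\<in>wp_facet_vertices n. \<forall>c\<in>wp_facet_vertices n. 2 *\<^sub>R (a + c) \<noteq> (5/2,4,2)"
      unfolding 2 wp_facet_vertices by simp
    ultimately show ?thesis using el diag by metis
  next
    case 3
    have "\<Sum>(wp_facet_vertices n) = (3/2,2,0)"
      unfolding 3 wp_facet_vertices by simp
    moreover have "\<forall>a\<in>wp_facet_vertices n. \<forall>c\<in>wp_facet_vertices n. 2 *\<^sub>R (a + c) \<noteq> (3/2,2,0)"
      unfolding 3 wp_facet_vertices by simp
    ultimately show ?thesis using el diag by metis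
  qed (use cd in \<open>simp_all add: wp_facet_vertices\<close>)
next
  assume "n \<in> {((-2,0,1),0), ((2,-1,0),1)}"
  then show "is_rectangle (wp_facet n)"
  proof safe
    have "is_rectangle (convex hull {(0,0,0), (0,1,0), (1/2,1,1), (1/2,0,1)::real\<times>real\<times>real})"
      unfolding is_rectangle_def
      by (rule exI[of _ "(0,0,0)"], rule exI[of _ "(0,1,0)"], rule exI[of _ "(1/2,1,1)"], rule exI[of _ "(1/2,0,1)"]) (simp add: zero_prod_def)
    then show "is_rectangle (wp_facet ((-2,0,1),0))"
      by (subst wp_facet_hull) (simp_all add: wp_normals_def wp_facet_vertices)
    have "is_rectangle (convex hull {(1/2,0,0), (1/2,0,1), (1,1,1), (1,1,0)::real\<times>real\<times>real})"
      unfolding is_rectangle_def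
      by (rule exI[of _ "(1/2,0,0)"], rule exI[of _ "(1/2,0,1)"], rule exI[of _ "(1,1,1)"], rule exI[of _ "(1,1,0)"]) (simp add: zero_prod_def)
    then show "is_rectangle (wp_facet ((2,-1,0),1))"
      by (subst wp_facet_hull) (simp_all add: wp_normals_def wp_facet_vertices)
  qed
qed

lemma is_trapezoid_wp_facet:
  assumes "n \<in> wp_normals"
  shows "is_trapezoid (wp_facet n) \<longleftrightarrow> n \<in> {((0,1,0),1), ((0,0,-1),0)}"
proof
  assume "is_trapezoid (wp_facet n)"
  then obtain a b c d k where r0: "{x. x extreme_point_of wp_facet n} = {a, b, c, d}"
    and r: "card {a, b, c, d} = 4" "c - d = k *\<^sub>R (b - a)" "0 < k" "k \<noteq> 1"
    by (rule trapezoid_extreme_points)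
  note r = r0[unfolded extreme_points_wp_facet[OF assms]] r
  then have cd: "card (wp_facet_vertices n) = 4" by simp
  have el: "a \<in> wp_facet_vertices n" "b \<in> wp_facet_vertices n" "c \<in> wp_facet_vertices n" "d \<in> wp_facet_vertices n"
    using r(1) by auto
  have dist: "a \<noteq> b" "a \<noteq> c" "a \<noteq> d" "b \<noteq> c" "b \<noteq> d" "c \<noteq> d"
    using r(2) by (auto simp: card_insert_if split: if_splits)
  have zero: "x = 0" if "y = k * x" "x \<in> {0, 1, -1}" "y \<in> {0, 1, -1}" for x y
    using that r(4,5) by (elim insertE emptyE) auto
  \<comment> \<open>On the rectangles \<open>v, w \<in> {0, 1}\<close> are coordinates, so a proportionality factor between
    edges can only be \<open>1\<close>.\<close>
  have not_rect: False
    if S: "\<forall>p\<in>wp_facet_vertices n. fst (snd p) \<in> {0, 1} \<and> snd (snd p) \<in> {0, 1}"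
      "\<forall>p\<in>wp_facet_vertices n. \<forall>q\<in>wp_facet_vertices n. snd p = snd q \<longrightarrow> p = q"
  proof -
    have "fst (snd c) - fst (snd d) = k * (fst (snd b) - fst (snd a))"
         "snd (snd c) - snd (snd d) = k * (snd (snd b) - snd (snd a))"
      using arg_cong[OF r(3), of "\<lambda>p. fst (snd p)"] arg_cong[OF r(3), of "\<lambda>p. snd (snd p)"] by auto
    note eqs = this
    have diff: "x - y \<in> {0, 1, -1}" if "x \<in> {0, 1}" "y \<in> {0, 1}" for x y :: real
      using that by auto
    have m: "fst (snd a) \<in> {0, 1}" "fst (snd b) \<in> {0, 1}" "fst (snd c) \<in> {0, 1}" "fst (snd d) \<in> {0, 1}"
        "snd (snd a) \<in> {0, 1}" "snd (snd b) \<in> {0, 1}" "snd (snd c) \<in> {0, 1}" "snd (snd d) \<in> {0, 1}"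
      using S(1)[rule_format, OF el(1)] S(1)[rule_format, OF el(2)] S(1)[rule_format, OF el(3)]
        S(1)[rule_format, OF el(4)] by (simp_all only:)
    have "fst (snd b) - fst (snd a) = 0" "snd (snd b) - snd (snd a) = 0"
      by (rule zero[OF eqs(1) diff[OF m(2,1)] diff[OF m(3,4)]],
          rule zero[OF eqs(2) diff[OF m(6,5)] diff[OF m(7,8)]])
    then have "snd b = snd a" by (simp add: prod_eq_iff)
    then have "b = a" by (rule S(2)[rule_format, OF el(2,1)])
    then show False using dist by simp
  qed
  from assms show "n \<in> {((0,1,0),1), ((0,0,-1),0)}"
  proof (cases rule: wp_normals_cases)
    case 5
    have False by (rule not_rect; unfold 5 wp_facet_vertices; simp)
    then show ?thesis ..
  next
    case 6
    have False by (rule not_rect; unfold 6 wp_facet_vertices; simp)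
    then show ?thesis ..
  qed (use cd in \<open>simp_all add: wp_facet_vertices\<close>)
next
  assume "n \<in> {((0,1,0),1), ((0,0,-1),0)}"
  then show "is_trapezoid (wp_facet n)"
  proof safe
    \<comment> \<open>The parallel sides run in the direction of \<open>u\<close>, with lengths
      \<open>1\<close> and \<open>1/2\<close>; on the other trapezoid the shorter side comes first,
      hence the ratios \<open>1/2\<close> and \<open>2\<close>.\<close>
    have "is_trapezoid (convex hull {(0,1,0), (1,1,0), (1,1,1), (1/2,1,1)::real\<times>real\<times>real})"
      unfolding is_trapezoid_def
      by (rule exI[of _ "(0,1,0)"], rule exI[of _ "(1,1,0)"], rule exI[of _ "(1,1,1)"], rule exI[of _ "(1/2,1,1)"],
          rule exI[of _ "1/2"]) (simp add: collinear_3_expand)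
    then show "is_trapezoid (wp_facet ((0,1,0),1))"
      by (subst wp_facet_hull) (simp_all add: wp_normals_def wp_facet_vertices)
    have "is_trapezoid (convex hull {(0,0,0), (1/2,0,0), (1,1,0), (0,1,0)::real\<times>real\<times>real})"
      unfolding is_trapezoid_def
      by (rule exI[of _ "(0,0,0)"], rule exI[of _ "(1/2,0,0)"], rule exI[of _ "(1,1,0)"], rule exI[of _ "(0,1,0)"],
          rule exI[of _ "2"]) (simp add: collinear_3_expand)
    then show "is_trapezoid (wp_facet ((0,0,-1),0))"
      by (subst wp_facet_hull) (simp_all add: wp_normals_def wp_facet_vertices)
  qed
qed

lemma card_facets_wiener_polyhedron:
  shows "card {F. F facet_of wiener_polyhedron} = 6"
    and "card {F. F facet_of wiener_polyhedron \<and> is_rectangle F} = 2"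
    and "card {F. F facet_of wiener_polyhedron \<and> is_trapezoid F} = 2"
    and "card {F. F facet_of wiener_polyhedron \<and> is_triangle F} = 2"
proof -
  show "card {F. F facet_of wiener_polyhedron} = 6"
    unfolding facets_wiener_polyhedron' by (simp add: card_image inj_on_wp_facet card_wp_normals)
  have count: "card {F. F facet_of wiener_polyhedron \<and> Q F} = card M"
    if "M \<subseteq> wp_normals" "\<And>n. n \<in> wp_normals \<Longrightarrow> Q (wp_facet n) \<longleftrightarrow> n \<in> M" for Q M
  proof -
    have "{F. F facet_of wiener_polyhedron \<and> Q F} = {F \<in> wp_facet ` wp_normals. Q F}"
      by (simp flip: facets_wiener_polyhedron')
    also have "\<dots> = wp_facet ` M" using that by auto
    finally have "{F. F facet_of wiener_polyhedron \<and> Q F} = wp_facet ` M" .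
    then show ?thesis using inj_on_subset[OF inj_on_wp_facet that(1)] by (simp add: card_image)
  qed
  show "card {F. F facet_of wiener_polyhedron \<and> is_rectangle F} = 2"
    by (subst count[OF _ is_rectangle_wp_facet]) (auto simp: wp_normals_def)
  show "card {F. F facet_of wiener_polyhedron \<and> is_trapezoid F} = 2"
    by (subst count[OF _ is_trapezoid_wp_facet]) (auto simp: wp_normals_def)
  show "card {F. F facet_of wiener_polyhedron \<and> is_triangle F} = 2"
    by (subst count[OF _ is_triangle_wp_facet]) (auto simp: wp_normals_def)
qed

section \<open>Edges\<close>

definition wp_edges :: "(real \<times> real \<times> real) set set" where
  "wp_edges = {{(0,0,0), (1/2,0,0)}, {(0,0,0), (1/2,0,1)}, {(1/2,0,0), (1/2,0,1)},
     {(0,1,0), (1,1,0)}, {(1,1,1), (1/2,1,1)}, {(0,1,0), (1/2,1,1)}, {(1,1,0), (1,1,1)},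
     {(0,0,0), (0,1,0)}, {(1/2,0,0), (1,1,0)}, {(1/2,0,1), (1/2,1,1)}, {(1/2,0,1), (1,1,1)}}"

lemma wp_facet_face: "n \<in> wp_normals \<Longrightarrow> wp_facet n face_of wiener_polyhedron"
  by (rule facet_of_imp_face_of[OF wp_facet_facet])

lemma aff_dim_wp_facet: "n \<in> wp_normals \<Longrightarrow> aff_dim (wp_facet n) = 2"
  using wp_facet_facet[of n] aff_dim_wiener_polyhedron by (simp add: facet_of_def)

lemma wp_facet_Int:
  assumes "n \<in> wp_normals" "m \<in> wp_normals"
  shows "wp_facet n \<inter> wp_facet m = convex hull (wp_facet_vertices n \<inter> wp_facet_vertices m)"
    and "{x. x extreme_point_of (wp_facet n \<inter> wp_facet m)} = wp_facet_vertices n \<inter> wp_facet_vertices m"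
proof -
  have f: "(wp_facet n \<inter> wp_facet m) face_of wiener_polyhedron"
    using assms by (intro face_of_Int wp_facet_face)
  have "wp_vertices \<inter> (wp_facet n \<inter> wp_facet m) = wp_facet_vertices n \<inter> wp_facet_vertices m"
    using vertices_Int_wp_facet[of n] vertices_Int_wp_facet[of m] by blast
  then show "wp_facet n \<inter> wp_facet m = convex hull (wp_facet_vertices n \<inter> wp_facet_vertices m)"
    and "{x. x extreme_point_of (wp_facet n \<inter> wp_facet m)} = wp_facet_vertices n \<inter> wp_facet_vertices m"
    using face_of_wiener_polyhedron_hull[OF f] extreme_points_wp_face[OF f] by simp_all
qed

text \<open>The intersection of two distinct facets is a proper face of at least one of them, and
  passing to a proper face lowers the dimension.\<close>

lemma aff_dim_wp_facet_Int:
  assumes n: "n \<in> wp_normals" and m: "m \<in> wp_normals" and ne: "n \<noteq> m"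
  shows "aff_dim (wp_facet n \<inter> wp_facet m) < 2"
proof -
  have F: "wp_facet n face_of wiener_polyhedron" "wp_facet m face_of wiener_polyhedron"
    using n m by (simp_all add: wp_facet_face)
  have conv: "convex (wp_facet n)" "convex (wp_facet m)"
    using F face_of_imp_convex convex_wiener_polyhedron by blast+
  have less: "aff_dim (wp_facet n \<inter> wp_facet m) < aff_dim (wp_facet k)"
    if "wp_facet n \<inter> wp_facet m \<noteq> wp_facet k" "k = n \<or> k = m" for k
  proof (rule face_of_aff_dim_lt)
    show "convex (wp_facet k)" using conv that(2) by blast
    show "wp_facet n \<inter> wp_facet m face_of wp_facet k"
      using face_of_subset[OF face_of_Int[OF F]] F that(2) by (blast dest: face_of_imp_subset)
  qed (rule that(1))
  have "wp_facet n \<noteq> wp_facet m" using inj_on_wp_facet n m ne by (auto dest: inj_onD)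
  then have "wp_facet n \<inter> wp_facet m \<noteq> wp_facet n \<or> wp_facet n \<inter> wp_facet m \<noteq> wp_facet m" by blast
  then show ?thesis using less[of n] less[of m] aff_dim_wp_facet[OF n] aff_dim_wp_facet[OF m] by auto
qed

text \<open>An edge is the intersection of the facets containing it, and a single facet is too
  large. Two of them already meet in dimension at most one, and the edge is a face of this
  intersection of the same dimension, hence all of it.\<close>

lemma edge_of_wiener_polyhedron_imp_facet_Int:
  assumes E: "E edge_of wiener_polyhedron"
  obtains n m where "n \<in> wp_normals" "m \<in> wp_normals" "n \<noteq> m" "E = wp_facet n \<inter> wp_facet m"
proof -
  have face: "E face_of wiener_polyhedron" and dim: "aff_dim E = 1"
    using E by (auto simp: edge_of_def)
  have "E \<noteq> {}" "E \<noteq> wiener_polyhedron" using dim aff_dim_wiener_polyhedron by auto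
  then have Eq: "E = \<Inter>{F. F facet_of wiener_polyhedron \<and> E \<subseteq> F}"
    by (intro face_of_polyhedron[OF polyhedron_wiener_polyhedron face])
  obtain F where F: "F facet_of wiener_polyhedron" "E \<subseteq> F"
    using face_of_polyhedron_subset_facet[OF polyhedron_wiener_polyhedron face] \<open>E \<noteq> {}\<close> \<open>E \<noteq> wiener_polyhedron\<close> by blast
  have facet: "\<exists>n\<in>wp_normals. F = wp_facet n" if "F facet_of wiener_polyhedron" for F
    using that facets_wiener_polyhedron' by (metis (mono_tags, lifting) imageE mem_Collect_eq)
  from facet[OF F(1)] obtain n where n: "n \<in> wp_normals" "F = wp_facet n" by (rule bexE)
  have "\<exists>F'. F' facet_of wiener_polyhedron \<and> E \<subseteq> F' \<and> F' \<noteq> F"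
  proof (rule ccontr)
    assume "\<not> ?thesis"
    then have "{F. F facet_of wiener_polyhedron \<and> E \<subseteq> F} = {F}" using F by blast
    then have "\<Inter>{F. F facet_of wiener_polyhedron \<and> E \<subseteq> F} = F" by simp
    then have "E = F" by (rule trans[OF Eq])
    then show False using dim aff_dim_wp_facet[OF n(1)] n(2) by simp
  qed
  then obtain F' where F': "F' facet_of wiener_polyhedron" "E \<subseteq> F'" "F' \<noteq> F" by (elim exE conjE)
  from facet[OF F'(1)] obtain m where "m \<in> wp_normals" "F' = wp_facet m" by (rule bexE)
  with F' n(2) have m: "m \<in> wp_normals" "E \<subseteq> wp_facet m" "wp_facet m \<noteq> wp_facet n" by simp_all
  then have "n \<noteq> m" by blast
  let ?G = "wp_facet n \<inter> wp_facet m"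
  have G: "?G face_of wiener_polyhedron" using n(1) m(1) by (intro face_of_Int wp_facet_face)
  have "E face_of ?G"
    by (rule face_of_subset[OF face]) (use F(2) n(2) m(2) face_of_imp_subset[OF G] in \<open>simp_all\<close>)
  have "E = ?G"
  proof (rule ccontr)
    assume "E \<noteq> ?G"
    then have "aff_dim E < aff_dim ?G"
      using \<open>E face_of ?G\<close> face_of_imp_convex[OF G] convex_wiener_polyhedron by (intro face_of_aff_dim_lt) auto
    then show False using dim aff_dim_wp_facet_Int[OF n(1) m(1) \<open>n \<noteq> m\<close>] by simp
  qed
  then show ?thesis using that n(1) m(1) \<open>n \<noteq> m\<close> by blast
qed

text \<open>Of the fifteen pairs of facets, \<open>v = 0\<close> and \<open>v = 1\<close> are
  disjoint, as are \<open>w = 0\<close> and \<open>w = 1\<close>. Four facets meet at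
  \<open>(1/2,0,1)\<close>, where the two triangles share only this vertex, and so do the two
  rectangles. The remaining eleven pairs give the edges.\<close>

lemma wp_facet_vertices_Int_edge:
  assumes "n \<in> wp_normals" "m \<in> wp_normals" "n \<noteq> m"
  shows "card (wp_facet_vertices n \<inter> wp_facet_vertices m) \<le> 1 \<or> wp_facet_vertices n \<inter> wp_facet_vertices m \<in> wp_edges"
  using assms(1)
  by (cases rule: wp_normals_cases; use assms(2) in \<open>cases rule: wp_normals_cases\<close>;
      use assms(3) in \<open>simp add: wp_facet_vertices wp_edges_def doubleton_eq_iff\<close>)

lemma wp_edges_cases:
  assumes "e \<in> wp_edges"
  shows "\<exists>n\<in>wp_normals. \<exists>m\<in>wp_normals. e = wp_facet_vertices n \<inter> wp_facet_vertices m"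
proof -
  define f where "f = (\<lambda>(n, m). wp_facet_vertices n \<inter> wp_facet_vertices m)"
  define I :: "(((real \<times> real \<times> real) \<times> real) \<times> ((real \<times> real \<times> real) \<times> real)) set" where "I =
     {(((0,-1,0),0), ((0,0,-1),0)), (((0,-1,0),0), ((-2,0,1),0)), (((0,-1,0),0), ((2,-1,0),1)),
      (((0,1,0),1), ((0,0,-1),0)), (((0,1,0),1), ((0,0,1),1)), (((0,1,0),1), ((-2,0,1),0)), (((0,1,0),1), ((2,-1,0),1)),
      (((0,0,-1),0), ((-2,0,1),0)), (((0,0,-1),0), ((2,-1,0),1)), (((0,0,1),1), ((-2,0,1),0)), (((0,0,1),1), ((2,-1,0),1))}"
  have "wp_edges \<subseteq> f ` I"
    by (simp add: f_def I_def wp_facet_vertices wp_edges_def doubleton_eq_iff)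
  moreover have "I \<subseteq> wp_normals \<times> wp_normals" by (simp add: I_def wp_normals_def)
  ultimately have "e \<in> f ` (wp_normals \<times> wp_normals)" using assms by (meson image_mono subsetD)
  then show ?thesis by (auto simp: f_def)
qed

lemma card_wp_edge: "e \<in> wp_edges \<Longrightarrow> card e = 2"
  by (auto simp: wp_edges_def)

lemma edges_wiener_polyhedron: "{E. E edge_of wiener_polyhedron} = (\<lambda>e. convex hull e) ` wp_edges"
proof safe
  fix E assume E: "E edge_of wiener_polyhedron"
  from edge_of_wiener_polyhedron_imp_facet_Int[OF E] obtain n m where
    nm: "n \<in> wp_normals" "m \<in> wp_normals" "n \<noteq> m" "E = wp_facet n \<inter> wp_facet m" by blast
  have hull: "E = convex hull (wp_facet_vertices n \<inter> wp_facet_vertices m)"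
    using wp_facet_Int(1)[OF nm(1,2)] nm(4) by simp
  have "aff_dim E = 1" using E by (simp add: edge_of_def)
  moreover have "aff_dim E \<le> int (card (wp_facet_vertices n \<inter> wp_facet_vertices m)) - 1"
    unfolding hull aff_dim_convex_hull
    by (rule aff_dim_le_card) (simp add: wp_facet_vertices_def wp_vertices_def)
  ultimately have "\<not> card (wp_facet_vertices n \<inter> wp_facet_vertices m) \<le> 1" by linarith
  then show "E \<in> (\<lambda>e. convex hull e) ` wp_edges"
    using wp_facet_vertices_Int_edge[OF nm(1-3)] unfolding hull by (intro imageI) blast
next
  fix e assume e: "e \<in> wp_edges"
  then obtain n m where nm: "n \<in> wp_normals" "m \<in> wp_normals" "e = wp_facet_vertices n \<inter> wp_facet_vertices m"
    using wp_edges_cases by blast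
  have "convex hull e face_of wiener_polyhedron"
    using face_of_Int[OF wp_facet_face wp_facet_face, OF nm(1,2)] wp_facet_Int(1)[OF nm(1,2)] nm(3) by simp
  moreover obtain p q where "e = {p, q}" "p \<noteq> q" using card_wp_edge[OF e] by (auto simp: card_2_iff)
  ultimately show "convex hull e edge_of wiener_polyhedron"
    by (simp add: edge_of_def aff_dim_convex_hull aff_dim_2)
qed

text \<open>Distinct vertex pairs span distinct edges, because the extreme points of an edge recover
  the pair.\<close>

lemma card_edges_wiener_polyhedron: "card {E. E edge_of wiener_polyhedron} = 11"
proof -
  have ext: "{x. x extreme_point_of (convex hull e)} = e" if e: "e \<in> wp_edges" for e
  proof -
    obtain n m where "n \<in> wp_normals" "m \<in> wp_normals" "e = wp_facet_vertices n \<inter> wp_facet_vertices m"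
      using wp_edges_cases[OF e] by (elim bexE)
    then show ?thesis using wp_facet_Int by simp
  qed
  have "inj_on (\<lambda>e. convex hull e) wp_edges"
  proof (rule inj_onI)
    fix e e' assume e: "e \<in> wp_edges" "e' \<in> wp_edges" and "convex hull e = convex hull e'"
    then have "{x. x extreme_point_of (convex hull e)} = {x. x extreme_point_of (convex hull e')}" by simp
    then show "e = e'" using ext[OF e(1)] ext[OF e(2)] by simp
  qed
  then have "card {E. E edge_of wiener_polyhedron} = card wp_edges"
    by (simp add: edges_wiener_polyhedron card_image)
  also have "\<dots> = 11"
    by (simp add: wp_edges_def doubleton_eq_iff)
  finally show ?thesis .
qed

text \<open>\<open>C\<close> is chosen before \<open>t\<close>, and the equivalence with
  \<open>D = C\<close> expresses existence, uniqueness and independence of the time at once. Its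
  witness is the law of the transformed triple at time \<open>1\<close>.\<close>

theorem mainTheorem2:
  fixes \<Omega> :: "'a measure" and W :: "real \<Rightarrow> 'a \<Rightarrow> real"
  assumes "wiener_process \<Omega> W"
  shows "(\<exists>C.
      (\<forall>t>0. \<forall>D. is_copula_of \<Omega> (W t) (running_max W t) (running_min W t) D \<longleftrightarrow> D = C) \<and>
      absolutely_continuous lborel C \<and>
      is_support C wiener_polyhedron) \<and>
    polyhedron wiener_polyhedron \<and>
    {x. x extreme_point_of wiener_polyhedron} =
      {(0, 0, 0), (0, 1, 0), (1, 1, 0), (1, 1, 1), (1/2, 0, 1), (1/2, 0, 0), (1/2, 1, 1)} \<and>
    card {F. F facet_of wiener_polyhedron} = 6 \<and>
    card {F. F facet_of wiener_polyhedron \<and> is_rectangle F} = 2 \<and>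
    card {F. F facet_of wiener_polyhedron \<and> is_trapezoid F} = 2 \<and>
    card {F. F facet_of wiener_polyhedron \<and> is_triangle F} = 2 \<and>
    card {E. E edge_of wiener_polyhedron} = 11"
proof -
  interpret wiener_process \<Omega> W by fact
  have "\<exists>C. (\<forall>t>0. \<forall>D. is_copula_of \<Omega> (W t) (running_max W t) (running_min W t) D \<longleftrightarrow> D = C) \<and>
      absolutely_continuous lborel C \<and> is_support C wiener_polyhedron"
    by (rule exI[of _ "distr \<Omega> borel (\<lambda>\<omega>. wiener_copula_map (path_triple W 1 \<omega>))"])
       (intro conjI allI impI is_copula_of_wiener_iff absolutely_continuous_wiener_copula
         is_support_wiener_copula[OF closed_wiener_polyhedron])
  then show ?thesis
    by (intro conjI polyhedron_wiener_polyhedron card_facets_wiener_polyhedron card_edges_wiener_polyhedron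
        extreme_points_wiener_polyhedron[unfolded wp_vertices_def])
qed

end
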